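(* Let $\Sigma\subset\mathbf{R}^3$ be a simply connected minimal surface other than a whole plane, with its conformal metric $\wp$. Let $\tilde 0\in\Sigma$ and $0<\rho_1<\rho_2$. Then for every geodesic annulus $A_\wp(\tilde 0,\rho_1,\rho_2)\subset\Sigma$, $$\frac{\rho_2}{\rho_1}>\frac12\,\mathrm{Mod}\big(A_\wp(\tilde 0,\rho_1,\rho_2)\big)^2+1 .$$ Equivalently, for the circular annulus $A=A(\rho_1,\rho_2)=\{x\in\mathbf{R}^2:\rho_1<|x|<\rho_2\}$, regarded as a subset of $T_{\tilde 0}\Sigma\cong\mathbf{R}^2$, and the Riemannian exponential map $\exp_{\tilde 0}$ of $(\Sigma,\wp)$ at $\tilde 0$, $$e^{\mathrm{Mod}(A)}>\frac12\,\mathrm{Mod}\big(\exp_{\tilde 0}(A)\big)^2+1 .$$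
   Context: The metric $\wp$ is the conformal metric on $\Sigma$ induced from $\mathbf{R}^3$, with $\Sigma$ regarded as a Riemann surface through conformal (isothermal) parameters. Distance: $d_\wp$ is the distance on $\Sigma$ induced by $\wp$. Geodesic disk: $B_\wp(\tilde 0,\rho)=\{q\in\Sigma: d_\wp(\tilde 0,q)<\rho\}$ is called a geodesic disk if it is disjoint from the cut locus of $\tilde 0$ and is the diffeomorphic image of the Euclidean disk $D(0,\rho)\subset T_{\tilde 0}\Sigma$ under the exponential map $\exp_{\tilde 0}$. Geodesic annulus: $A_\wp(\tilde 0,\rho_1,\rho_2)=\{q\in\Sigma:\rho_1<d_\wp(\tilde 0,q)<\rho_2\}$, where $B_\wp(\tilde 0,\rho_2)$ is a geodesic disk. Conformal modulus: for a doubly connected domain $\mathcal{A}$ in the plane or in a Riemann surface, $\mathrm{Mod}(\mathcal{A})=\log\frac{r_2}{r_1}$, where $r_1$ and $r_2$ are the inner and outer radii of a circular annulus $\{z\in\mathbf{C}:r_1<|z|<r_2\}$ conformally equivalent to $\mathcal{A}$. *)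

theory Defs
  imports "HOL-Analysis.Analysis"
begin

section \<open>Smooth maps of two real variables\<close>

text \<open>The parameter plane is \<open>complex\<close>, the point \<open>x + iy\<close> standing for the real pair \<open>(x, y)\<close>.\<close>

definition pd_x :: "(complex \<Rightarrow> 'b::real_normed_vector) \<Rightarrow> complex \<Rightarrow> 'b" where
  "pd_x f z = frechet_derivative f (at z) 1"

definition pd_y :: "(complex \<Rightarrow> 'b::real_normed_vector) \<Rightarrow> complex \<Rightarrow> 'b" where
  "pd_y f z = frechet_derivative f (at z) \<i>"

text \<open>\<open>C_times k f U\<close>: \<open>f\<close> is of class \<open>C^k\<close> on the open set \<open>U\<close>.\<close>

primrec C_times :: "nat \<Rightarrow> (complex \<Rightarrow> 'b::real_normed_vector) \<Rightarrow> complex set \<Rightarrow> bool" where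
  "C_times 0 f U = continuous_on U f"
| "C_times (Suc k) f U =
     (f differentiable_on U \<and> C_times k (pd_x f) U \<and> C_times k (pd_y f) U)"

definition C_infinity :: "(complex \<Rightarrow> 'b::real_normed_vector) \<Rightarrow> complex set \<Rightarrow> bool" where
  "C_infinity f U \<longleftrightarrow> (\<forall>k. C_times k f U)"

section \<open>Immersed surfaces\<close>

text \<open>
  A surface is a set \<open>S\<close> in a Hausdorff, second countable space, together with an immersion \<open>X\<close>
  of \<open>S\<close> into a Euclidean space. An embedded surface \<open>S\<close> of \<open>\<real>^3\<close> is the case in which
  \<open>X\<close> is the identity. No atlas has to be carried along: since \<open>X\<close> is an immersion, the smooth
  local parametrizations of \<open>S\<close> are exactly those homeomorphisms \<open>\<phi>\<close> from an open subset of the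
  plane onto an open subset of \<open>S\<close> for which \<open>X \<circ> \<phi>\<close> is smooth with injective
  differential. In particular, \<open>regular_param X S U \<phi> V\<close> also says that \<open>\<phi>\<close> is a
  diffeomorphism of \<open>U\<close> onto the open subset \<open>V\<close> of the surface.
\<close>

definition regular_param ::
  "('a::topological_space \<Rightarrow> 'b::euclidean_space) \<Rightarrow> 'a set \<Rightarrow> complex set \<Rightarrow> (complex \<Rightarrow> 'a) \<Rightarrow> 'a set \<Rightarrow> bool"
  where
  "regular_param X S U \<phi> V \<longleftrightarrow>
     open U \<and> openin (top_of_set S) V \<and> (\<exists>\<psi>. homeomorphism U V \<phi> \<psi>) \<and>
     C_infinity (X \<circ> \<phi>) U \<and> (\<forall>z\<in>U. inj (frechet_derivative (X \<circ> \<phi>) (at z)))"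

definition immersed_surface :: "('a::topological_space \<Rightarrow> 'b::euclidean_space) \<Rightarrow> 'a set \<Rightarrow> bool" where
  "immersed_surface X S \<longleftrightarrow> (\<forall>p\<in>S. \<exists>U \<phi> V. regular_param X S U \<phi> V \<and> p \<in> V)"

text \<open>Tangent planes are identified with their images in the ambient space under the differential of \<open>X\<close>.\<close>

definition tangent_plane :: "('a::topological_space \<Rightarrow> 'b::euclidean_space) \<Rightarrow> 'a set \<Rightarrow> 'a \<Rightarrow> 'b set" where
  "tangent_plane X S p =
     {v. \<exists>U \<phi> V z. regular_param X S U \<phi> V \<and> z \<in> U \<and> \<phi> z = p \<and>
           v \<in> range (frechet_derivative (X \<circ> \<phi>) (at z))}"

section \<open>Minimal surfaces\<close>

text \<open>
  The mean curvature \<open>(E n - 2 F m + G l) / (2 (E G - F^2))\<close> of a parametrized surface in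
  \<open>\<real>^3\<close>, with \<open>E, F, G\<close> and \<open>l, m, n\<close> the coefficients of its first and second
  fundamental forms.
\<close>

definition unit_normal :: "(complex \<Rightarrow> real^3) \<Rightarrow> complex \<Rightarrow> real^3" where
  "unit_normal Y z = sgn (cross3 (pd_x Y z) (pd_y Y z))"

definition mean_curvature :: "(complex \<Rightarrow> real^3) \<Rightarrow> complex \<Rightarrow> real" where
  "mean_curvature Y z =
    (let E = pd_x Y z \<bullet> pd_x Y z; F = pd_x Y z \<bullet> pd_y Y z; G = pd_y Y z \<bullet> pd_y Y z;
         l = pd_x (pd_x Y) z \<bullet> unit_normal Y z;
         m = pd_y (pd_x Y) z \<bullet> unit_normal Y z;
         n = pd_y (pd_y Y) z \<bullet> unit_normal Y z
     in (E * n - 2 * F * m + G * l) / (2 * (E * G - F\<^sup>2)))"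

definition minimal_surface :: "('a::topological_space \<Rightarrow> real^3) \<Rightarrow> 'a set \<Rightarrow> bool" where
  "minimal_surface X S \<longleftrightarrow>
     immersed_surface X S \<and>
     (\<forall>U \<phi> V. regular_param X S U \<phi> V \<longrightarrow> (\<forall>z\<in>U. mean_curvature (X \<circ> \<phi>) z = 0))"

definition whole_plane :: "('a \<Rightarrow> real^3) \<Rightarrow> 'a set \<Rightarrow> bool" where
  "whole_plane X S \<longleftrightarrow> inj_on X S \<and> affine (X ` S) \<and> aff_dim (X ` S) = 2"

section \<open>Distance, geodesics and the exponential map of the induced metric\<close>

text \<open>
  The Isabelle notion of a piecewise \<open>C^1\<close> path allows an unbounded derivative near the finitely
  many exceptional points; \<open>has_integral\<close> restricts the infimum to paths of finite length.
\<close>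

definition surface_dist :: "('a::topological_space \<Rightarrow> 'b::euclidean_space) \<Rightarrow> 'a set \<Rightarrow> 'a \<Rightarrow> 'a \<Rightarrow> real" where
  "surface_dist X S p q =
     Inf {L. \<exists>\<gamma>. path \<gamma> \<and> path_image \<gamma> \<subseteq> S \<and> pathstart \<gamma> = p \<and> pathfinish \<gamma> = q \<and>
                 valid_path (X \<circ> \<gamma>) \<and>
                 ((\<lambda>t. norm (vector_derivative (X \<circ> \<gamma>) (at t))) has_integral L) {0..1}}"

text \<open>
  The covariant derivative of the velocity is the tangential part of the acceleration in the ambient
  space, so \<open>\<gamma>\<close> is a geodesic iff the acceleration of \<open>X \<circ> \<gamma>\<close> is normal to the
  surface. The parameter interval is \<open>[0,1]\<close> and \<open>v\<close> is the initial velocity.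
\<close>

definition geodesic_from ::
  "('a::topological_space \<Rightarrow> 'b::euclidean_space) \<Rightarrow> 'a set \<Rightarrow> 'a \<Rightarrow> 'b \<Rightarrow> (real \<Rightarrow> 'a) \<Rightarrow> bool" where
  "geodesic_from X S p v \<gamma> \<longleftrightarrow>
     path \<gamma> \<and> path_image \<gamma> \<subseteq> S \<and> pathstart \<gamma> = p \<and>
     (\<exists>vel acc. vel 0 = v \<and>
        (\<forall>t\<in>{0..1}.
           ((X \<circ> \<gamma>) has_vector_derivative vel t) (at t within {0..1}) \<and>
           (vel has_vector_derivative acc t) (at t within {0..1}) \<and>
           (\<forall>w\<in>tangent_plane X S (\<gamma> t). acc t \<bullet> w = 0)))"

text \<open>The surface need not be complete, so the exponential map is defined only on \<open>exp_dom\<close>.\<close>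

definition exp_dom :: "('a::topological_space \<Rightarrow> 'b::euclidean_space) \<Rightarrow> 'a set \<Rightarrow> 'a \<Rightarrow> 'b set" where
  "exp_dom X S p = {v \<in> tangent_plane X S p. \<exists>\<gamma>. geodesic_from X S p v \<gamma>}"

definition exp_map :: "('a::topological_space \<Rightarrow> 'b::euclidean_space) \<Rightarrow> 'a set \<Rightarrow> 'a \<Rightarrow> 'b \<Rightarrow> 'a" where
  "exp_map X S p v = (THE q. \<exists>\<gamma>. geodesic_from X S p v \<gamma> \<and> pathfinish \<gamma> = q)"

text \<open>A cut point of \<open>p\<close> is the last point up to which a geodesic starting at \<open>p\<close> is minimizing.\<close>

definition cut_locus :: "('a::topological_space \<Rightarrow> 'b::euclidean_space) \<Rightarrow> 'a set \<Rightarrow> 'a \<Rightarrow> 'a set" where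
  "cut_locus X S p =
     exp_map X S p `
       {v \<in> exp_dom X S p. v \<noteq> 0 \<and> surface_dist X S p (exp_map X S p v) = norm v \<and>
          (\<forall>s>1. s *\<^sub>R v \<in> exp_dom X S p \<longrightarrow>
                 surface_dist X S p (exp_map X S p (s *\<^sub>R v)) < norm (s *\<^sub>R v))}"

definition surface_ball :: "('a::topological_space \<Rightarrow> 'b::euclidean_space) \<Rightarrow> 'a set \<Rightarrow> 'a \<Rightarrow> real \<Rightarrow> 'a set" where
  "surface_ball X S p \<rho> = {q \<in> S. surface_dist X S p q < \<rho>}"

text \<open>The linear isometry \<open>\<iota>\<close> is an identification of the plane with the tangent plane at \<open>p\<close>.\<close>

definition geodesic_disk :: "('a::topological_space \<Rightarrow> 'b::euclidean_space) \<Rightarrow> 'a set \<Rightarrow> 'a \<Rightarrow> real \<Rightarrow> bool" where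
  "geodesic_disk X S p \<rho> \<longleftrightarrow>
     surface_ball X S p \<rho> \<inter> cut_locus X S p = {} \<and>
     {v \<in> tangent_plane X S p. norm v < \<rho>} \<subseteq> exp_dom X S p \<and>
     (\<exists>\<iota>. linear \<iota> \<and> (\<forall>z. norm (\<iota> z) = norm z) \<and> range \<iota> = tangent_plane X S p \<and>
          regular_param X S (ball 0 \<rho>) (exp_map X S p \<circ> \<iota>) (surface_ball X S p \<rho>))"

definition surface_annulus ::
  "('a::topological_space \<Rightarrow> 'b::euclidean_space) \<Rightarrow> 'a set \<Rightarrow> 'a \<Rightarrow> real \<Rightarrow> real \<Rightarrow> 'a set" where
  "surface_annulus X S p \<rho>1 \<rho>2 =
     {q \<in> S. \<rho>1 < surface_dist X S p q \<and> surface_dist X S p q < \<rho>2}"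

definition tangent_annulus ::
  "('a::topological_space \<Rightarrow> 'b::euclidean_space) \<Rightarrow> 'a set \<Rightarrow> 'a \<Rightarrow> real \<Rightarrow> real \<Rightarrow> 'b set" where
  "tangent_annulus X S p \<rho>1 \<rho>2 = {v \<in> tangent_plane X S p. \<rho>1 < norm v \<and> norm v < \<rho>2}"

section \<open>Conformal modulus\<close>

definition isothermal_param ::
  "('a::topological_space \<Rightarrow> 'b::euclidean_space) \<Rightarrow> 'a set \<Rightarrow> complex set \<Rightarrow> (complex \<Rightarrow> 'a) \<Rightarrow> 'a set \<Rightarrow> bool"
  where
  "isothermal_param X S U \<phi> V \<longleftrightarrow>
     regular_param X S U \<phi> V \<and>
     (\<forall>z\<in>U. norm (pd_x (X \<circ> \<phi>) z) = norm (pd_y (X \<circ> \<phi>) z) \<and>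
            pd_x (X \<circ> \<phi>) z \<bullet> pd_y (X \<circ> \<phi>) z = 0)"

text \<open>
  The complex structure of the surface is the one given by its isothermal parameters, so a conformal
  equivalence between a plane domain \<open>U\<close> and a domain \<open>V\<close> of the surface is an isothermal
  parametrization of \<open>V\<close> by \<open>U\<close>.

  \<open>has_conformal_modulus X S A M\<close> says that \<open>A\<close> is conformally equivalent to a circular
  annulus with radii \<open>r1 < r2\<close> and that \<open>M = ln (r2 / r1)\<close>. The degenerate radii \<open>r1 = 0\<close>
  and \<open>r2 = \<infinity>\<close> are admitted, with modulus \<open>\<infinity>\<close>: every doubly connected domain is
  conformally equivalent to an annulus in this extended sense, and the value \<open>M\<close> does not depend
  on the choice of the annulus.
\<close>

definition circular_annulus :: "ereal \<Rightarrow> ereal \<Rightarrow> complex set" where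
  "circular_annulus r1 r2 = {z. r1 < ereal (norm z) \<and> ereal (norm z) < r2}"

definition has_conformal_modulus ::
  "('a::topological_space \<Rightarrow> 'b::euclidean_space) \<Rightarrow> 'a set \<Rightarrow> 'a set \<Rightarrow> ereal \<Rightarrow> bool" where
  "has_conformal_modulus X S A M \<longleftrightarrow>
     (\<exists>r1 r2 h. 0 \<le> r1 \<and> r1 < r2 \<and> isothermal_param X S (circular_annulus r1 r2) h A \<and>
        M = (if r1 = 0 \<or> r2 = \<infinity> then \<infinity>
             else ereal (ln (real_of_ereal r2 / real_of_ereal r1))))"

end

theory Submission
  imports Defs
begin

text \<open>
  In geodesic polar coordinates the metric of the disk is \<open>dr\<^sup>2 + f\<^sup>2 d\<theta>\<^sup>2\<close> (Gauss), and minimality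
  forces \<open>f'' = - K f \<ge> 0\<close>, so that \<open>f \<ge> r\<close>: the exponential map is an isometry along rays and
  stretches circles. An annulus whose circles are stretched has the smaller modulus, by the
  length-area method: if \<open>\<Phi>\<close> is the logarithm of the modulus of the conformal coordinate, then
  along every ray \<open>\<Phi>\<close> changes by the modulus \<open>M\<close>, while \<open>2 \<bar>\<Phi>\<^sub>t\<bar> \<le> \<Phi>\<^sub>t\<^sup>2 + 1\<close> in the logarithmic
  coordinates \<open>(t, \<theta>) = (ln r, \<theta>)\<close> and \<open>\<Phi>\<^sub>t\<^sup>2\<close> is at most the Jacobian of the logarithm of the
  conformal coordinate, whose integral is at most \<open>2 \<pi> M\<close>. Hence \<open>2 \<pi> M \<le> (2 \<pi> M + 2 \<pi> ln (\<rho>2 / \<rho>1)) / 2\<close>,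
  that is \<open>M \<le> ln (\<rho>2 / \<rho>1)\<close>, and \<open>1 + M\<^sup>2 / 2 < exp M\<close>.
\<close>

section \<open>Length-area estimate for conformal annuli\<close>

text \<open>The modulus is given by an arbitrary isothermal parametrization, over an annulus that
  may be degenerate and without any boundary values; it may also interchange the two ends. The
  length-area estimate is therefore made for radii \<open>s1 < s2\<close> strictly inside the
  conformal annulus, with a bound independent of them, and exhausting the annulus both excludes
  infinite modulus and gives the inequality. The surface is accessible only through the immersion,
  so neither Christoffel symbols nor the Gauss curvature occur: f'' \<ge> 0 comes from
  differentiating, across the rays, the fact that radial accelerations are normal, in Cartesian
  normal coordinates, which are regular at the centre. Two definitions shape the rest.
  \<open>exp_map\<close> is a definite description, so rays are known to be geodesics only after
  uniqueness has been proved; and the annulus is defined by distance, so the distance from the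
  centre to exp(v) has to be shown equal to |v|, which again rests on the chart being
  expanding.\<close>

lemma Basis_real2: "Basis = {axis 1 1, axis 2 1 :: real^2}"
  by (auto simp: Basis_vec_def UNIV_2)

lemma axis_1_neq_2: "(axis 1 1 :: real^2) \<noteq> axis 2 1"
  by (simp add: axis_eq_axis)

lemma vector2_measurable [measurable]:
  "(\<lambda>(s, t). vector [s, t] :: real^2) \<in> borel_measurable (borel \<Otimes>\<^sub>M borel)"
proof -
  have "(\<lambda>(s, t). vector [s, t] :: real^2) = (\<lambda>p. fst p *\<^sub>R axis 1 1 + snd p *\<^sub>R axis 2 1)"
    by (auto simp: vec_eq_iff forall_2 axis_def)
  moreover have "continuous_on UNIV (\<lambda>p::real \<times> real. fst p *\<^sub>R axis 1 1 + snd p *\<^sub>R axis 2 1 :: real^2)"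
    by (intro continuous_intros)
  ultimately show ?thesis
    using borel_measurable_continuous_onI by (simp add: borel_prod)
qed

text \<open>The change of variables by the Jacobian determinant is made on \<open>real^2\<close>,
  while iterated integrals belong to product measures. The two measures agree because they agree on
  boxes.\<close>

lemma lborel_real2: "(lborel :: (real^2) measure) = distr (lborel \<Otimes>\<^sub>M lborel) borel (\<lambda>(s, t). vector [s, t])"
proof (rule lborel_eqI)
  fix l u :: "real^2" assume lu: "\<And>b. b \<in> Basis \<Longrightarrow> l \<bullet> b \<le> u \<bullet> b"
  have le: "l$1 \<le> u$1" "l$2 \<le> u$2"
    using lu[of "axis 1 1"] lu[of "axis 2 1"] by (auto simp: Basis_real2 inner_axis)
  have *: "(\<lambda>(s, t). vector [s, t]) -` box l u \<inter> space (lborel \<Otimes>\<^sub>M lborel) = {l$1<..<u$1} \<times> {l$2<..<u$2}"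
    by (auto simp: mem_box Basis_real2 inner_axis space_pair_measure)
  show "emeasure (distr (lborel \<Otimes>\<^sub>M lborel) borel (\<lambda>(s, t). vector [s, t])) (box l u) = (\<Prod>b\<in>Basis. (u - l) \<bullet> b)"
    by (subst emeasure_distr) (use le in \<open>auto simp: * lborel.emeasure_pair_measure_Times Basis_real2
       axis_1_neq_2 inner_axis inner_diff_left ennreal_mult\<close>)
qed simp

lemma nn_integral_real2:
  fixes f :: "real^2 \<Rightarrow> ennreal"
  assumes [measurable]: "f \<in> borel_measurable borel"
  shows "(\<integral>\<^sup>+x. f x \<partial>lborel) = (\<integral>\<^sup>+t. (\<integral>\<^sup>+s. f (vector [s, t]) \<partial>lborel) \<partial>lborel)"
proof -
  have "(\<integral>\<^sup>+x. f x \<partial>lborel) = (\<integral>\<^sup>+p. f (case p of (s, t) \<Rightarrow> vector [s, t]) \<partial>(lborel \<Otimes>\<^sub>M lborel))"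
    by (subst lborel_real2, subst nn_integral_distr) auto
  also have "\<dots> = (\<integral>\<^sup>+t. (\<integral>\<^sup>+s. f (vector [s, t]) \<partial>lborel) \<partial>lborel)"
    by (subst lborel_pair.nn_integral_snd[symmetric]) (auto simp: case_prod_beta')
  finally show ?thesis .
qed

section \<open>Crossings along rays and behaviour at the ends of an annulus\<close>

text \<open>Here \<open>b\<close> is the first time at which f reaches \<beta>, and \<open>a\<close>
  the last time before \<open>b\<close> at which f is at most \<alpha>; between them f stays
  strictly inside the band. A ray thus has a stretch on which the whole change takes place inside
  the shell whose area is counted.\<close>

lemma monotone_crossing:
  fixes f :: "real \<Rightarrow> real"
  assumes cont: "continuous_on {c..d} f" and "c \<le> d" "f c \<le> \<alpha>" "\<alpha> < \<beta>" "\<beta> \<le> f d"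
  obtains a b where "c \<le> a" "a < b" "b \<le> d" "f a = \<alpha>" "f b = \<beta>" "\<And>t. a < t \<Longrightarrow> t < b \<Longrightarrow> \<alpha> < f t \<and> f t < \<beta>"
proof -
  define B where "B = {t\<in>{c..d}. \<beta> \<le> f t}"
  have "closed B" unfolding B_def
    by (intro continuous_on_closed_Collect_le) (auto intro: cont continuous_intros)
  define b where "b = Inf B"
  have bdB: "bdd_below B" "B \<noteq> {}" using assms by (auto simp: B_def intro!: bdd_belowI[of _ c])
  have bB: "b \<in> B" unfolding b_def by (rule closed_contains_Inf) fact+
  have b1: "f t < \<beta>" if "c \<le> t" "t < b" for t
    using cInf_lower[OF _ bdB(1), of t] that bB unfolding b_def[symmetric] by (fastforce simp: B_def)
  have cb: "continuous_on {c..b} f" using bB by (intro continuous_on_subset[OF cont]) (auto simp: B_def)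
  define A where "A = {t\<in>{c..b}. f t \<le> \<alpha>}"
  have "closed A" unfolding A_def
    by (intro continuous_on_closed_Collect_le) (auto intro: cb continuous_intros)
  define a where "a = Sup A"
  have bdA: "bdd_above A" "A \<noteq> {}" using assms bB by (auto simp: A_def B_def intro!: bdd_aboveI[of _ b])
  have aA: "a \<in> A" unfolding a_def by (rule closed_contains_Sup) fact+
  have a1: "\<alpha> < f t" if "a < t" "t \<le> b" for t
    using cSup_upper[OF _ bdA(1), of t] that aA unfolding a_def[symmetric] by (fastforce simp: A_def)
  have ab: "a < b" using aA bB assms by (force simp: A_def B_def less_le)
  have c2: "continuous_on {a..b} f" using aA by (intro continuous_on_subset[OF cb]) (auto simp: A_def)
  obtain x where "a \<le> x" "x \<le> b" "f x = \<alpha>"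
    using IVT'[of f a \<alpha> b] aA bB assms c2 ab by (auto simp: A_def B_def)
  then have fa: "f a = \<alpha>" using a1[of x] by (cases "x = a") auto
  obtain y where "a \<le> y" "y \<le> b" "f y = \<beta>"
    using IVT'[of f a \<beta> b] aA bB assms c2 ab by (auto simp: A_def B_def)
  then have fb: "f b = \<beta>" using b1[of y] aA by (cases "y = b") (auto simp: A_def)
  show ?thesis using that[of a b] ab fa fb a1 b1 aA bB by (auto simp: A_def B_def)
qed

text \<open>The shell between \<open>s1\<close> and \<open>s2\<close> is compact, hence so is its
  preimage, and near either end of the source |g| lies outside the band. A collar is connected, so
  |g| stays on one side of the band there. Both collars cannot be on the same side, since g is onto
  and maps what remains between them to a compact set. The disjunction records the two possible
  orientations of g.\<close>

lemma annulus_homeomorphism_ends: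
  fixes g k :: "complex \<Rightarrow> complex"
  assumes \<rho>: "0 < \<rho>1" "\<rho>1 < \<rho>2"
    and hom: "homeomorphism {z. \<rho>1 < norm z \<and> norm z < \<rho>2} {w. R1 < ereal (norm w) \<and> ereal (norm w) < R2} g k"
    and s: "0 \<le> R1" "s1 < s2" "R1 < ereal s1" "ereal s2 < R2"
  obtains c d where "\<rho>1 < c" "c < d" "d < \<rho>2"
    "(\<forall>z. norm z = c \<longrightarrow> norm (g z) \<le> s1) \<and> (\<forall>z. norm z = d \<longrightarrow> s2 \<le> norm (g z)) \<or>
     (\<forall>z. norm z = c \<longrightarrow> s2 \<le> norm (g z)) \<and> (\<forall>z. norm z = d \<longrightarrow> norm (g z) \<le> s1)"
proof -
  have "0 < ereal s1" using s by (metis le_less_trans)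
  then have "0 < s1" by simp
  note s = this s
  define \<Omega> where "\<Omega> = {z::complex. \<rho>1 < norm z \<and> norm z < \<rho>2}"
  define \<Omega>' where "\<Omega>' = {w::complex. R1 < ereal (norm w) \<and> ereal (norm w) < R2}"
  have gk: "continuous_on \<Omega> g" "continuous_on \<Omega>' k" "g ` \<Omega> = \<Omega>'" "k ` \<Omega>' = \<Omega>"
    "\<And>z. z \<in> \<Omega> \<Longrightarrow> k (g z) = z" "\<And>w. w \<in> \<Omega>' \<Longrightarrow> g (k w) = w"
    using hom unfolding homeomorphism_def \<Omega>_def \<Omega>'_def by auto
  define K where "K = {w::complex. s1 \<le> norm w \<and> norm w \<le> s2}"
  have K\<Omega>: "K \<subseteq> \<Omega>'" using s unfolding K_def \<Omega>'_def
    by (auto intro: less_le_trans[of R1 "ereal s1"] le_less_trans[of _ "ereal s2" R2])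
  have "closed K" unfolding K_def
    by (intro closed_Collect_conj closed_Collect_le continuous_intros)
  moreover have "K \<subseteq> cball 0 s2" by (auto simp: K_def)
  ultimately have "compact K" using compact_Int_closed[OF compact_cball, of K 0 s2] by (simp add: Int_absorb1)
  have "of_real s1 \<in> K" using s by (auto simp: K_def)
  then have Kne: "k ` K \<noteq> {}" by auto
  have "compact (k ` K)" using \<open>compact K\<close> gk K\<Omega> by (meson compact_continuous_image continuous_on_subset)
  obtain za where za: "za \<in> k ` K" "\<And>z. z \<in> k ` K \<Longrightarrow> norm za \<le> norm z"
    using continuous_attains_inf[OF \<open>compact (k ` K)\<close> Kne, of norm] by (auto intro: continuous_intros)
  obtain zb where zb: "zb \<in> k ` K" "\<And>z. z \<in> k ` K \<Longrightarrow> norm z \<le> norm zb"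
    using continuous_attains_sup[OF \<open>compact (k ` K)\<close> Kne, of norm] by (auto intro: continuous_intros)
  have kK: "k ` K \<subseteq> \<Omega>" using K\<Omega> gk by auto
  define c where "c = (\<rho>1 + norm za) / 2"
  define d where "d = (norm zb + \<rho>2) / 2"
  have cd: "\<rho>1 < c" "c < norm za" "norm za \<le> norm zb" "norm zb < d" "d < \<rho>2"
    using za zb kK by (auto simp: c_def d_def \<Omega>_def subset_iff)
  have out: "g z \<notin> K" if "z \<in> \<Omega>" "norm z \<le> c \<or> d \<le> norm z" for z
  proof
    assume "g z \<in> K"
    then have "z \<in> k ` K" using gk(5)[OF that(1)] by force
    with za(2)[of z] zb(2)[of z] cd that show False by linarith
  qed
  have alt: "(\<forall>z\<in>I. norm (g z) < s1) \<or> (\<forall>z\<in>I. s2 < norm (g z))"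
    if I: "connected I" "I \<subseteq> \<Omega>" "\<And>z. z \<in> I \<Longrightarrow> norm z \<le> c \<or> d \<le> norm z" for I
  proof (rule ccontr)
    assume "\<not> ?thesis"
    then obtain z1 z2 where z: "z1 \<in> I" "s1 \<le> norm (g z1)" "z2 \<in> I" "norm (g z2) \<le> s2" by force
    with out[of z1] out[of z2] I have "s2 < norm (g z1)" "norm (g z2) < s1" by (auto simp: K_def not_le)
    moreover have "connected ((\<lambda>z. norm (g z)) ` I)"
      using I gk(1) by (intro connected_continuous_image continuous_intros) (auto intro: continuous_on_subset)
    ultimately have "s1 \<in> (\<lambda>z. norm (g z)) ` I"
      using z s connectedD_interval[of "(\<lambda>z. norm (g z)) ` I" "norm (g z2)" "norm (g z1)" s1] by force
    then obtain z3 where "z3 \<in> I" "norm (g z3) = s1" by auto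
    with out[of z3] I s show False by (auto simp: K_def)
  qed
  define In where "In = {z::complex. \<rho>1 < norm z \<and> norm z \<le> c}"
  define Out where "Out = {z::complex. d \<le> norm z \<and> norm z < \<rho>2}"
  have altIn: "(\<forall>z\<in>In. norm (g z) < s1) \<or> (\<forall>z\<in>In. s2 < norm (g z))"
    using connected_annulus(2)[where a="0::complex" and ?r1.0="\<rho>1" and ?r2.0=c] cd
    by (intro alt) (auto simp: In_def \<Omega>_def)
  have altOut: "(\<forall>z\<in>Out. norm (g z) < s1) \<or> (\<forall>z\<in>Out. s2 < norm (g z))"
    using connected_annulus(3)[where a="0::complex" and ?r1.0=d and ?r2.0="\<rho>2"] cd
    by (intro alt) (auto simp: Out_def \<Omega>_def)
  define C where "C = {z::complex. c \<le> norm z \<and> norm z \<le> d}"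
  have C\<Omega>: "C \<subseteq> \<Omega>" using cd by (auto simp: C_def \<Omega>_def)
  have "closed C" unfolding C_def
    by (intro closed_Collect_conj closed_Collect_le continuous_intros)
  moreover have "C \<subseteq> cball 0 d" by (auto simp: C_def)
  ultimately have "compact C" using compact_Int_closed[OF compact_cball, of C 0 d] by (simp add: Int_absorb1)
  then have cgC: "compact (g ` C)" using gk(1) C\<Omega> by (meson compact_continuous_image continuous_on_subset)
  have gCne: "g ` C \<noteq> {}"
  proof -
    have "of_real c \<in> C" using cd \<rho> by (auto simp: C_def)
    then show ?thesis by auto
  qed
  have cover: "\<Omega> = In \<union> C \<union> Out" using cd by (auto simp: In_def Out_def C_def \<Omega>_def)
  \<comment> \<open>If |g| were below \<open>s1\<close> on both collars, it would nowhere exceed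
    \<open>max (norm w) s2\<close>, and a radius \<open>r\<close> between this number and
    \<open>R2\<close> would be missed.\<close>
  have not1: "\<not> ((\<forall>z\<in>In. norm (g z) < s1) \<and> (\<forall>z\<in>Out. norm (g z) < s1))"
  proof
    assume a: "(\<forall>z\<in>In. norm (g z) < s1) \<and> (\<forall>z\<in>Out. norm (g z) < s1)"
    obtain w where w: "w \<in> g ` C" "\<And>z. z \<in> g ` C \<Longrightarrow> norm z \<le> norm w"
      using continuous_attains_sup[OF cgC gCne, of norm] by (auto intro: continuous_intros)
    have "w \<in> \<Omega>'" using w gk C\<Omega> by auto
    then have "ereal (max (norm w) s2) < R2" using s by (auto simp: \<Omega>'_def max_def)
    then obtain r where r: "ereal (max (norm w) s2) < ereal r" "ereal r < R2" using ereal_dense2 by blast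
    have "R1 < ereal r" using s r by (metis ereal_less_eq(3) less_le_trans max.cobounded2 order.strict_implies_order order_less_trans less_ereal.simps(1))
    then have "of_real r \<in> \<Omega>'" using r s by (auto simp: \<Omega>'_def)
    then obtain z where z: "z \<in> \<Omega>" "g z = of_real r" using gk(3) by force
    have "0 \<le> r" using r s by (auto simp: max_def split: if_splits)
    then have n: "norm (g z) = r" using z(2) by simp
    have "z \<in> In \<or> z \<in> Out \<or> norm (g z) \<le> norm w" using z(1) w(2) unfolding cover by auto
    then show False using a n r s by (auto simp: max_def split: if_splits)
  qed
  have not2: "\<not> ((\<forall>z\<in>In. s2 < norm (g z)) \<and> (\<forall>z\<in>Out. s2 < norm (g z)))"
  proof
    assume a: "(\<forall>z\<in>In. s2 < norm (g z)) \<and> (\<forall>z\<in>Out. s2 < norm (g z))"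
    obtain w where w: "w \<in> g ` C" "\<And>z. z \<in> g ` C \<Longrightarrow> norm w \<le> norm z"
      using continuous_attains_inf[OF cgC gCne, of norm] by (auto intro: continuous_intros)
    have "w \<in> \<Omega>'" using w gk C\<Omega> by auto
    then have "R1 < ereal (min (norm w) s1)" using s by (auto simp: \<Omega>'_def min_def)
    then obtain r where r: "R1 < ereal r" "ereal r < ereal (min (norm w) s1)" using ereal_dense2 by blast
    have "0 < ereal r" using s r by (meson le_less_trans)
    with r have r: "R1 < ereal r" "r < norm w" "r < s1" "0 < r" by auto
    have "ereal r < R2" using s r by (meson less_ereal.simps(1) order_less_trans)
    then have "of_real r \<in> \<Omega>'" using r s by (auto simp: \<Omega>'_def)
    then obtain z where z: "z \<in> \<Omega>" "g z = of_real r" using gk(3) by force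
    have "0 \<le> r" using r s by (auto simp: max_def split: if_splits)
    then have n: "norm (g z) = r" using z(2) by simp
    have "z \<in> In \<or> z \<in> Out \<or> norm w \<le> norm (g z)" using z(1) w(2) unfolding cover by auto
    then show False using a n r s by force
  qed
  have "c < d" using cd by linarith
  have "\<forall>z. norm z = c \<longrightarrow> z \<in> In" "\<forall>z. norm z = d \<longrightarrow> z \<in> Out" using cd by (auto simp: In_def Out_def)
  with altIn altOut not1 not2 \<open>c < d\<close> cd show ?thesis
    by (intro that[of c d]) (auto simp: less_imp_le)
qed

section \<open>The length-area inequality in logarithmic polar coordinates\<close>

text \<open>With a = A/w and b = B/w the left side is |Re a|, and 2 |Re a| \<le> |a|^2 + 1. Since a
  and b are orthogonal and |a| \<le> |b|, the square |a|^2 is at most |a| |b|, which is exactly the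
  modulus of the determinant of a and b.\<close>

lemma log_derivative_bound:
  fixes w A B :: complex
  assumes "w \<noteq> 0" "A \<bullet> B = 0" "norm A \<le> norm B"
  shows "\<bar>w \<bullet> A\<bar> / (norm w)\<^sup>2 \<le> (\<bar>Re (A / w) * Im (B / w) - Im (A / w) * Re (B / w)\<bar> + 1) / 2"
proof -
  define a where "a = A / w"
  define b where "b = B / w"
  have A: "A = w * a" and B: "B = w * b" using assms by (auto simp: a_def b_def)
  have "A \<bullet> B = (norm w)\<^sup>2 * (a \<bullet> b)"
    unfolding A B inner_complex_def cmod_power2 by (simp add: power2_eq_square algebra_simps)
  with assms have ab: "a \<bullet> b = 0" by simp
  have nab: "norm a \<le> norm b" using assms unfolding A B by (simp add: norm_mult)
  have wA: "w \<bullet> A = (norm w)\<^sup>2 * Re a"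
    unfolding A inner_complex_def cmod_power2 by (simp add: power2_eq_square algebra_simps)
  \<comment> \<open>Lagrange's identity in the plane; orthogonality removes the second
    square.\<close>
  have "(Re a * Im b - Im a * Re b)\<^sup>2 + (a \<bullet> b)\<^sup>2 = (norm a)\<^sup>2 * (norm b)\<^sup>2"
    unfolding inner_complex_def cmod_power2 by (simp add: power2_eq_square algebra_simps)
  with ab have "(Re a * Im b - Im a * Re b)\<^sup>2 = (norm a * norm b)\<^sup>2" by (simp add: power_mult_distrib)
  then have "\<bar>Re a * Im b - Im a * Re b\<bar> = \<bar>norm a * norm b\<bar>" by (simp only: power2_eq_iff abs_eq_iff)
  then have "\<bar>Re a * Im b - Im a * Re b\<bar> = norm a * norm b" by simp
  moreover have "norm a * norm a \<le> norm a * norm b" using nab by (intro mult_left_mono) auto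
  moreover have "\<bar>Re a\<bar> * \<bar>Re a\<bar> \<le> norm a * norm a" by (intro mult_mono abs_Re_le_cmod) auto
  moreover have "2 * \<bar>Re a\<bar> \<le> \<bar>Re a\<bar> * \<bar>Re a\<bar> + 1"
    using sum_squares_ge_zero[of "\<bar>Re a\<bar> - 1" 0] by (simp add: algebra_simps)
  ultimately have "\<bar>Re a\<bar> \<le> (\<bar>Re a * Im b - Im a * Re b\<bar> + 1) / 2" by argo
  then show ?thesis using assms wA by (simp add: a_def b_def abs_mult)
qed

text \<open>The vectors z and iz form a real basis of the plane, and pairing with their orthogonal
  images reads off both coefficients of a vector in the kernel.\<close>

lemma inj_of_orthogonal:
  fixes D :: "complex \<Rightarrow> 'b::real_inner"
  assumes "linear D" "z \<noteq> 0" "D z \<noteq> 0" "D (\<i> * z) \<noteq> 0" "D z \<bullet> D (\<i> * z) = 0"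
  shows "inj D"
proof (subst linear_injective_0[OF assms(1)], intro allI impI)
  fix \<omega> assume "D \<omega> = 0"
  define \<zeta> where "\<zeta> = \<omega> / z"
  have "\<omega> = Re \<zeta> *\<^sub>R z + Im \<zeta> *\<^sub>R (\<i> * z)"
  proof -
    have "\<omega> = \<zeta> * z" using assms by (simp add: \<zeta>_def)
    also have "\<dots> = (of_real (Re \<zeta>) + \<i> * of_real (Im \<zeta>)) * z" by (metis complex_eq)
    finally show ?thesis by (simp add: scaleR_conv_of_real algebra_simps)
  qed
  then have D: "D \<omega> = Re \<zeta> *\<^sub>R D z + Im \<zeta> *\<^sub>R D (\<i> * z)"
    using assms(1) by (metis linear_add linear_scale)
  have "D \<omega> \<bullet> D z = Re \<zeta> * (D z \<bullet> D z)" "D \<omega> \<bullet> D (\<i> * z) = Im \<zeta> * (D (\<i> * z) \<bullet> D (\<i> * z))"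
    unfolding D using assms(5) by (auto simp: inner_add_left inner_commute[of "D (\<i> * z)" "D z"])
  with \<open>D \<omega> = 0\<close> assms(3,4) have "Re \<zeta> = 0" "Im \<zeta> = 0" by simp_all
  then have "\<zeta> = 0" by (intro complex_eqI) simp_all
  then show "\<omega> = 0" using assms(2) by (simp add: \<zeta>_def)
qed

lemma has_derivative_cexp:
  fixes f :: "'a::real_normed_vector \<Rightarrow> complex"
  assumes "(f has_derivative f') (at x)"
  shows "((\<lambda>x. exp (f x)) has_derivative (\<lambda>h. exp (f x) * f' h)) (at x)"
  using has_derivative_compose[OF assms] DERIV_exp[of "f x"] by (simp add: has_field_derivative_def)

text \<open>\<open>Dg z z\<close> and \<open>Dg z (\<i> * z)\<close> are the derivatives of g in t =
  ln r and in the angle, so \<open>orth\<close> and \<open>stretch\<close> say that g keeps rays and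
  circles orthogonal and stretches circles at least as much as rays. As \<open>s1\<close> and
  \<open>s2\<close> lie strictly inside the target annulus, each ray is used on a compact piece only
  and nothing is asked of g at the boundary.\<close>

lemma homeomorphic_annulus_modulus_le:
  fixes g k :: "complex \<Rightarrow> complex" and Dg
  assumes \<rho>: "0 < \<rho>1" "\<rho>1 < \<rho>2"
    and hom: "homeomorphism {z. \<rho>1 < norm z \<and> norm z < \<rho>2} {w. R1 < ereal (norm w) \<and> ereal (norm w) < R2} g k"
    and der: "\<And>z. \<rho>1 < norm z \<Longrightarrow> norm z < \<rho>2 \<Longrightarrow> (g has_derivative Dg z) (at z)"
    and cont: "continuous_on {z. \<rho>1 < norm z \<and> norm z < \<rho>2} (\<lambda>z. Dg z z)"
    and nz: "\<And>z. \<rho>1 < norm z \<Longrightarrow> norm z < \<rho>2 \<Longrightarrow> Dg z z \<noteq> 0"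
    and orth: "\<And>z. \<rho>1 < norm z \<Longrightarrow> norm z < \<rho>2 \<Longrightarrow> Dg z z \<bullet> Dg z (\<i> * z) = 0"
    and stretch: "\<And>z. \<rho>1 < norm z \<Longrightarrow> norm z < \<rho>2 \<Longrightarrow> norm (Dg z z) \<le> norm (Dg z (\<i> * z))"
    and s: "0 \<le> R1" "s1 < s2" "R1 < ereal s1" "ereal s2 < R2"
  shows "ln s2 - ln s1 \<le> ln \<rho>2 - ln \<rho>1"
proof -
  have "0 < ereal s1" using s by (metis le_less_trans)
  then have "0 < s1" by simp
  note s = this s
  define \<Omega> where "\<Omega> = {z::complex. \<rho>1 < norm z \<and> norm z < \<rho>2}"
  define \<Omega>' where "\<Omega>' = {w::complex. R1 < ereal (norm w) \<and> ereal (norm w) < R2}"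
  have hom': "homeomorphism \<Omega> \<Omega>' g k" using hom by (simp add: \<Omega>_def \<Omega>'_def)
  have gk: "continuous_on \<Omega> g" "continuous_on \<Omega>' k" "g ` \<Omega> = \<Omega>'" "k ` \<Omega>' = \<Omega>"
    "\<And>z. z \<in> \<Omega> \<Longrightarrow> k (g z) = z" "\<And>w. w \<in> \<Omega>' \<Longrightarrow> g (k w) = w"
    using hom' unfolding homeomorphism_def by auto
  have D: "\<And>z. z \<in> \<Omega> \<Longrightarrow> (g has_derivative Dg z) (at z)" "continuous_on \<Omega> (\<lambda>z. Dg z z)"
    using der cont by (auto simp: \<Omega>_def)
  have \<Omega>: "z \<in> \<Omega> \<longleftrightarrow> \<rho>1 < norm z \<and> norm z < \<rho>2" for z by (simp add: \<Omega>_def)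
  have g0: "g z \<noteq> 0" if "z \<in> \<Omega>" for z
    using gk(3) that s(2) by (force simp: \<Omega>'_def zero_ereal_def)
  define m where "m = ln s2 - ln s1"
  define l where "l = ln \<rho>2 - ln \<rho>1"
  have m0: "0 < m" using s by (simp add: m_def)
  have l0: "0 < l" using \<rho> by (simp add: l_def)
  define e where "e t \<theta> = exp (Complex t \<theta>)" for t \<theta>
  have ne: "norm (e t \<theta>) = exp t" for t \<theta> by (simp add: e_def)
  have e\<Omega>: "e t \<theta> \<in> \<Omega> \<longleftrightarrow> ln \<rho>1 < t \<and> t < ln \<rho>2" for t \<theta>
    using \<rho> exp_less_cancel_iff[of "ln \<rho>1" t] exp_less_cancel_iff[of t "ln \<rho>2"] by (simp add: \<Omega> ne)
  define \<phi> where "\<phi> z = (g z \<bullet> Dg z z) / (norm (g z))\<^sup>2" for z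
  have der\<phi>: "((\<lambda>t. ln (norm (g (e t \<theta>)))) has_real_derivative \<phi> (e t \<theta>)) (at t)" if "e t \<theta> \<in> \<Omega>" for t \<theta>
  proof -
    define z where "z = e t \<theta>"
    have z: "z \<in> \<Omega>" using that by (simp add: z_def)
    have "((\<lambda>t. e t \<theta>) has_derivative (\<lambda>h. h *\<^sub>R z)) (at t)"
      unfolding e_def z_def Complex_eq
      by (rule has_derivative_eq_rhs, rule has_derivative_cexp) (auto intro!: derivative_eq_intros simp: scaleR_conv_of_real)
    moreover have "(g has_derivative Dg z) (at (e t \<theta>))" using D(1) z by (simp add: z_def)
    ultimately have g': "((\<lambda>t. g (e t \<theta>)) has_derivative (\<lambda>h. Dg z (h *\<^sub>R z))) (at t)"
      by (rule has_derivative_compose)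
    have "g z \<noteq> 0" using g0 z by simp
    then have "((\<lambda>t. norm (g (e t \<theta>))) has_derivative (\<lambda>h. Dg z (h *\<^sub>R z) \<bullet> sgn (g z))) (at t)"
      using has_derivative_compose[OF g' has_derivative_norm[of "g (e t \<theta>)"]] by (simp add: z_def)
    then have "((\<lambda>t. ln (norm (g (e t \<theta>)))) has_derivative (\<lambda>h. (Dg z (h *\<^sub>R z) \<bullet> sgn (g z)) / norm (g z))) (at t)"
      using \<open>g z \<noteq> 0\<close> by (auto intro!: derivative_eq_intros simp: z_def divide_inverse)
    moreover have "(Dg z (h *\<^sub>R z) \<bullet> sgn (g z)) / norm (g z) = h * \<phi> z" for h
      using linear_scale[OF has_derivative_linear[OF D(1)[of z]], of h z] z
      by (simp add: \<Omega> \<phi>_def sgn_div_norm inner_commute power2_eq_square divide_inverse)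
    ultimately show ?thesis by (simp add: has_field_derivative_def z_def mult.commute[of _ "\<phi> _"] mult_commute_abs)
  qed
  have cont\<phi>: "continuous_on \<Omega> \<phi>"
    unfolding \<phi>_def using gk(1) D(2) g0 by (intro continuous_intros) auto
  obtain c d where cd: "\<rho>1 < c" "c < d" "d < \<rho>2" and ends:
    "(\<forall>z. norm z = c \<longrightarrow> norm (g z) \<le> s1) \<and> (\<forall>z. norm z = d \<longrightarrow> s2 \<le> norm (g z)) \<or>
     (\<forall>z. norm z = c \<longrightarrow> s2 \<le> norm (g z)) \<and> (\<forall>z. norm z = d \<longrightarrow> norm (g z) \<le> s1)"
    using annulus_homeomorphism_ends[OF \<rho> hom s(2-)] by blast
  have cpos: "0 < c" "0 < d" using cd \<rho> by auto
  \<comment> \<open>Along every ray ln |g| crosses the interval from ln \<open>s1\<close> to ln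
    \<open>s2\<close>, upwards or downwards, and over a single crossing the integral of its
    derivative already has modulus m.\<close>
  have radial: "ennreal m \<le> (\<integral>\<^sup>+t. ennreal \<bar>\<phi> (e t \<theta>)\<bar> *
       indicator {t. ln \<rho>1 < t \<and> t < ln \<rho>2 \<and> s1 < norm (g (e t \<theta>)) \<and> norm (g (e t \<theta>)) < s2} t \<partial>lborel)" (is "_ \<le> ?I") for \<theta>
  proof -
    define f where "f t = ln (norm (g (e t \<theta>)))" for t
    have sub: "e t \<theta> \<in> \<Omega>" if "ln c \<le> t" "t \<le> ln d" for t
      unfolding e\<Omega> using that cd \<rho> cpos by (smt (verit) ln_less_cancel_iff)
    have cf: "continuous_on {ln c..ln d} f"
    proof (rule continuous_at_imp_continuous_on, rule)
      fix t assume "t \<in> {ln c..ln d}"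
      then show "isCont f t"
        unfolding f_def using DERIV_isCont[OF der\<phi>[OF sub]] by auto
    qed
    have cdle: "ln c \<le> ln d" using cd cpos by simp
    have lns: "ln s1 < ln s2" using s by simp
    have fpos: "0 < norm (g (e t \<theta>))" if "ln c \<le> t" "t \<le> ln d" for t using g0[OF sub[OF that]] by simp
    have n: "norm (e (ln c) \<theta>) = c" "norm (e (ln d) \<theta>) = d" using cpos by (auto simp: ne)
    obtain a b where ab: "ln c \<le> a" "a < b" "b \<le> ln d" "\<bar>f b - f a\<bar> = m"
        "\<And>t. a < t \<Longrightarrow> t < b \<Longrightarrow> ln s1 < f t \<and> f t < ln s2"
    proof (cases "f (ln c) \<le> ln s1 \<and> ln s2 \<le> f (ln d)")
      case True
      then show ?thesis using monotone_crossing[OF cf cdle _ lns] that m0 by (metis abs_of_pos m_def)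
    next
      case False
      \<comment> \<open>Here g interchanges the two ends, and the crossing is taken for -f.\<close>
      have "f (ln d) \<le> ln s1 \<and> ln s2 \<le> f (ln c)"
        using False ends n fpos[of "ln c"] fpos[of "ln d"] cdle s by (auto simp: f_def)
      moreover have "continuous_on {ln c..ln d} (\<lambda>t. - f t)" using cf by (intro continuous_intros)
      ultimately obtain a b where "ln c \<le> a" "a < b" "b \<le> ln d" "- f a = - ln s2" "- f b = - ln s1"
         "\<And>t. a < t \<Longrightarrow> t < b \<Longrightarrow> - ln s2 < - f t \<and> - f t < - ln s1"
         using monotone_crossing[of "ln c" "ln d" "\<lambda>t. - f t" "- ln s2" "- ln s1"] cdle lns by auto
      then show ?thesis using that[of a b] m0 by (auto simp: m_def)
    qed
    have fJ: "((\<lambda>t. \<phi> (e t \<theta>)) has_integral (f b - f a)) {a..b}"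
      using ab sub by (intro fundamental_theorem_of_calculus)
        (auto simp: f_def has_real_derivative_iff_has_vector_derivative[symmetric] intro!: has_field_derivative_at_within der\<phi>)
    have ce: "continuous_on {a..b} (\<lambda>t. \<phi> (e t \<theta>))"
    proof (rule continuous_on_compose2[OF cont\<phi>])
      show "continuous_on {a..b} (\<lambda>t. e t \<theta>)" unfolding e_def Complex_eq by (intro continuous_intros)
    qed (use ab sub in force)
    then have "(\<lambda>t. \<bar>\<phi> (e t \<theta>)\<bar>) integrable_on {a..b}"
      by (intro integrable_continuous_interval continuous_intros)
    then obtain J where J: "((\<lambda>t. \<bar>\<phi> (e t \<theta>)\<bar>) has_integral J) {a..b}" by blast
    have "m \<le> J"
    proof -
      have "\<bar>f b - f a\<bar> \<le> J"
        using integral_norm_bound_integral[of "\<lambda>t. \<phi> (e t \<theta>)" "{a..b}" "\<lambda>t. \<bar>\<phi> (e t \<theta>)\<bar>"] fJ J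
        by (auto simp: has_integral_iff)
      then show ?thesis using ab by simp
    qed
    also have "ennreal J = (\<integral>\<^sup>+t. ennreal \<bar>\<phi> (e t \<theta>)\<bar> * indicator {a<..<b} t \<partial>lborel)"
      using J by (intro nn_integral_has_integral_lebesgue'[symmetric]) (auto simp: has_integral_Icc_iff_Ioo)
    also have "\<dots> \<le> ?I"
    proof (intro nn_integral_mono mult_left_mono)
      fix t
      have "ln \<rho>1 < t \<and> t < ln \<rho>2 \<and> s1 < norm (g (e t \<theta>)) \<and> norm (g (e t \<theta>)) < s2" if "t \<in> {a<..<b}"
        using ab(5)[of t] ab sub[of t] fpos[of t] that s by (auto simp: e\<Omega> f_def)
      then show "indicator {a<..<b} t \<le> (indicator {t. ln \<rho>1 < t \<and> t < ln \<rho>2 \<and> s1 < norm (g (e t \<theta>)) \<and> norm (g (e t \<theta>)) < s2} t :: ennreal)"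
        by (auto simp: indicator_def)
    qed auto
    finally show ?thesis by (simp add: ennreal_leI)
  qed
  define G where "G x = g (e (x$1) (x$2))" for x :: "real^2"
  define Q where "Q = {x::real^2. ln \<rho>1 < x$1 \<and> x$1 < ln \<rho>2 \<and> 0 < x$2 \<and> x$2 < 2 * pi}"
  define E where "E = {x\<in>Q. s1 < norm (G x) \<and> norm (G x) < s2}"
  \<comment> \<open>The points sent by g to the branch cut of \<open>Ln\<close> are left out, so
    that the logarithm of g is differentiable on \<open>E0\<close>.\<close>
  define E0 where "E0 = {x\<in>E. G x \<notin> \<real>\<^sub>\<le>\<^sub>0}"
  have oQ: "open Q" unfolding Q_def
    by (intro open_Collect_conj open_Collect_less continuous_intros)
  have ce: "continuous_on A (\<lambda>x::real^2. e (x$1) (x$2))" for A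
    unfolding e_def Complex_eq by (intro continuous_intros)
  have Q\<Omega>: "e (x$1) (x$2) \<in> \<Omega>" if "x \<in> Q" for x using that by (auto simp: Q_def e\<Omega>)
  have cG: "continuous_on Q G" unfolding G_def
    by (rule continuous_on_compose2[OF gk(1) ce]) (use Q\<Omega> in auto)
  have oE: "open E"
  proof -
    have "open (Q \<inter> (\<lambda>x. norm (G x)) -` {s1<..<s2})"
      using cG oQ by (intro continuous_open_preimage continuous_intros) auto
    then show ?thesis by (rule back_subst[where P="open"]) (auto simp: E_def)
  qed
  have oE0: "open E0"
  proof -
    have "open (E \<inter> G -` (- \<real>\<^sub>\<le>\<^sub>0))"
      using cG oE closed_nonpos_Reals_complex by (intro continuous_open_preimage) (auto simp: E_def intro: continuous_on_subset)
    then show ?thesis by (rule back_subst[where P="open"]) (auto simp: E0_def)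
  qed
  define F where "F x = \<bar>\<phi> (e (x$1) (x$2))\<bar>" for x :: "real^2"
  have cF: "continuous_on E F"
  proof -
    have "continuous_on Q F" unfolding F_def
      by (intro continuous_intros continuous_on_compose2[OF cont\<phi> ce]) (use Q\<Omega> in auto)
    then show ?thesis by (rule continuous_on_subset) (auto simp: E_def)
  qed
  have mF[measurable]: "(\<lambda>x. ennreal (F x) * indicator E x) \<in> borel_measurable borel"
  proof -
    have "(\<lambda>x. indicator E x *\<^sub>R F x) \<in> borel_measurable borel"
      using cF oE by (intro borel_measurable_continuous_on_indicator) auto
    moreover have "(\<lambda>x. ennreal (F x) * indicator E x) = (\<lambda>x. ennreal (indicator E x *\<^sub>R F x))"
      by (auto simp: indicator_def)
    ultimately show ?thesis by simp
  qed
  \<comment> \<open>The bound along rays, integrated over the angles.\<close>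
  have lower: "ennreal (2 * pi * m) \<le> (\<integral>\<^sup>+x. ennreal (F x) * indicator E x \<partial>lborel)"
  proof -
    have "ennreal (2 * pi * m) = (\<integral>\<^sup>+\<theta>. ennreal m * indicator {0<..<2*pi} \<theta> \<partial>lborel)"
      using m0 by (simp add: nn_integral_cmult ennreal_mult[symmetric] mult.commute)
    also have "\<dots> \<le> (\<integral>\<^sup>+\<theta>. (\<integral>\<^sup>+t. ennreal (F (vector [t, \<theta>])) * indicator E (vector [t, \<theta>]) \<partial>lborel) \<partial>lborel)"
    proof (intro nn_integral_mono)
      fix \<theta>
      show "ennreal m * indicator {0<..<2*pi} \<theta> \<le> (\<integral>\<^sup>+t. ennreal (F (vector [t, \<theta>])) * indicator E (vector [t, \<theta>]) \<partial>lborel)"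
      proof (cases "\<theta> \<in> {0<..<2*pi}")
        case True
        have "ennreal m \<le> (\<integral>\<^sup>+t. ennreal (F (vector [t, \<theta>])) * indicator E (vector [t, \<theta>]) \<partial>lborel)"
          using True by (intro order_trans[OF radial[of \<theta>]] nn_integral_mono)
            (auto simp: F_def E_def Q_def G_def indicator_def)
        then show ?thesis using True by simp
      qed auto
    qed
    also have "\<dots> = (\<integral>\<^sup>+x. ennreal (F x) * indicator E x \<partial>lborel)"
      by (rule nn_integral_real2[symmetric]) simp
    finally show ?thesis .
  qed
  have exp_inj: "t = t' \<and> \<theta> = \<theta>'" if "e t \<theta> = e t' \<theta>'" "0 < \<theta>" "\<theta> < 2*pi" "0 < \<theta>'" "\<theta>' < 2*pi" for t t' \<theta> \<theta>'
  proof -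
    have "Complex t \<theta> = Complex t' \<theta>'"
    proof (rule exp_complex_eqI)
      show "exp (Complex t \<theta>) = exp (Complex t' \<theta>')" using that(1) by (simp only: e_def)
      have "\<bar>\<theta> - \<theta>'\<bar> < 2 * pi" using that(2-) by linarith
      then show "\<bar>Im (Complex t \<theta>) - Im (Complex t' \<theta>')\<bar> < 2 * pi" by simp
    qed
    then show ?thesis by simp
  qed
  \<comment> \<open>The removed points lie over the real points of the target annulus. The inverse
    \<open>k\<close> and a suitable logarithm are differentiable there, so they carry this null set
    to a null set.\<close>
  have neg: "negligible (E - E0)"
  proof -
    define Z where "Z = {w \<in> \<Omega>'. Im w = 0}"
    have "negligible {w::complex. \<i> \<bullet> w = 0}" by (intro negligible_hyperplane) auto
    then have "negligible Z" by (rule negligible_subset) (auto simp: Z_def inner_complex_def)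
    moreover have "k differentiable_on Z"
      unfolding differentiable_on_def
    proof
      fix w assume "w \<in> Z"
      then have w: "w \<in> \<Omega>'" "k w \<in> \<Omega>" using gk by (auto simp: Z_def)
      have o': "open \<Omega>" unfolding \<Omega>_def by (intro open_Collect_conj open_Collect_less continuous_intros)
      have "open (g ` \<Omega>)"
        by (rule invariance_of_domain[OF gk(1) o']) (metis gk(5) inj_onI)
      then have o: "open \<Omega>'" using gk by simp
      have der: "(g has_derivative Dg (k w)) (at (k w))" using D(1) w by simp
      have lin: "linear (Dg (k w))" using der by (rule has_derivative_linear)
      have "inj (Dg (k w))"
        using w(2) nz[of "k w"] orth[of "k w"] stretch[of "k w"] \<rho>
        by (intro inj_of_orthogonal[OF lin, of "k w"]) (force simp: \<Omega>)+
      then obtain L where L: "linear L" "L \<circ> Dg (k w) = id" using linear_injective_left_inverse[OF lin] by auto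
      have "(k has_derivative L) (at w)"
      proof (rule has_derivative_inverse_basic[of g "Dg (k w)" k w L \<Omega>'])
        show "continuous (at w) k" using gk(2) o w by (simp add: continuous_on_eq_continuous_at)
        show "bounded_linear L" using L by (simp add: linear_conv_bounded_linear)
      qed (use der L gk(6) w o in auto)
      then show "k differentiable at w within Z"
        using differentiable_at_withinI differentiable_def by blast
    qed
    ultimately have "negligible (k ` Z)" by (intro negligible_differentiable_image_negligible) auto
    then have "negligible (k ` Z - \<real>\<^sub>\<ge>\<^sub>0)" by (rule negligible_subset) auto
    \<comment> \<open>\<open>B\<close> is the logarithm with imaginary part between 0 and 2 pi,
      obtained from \<open>Ln\<close> at -z. It is cut along the nonnegative reals, which the angles
      in \<open>Q\<close> avoid.\<close>
    moreover define B where "B z = (vector [Re (Ln (- z)), Im (Ln (- z)) + pi] :: real^2)" for z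
    have "B differentiable_on (k ` Z - \<real>\<^sub>\<ge>\<^sub>0)"
      unfolding differentiable_on_def
    proof
      fix z assume "z \<in> k ` Z - \<real>\<^sub>\<ge>\<^sub>0"
      then have "- z \<notin> \<real>\<^sub>\<le>\<^sub>0" by (simp add: complex_nonpos_Reals_iff complex_nonneg_Reals_iff)
      then have "((\<lambda>z. Ln (- z)) has_field_derivative (inverse (- z) * (- 1))) (at z)"
        by (auto intro!: derivative_eq_intros)
      then have L: "((\<lambda>z. Ln (- z)) has_derivative (\<lambda>h. (inverse (- z) * (- 1)) * h)) (at z)"
        by (simp add: has_field_derivative_def)
      have "B = (\<lambda>z. Re (Ln (- z)) *\<^sub>R axis 1 1 + (Im (Ln (- z)) + pi) *\<^sub>R axis 2 1)"
        by (auto simp: B_def vec_eq_iff forall_2 axis_def)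
      then have "\<exists>B'. (B has_derivative B') (at z)"
        by (auto intro!: exI derivative_eq_intros L)
      then show "B differentiable at z within (k ` Z - \<real>\<^sub>\<ge>\<^sub>0)"
        using differentiable_at_withinI differentiable_def by blast
    qed
    ultimately have "negligible (B ` (k ` Z - \<real>\<^sub>\<ge>\<^sub>0))" by (intro negligible_differentiable_image_negligible) auto
    then show ?thesis
    proof (rule negligible_subset, intro subsetI)
      fix x assume x: "x \<in> E - E0"
      define z where "z = e (x$1) (x$2)"
      have Q: "0 < x$2" "x$2 < 2*pi" "z \<in> \<Omega>" using x Q\<Omega> by (auto simp: E_def Q_def z_def)
      have "g z \<in> Z" using x gk(3) Q by (auto simp: E0_def G_def Z_def z_def complex_nonpos_Reals_iff)
      then have "z \<in> k ` Z" using gk(5)[OF Q(3)] by force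
      have mz: "- z = exp (Complex (x$1) (x$2 - pi))"
        by (simp add: z_def e_def exp_eq_polar cis.ctr complex_eq_iff cos_diff sin_diff)
      then have Ln: "Ln (- z) = Complex (x$1) (x$2 - pi)"
        using Q by (simp only: mz) (intro Ln_exp; simp)
      have "z \<notin> \<real>\<^sub>\<ge>\<^sub>0"
      proof
        assume "z \<in> \<real>\<^sub>\<ge>\<^sub>0"
        then obtain r where r: "z = of_real r" "0 \<le> r" by (auto elim: nonneg_Reals_cases)
        have "z \<noteq> 0" by (simp add: z_def e_def)
        with r have "0 < r" by simp
        have "norm z = r" using r by simp
        then have "Complex (ln (norm z)) 0 = of_real (ln r)" by (simp add: complex_of_real_def)
        then have "exp (Complex (ln (norm z)) 0) = of_real (exp (ln r))" by (metis exp_of_real)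
        then have exp_z: "exp (Complex (ln (norm z)) 0) = z" using r(1) \<open>0 < r\<close> by (metis exp_ln)
        have "Complex (x$1) (x$2) = Complex (ln (norm z)) 0"
        proof (rule exp_complex_eqI)
          show "exp (Complex (x$1) (x$2)) = exp (Complex (ln (norm z)) 0)"
            unfolding exp_z by (simp only: z_def e_def)
          have "\<bar>x$2 - 0\<bar> < 2 * pi" using Q(1,2) by linarith
          then show "\<bar>Im (Complex (x$1) (x$2)) - Im (Complex (ln (norm z)) 0)\<bar> < 2 * pi" by simp
        qed
        then show False using Q by simp
      qed
      moreover have "B z = x" by (simp add: B_def Ln vec_eq_iff forall_2)
      ultimately show "x \<in> B ` (k ` Z - \<real>\<^sub>\<ge>\<^sub>0)" using \<open>z \<in> k ` Z\<close> by force
    qed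
  qed
  define L where "L x = (vector [Re (Ln (G x)), Im (Ln (G x))] :: real^2)" for x
  define L' where "L' x h = (let z = e (x$1) (x$2); w = Dg z (z * Complex (h$1) (h$2)) / g z in vector [Re w, Im w] :: real^2)" for x h :: "real^2"
  have E0: "x \<in> Q" "e (x$1) (x$2) \<in> \<Omega>" "G x \<notin> \<real>\<^sub>\<le>\<^sub>0" "G x \<noteq> 0" if "x \<in> E0" for x
    using that Q\<Omega>[of x] g0 by (auto simp: E0_def E_def G_def)
  have derL: "(L has_derivative L' x) (at x within E0)" if "x \<in> E0" for x
  proof -
    define z where "z = e (x$1) (x$2)"
    have z: "z \<in> \<Omega>" using E0[OF that] by (simp add: z_def)
    have gz: "g z \<notin> \<real>\<^sub>\<le>\<^sub>0" "g z \<noteq> 0" using E0[OF that] by (auto simp: z_def G_def)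
    have c: "((\<lambda>x::real^2. x $ i) has_derivative (\<lambda>h. h $ i)) (at x)" for i
      by (intro bounded_linear_imp_has_derivative bounded_linear_vec_nth)
    have "((\<lambda>x::real^2. e (x$1) (x$2)) has_derivative (\<lambda>h. z * Complex (h$1) (h$2))) (at x)"
      unfolding e_def z_def Complex_eq
      by (rule has_derivative_eq_rhs, rule has_derivative_cexp) (auto intro!: derivative_eq_intros c)
    moreover have "(g has_derivative Dg z) (at (e (x$1) (x$2)))" using D(1) z by (simp add: z_def)
    ultimately have "(G has_derivative (\<lambda>h. Dg z (z * Complex (h$1) (h$2)))) (at x)"
      unfolding G_def by (rule has_derivative_compose)
    moreover have "(Ln has_derivative (*) (inverse (g z))) (at (G x))"
      using has_field_derivative_Ln[OF gz(1)] by (simp add: has_field_derivative_def G_def z_def)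
    ultimately have Ln: "((\<lambda>x. Ln (G x)) has_derivative (\<lambda>h. inverse (g z) * Dg z (z * Complex (h$1) (h$2)))) (at x)"
      by (rule has_derivative_compose)
    have "L = (\<lambda>x. Re (Ln (G x)) *\<^sub>R axis 1 1 + Im (Ln (G x)) *\<^sub>R axis 2 1)"
      by (auto simp: L_def vec_eq_iff forall_2 axis_def)
    moreover have "L' x = (\<lambda>h. Re (inverse (g z) * Dg z (z * Complex (h$1) (h$2))) *\<^sub>R axis 1 1 + Im (inverse (g z) * Dg z (z * Complex (h$1) (h$2))) *\<^sub>R axis 2 1)"
      by (auto simp: L'_def vec_eq_iff forall_2 axis_def Let_def divide_inverse z_def mult.commute[of "inverse _"])
    ultimately have "(L has_derivative L' x) (at x)" by (auto intro!: derivative_eq_intros Ln)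
    then show ?thesis by (rule has_derivative_at_withinI)
  qed
  have injL: "inj_on L E0"
  proof (rule inj_onI)
    fix x y assume xy: "x \<in> E0" "y \<in> E0" "L x = L y"
    then have "Ln (G x) = Ln (G y)" by (auto simp: L_def vec_eq_iff forall_2 complex_eq_iff)
    then have "G x = G y" using E0 xy by (metis exp_Ln)
    then have "e (x$1) (x$2) = e (y$1) (y$2)" using gk(5) E0 xy by (metis G_def)
    then show "x = y" using exp_inj[of "x$1" "x$2" "y$1" "y$2"] E0(1)[OF xy(1)] E0(1)[OF xy(2)]
      by (simp add: Q_def vec_eq_iff forall_2)
  qed
  have mE0: "E0 \<in> sets lebesgue" using oE0 by auto
  have "open (L ` E0)"
    using injL oE0 derL by (intro invariance_of_domain) (auto intro!: has_derivative_continuous_on)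
  \<comment> \<open>The principal branch confines the imaginary part, \<open>E\<close> confines the
    real part, so the image has area at most 2 pi m. By injectivity this area is also the integral
    of the Jacobian.\<close>
  have LR: "L ` E0 \<subseteq> box (vector [ln s1, - pi]) (vector [ln s2, pi])"
  proof
    fix y assume "y \<in> L ` E0"
    then obtain x where x: "x \<in> E0" "y = L x" by auto
    have "- pi < Im (Ln (G x))" "Im (Ln (G x)) < pi"
      using E0[OF x(1)] mpi_less_Im_Ln Im_Ln_less_pi by blast+
    moreover have "ln s1 < Re (Ln (G x))" "Re (Ln (G x)) < ln s2"
      using x s E0[OF x(1)] by (auto simp: E0_def E_def)
    ultimately show "y \<in> box (vector [ln s1, - pi]) (vector [ln s2, pi])"
      by (auto simp: x mem_box Basis_real2 inner_axis L_def)
  qed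
  have box: "measure lebesgue (box (vector [a, b]) (vector [c, d] :: real^2)) = (c - a) * (d - b)" if "a \<le> c" "b \<le> d" for a b c d
    using that by (subst measure_completion) (auto simp: measure_lborel_box_eq Basis_real2 axis_1_neq_2 inner_axis inner_diff_left)
  have ml: "L ` E0 \<in> lmeasurable" using \<open>open (L ` E0)\<close> LR by (meson bounded_box bounded_subset lmeasurable_open)
  have "measure lebesgue (L ` E0) \<le> measure lebesgue (box (vector [ln s1, - pi]) (vector [ln s2, pi] :: real^2))"
    using LR ml by (intro measure_mono_fmeasurable) (auto simp: fmeasurableD)
  also have "\<dots> = 2 * pi * m" using s by (subst box) (auto simp: m_def)
  finally have area: "measure lebesgue (L ` E0) \<le> 2 * pi * m" .
  have EQ: "E0 \<subseteq> box (vector [ln \<rho>1, 0]) (vector [ln \<rho>2, 2 * pi])"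
    by (auto simp: E0_def E_def Q_def mem_box Basis_real2 inner_axis)
  have mlE: "E0 \<in> lmeasurable" using oE0 EQ by (meson bounded_box bounded_subset lmeasurable_open)
  have "measure lebesgue E0 \<le> measure lebesgue (box (vector [ln \<rho>1, 0]) (vector [ln \<rho>2, 2 * pi] :: real^2))"
    using EQ mlE by (intro measure_mono_fmeasurable) (auto simp: fmeasurableD)
  also have "\<dots> = 2 * pi * l" using \<rho> by (subst box) (auto simp: l_def)
  finally have areaE: "measure lebesgue E0 \<le> 2 * pi * l" .
  define J where "J x = \<bar>det (matrix (L' x))\<bar>" for x
  have "(J has_integral measure lebesgue (L ` E0)) E0"
    unfolding J_def using has_measure_differentiable_image[OF mE0 derL injL] ml by blast
  moreover have "((\<lambda>x. 1) has_integral measure lebesgue E0) E0"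
    using mlE by (simp add: has_integral_iff lmeasurable_iff_integrable_on lmeasure_integral)
  ultimately have JI: "((\<lambda>x. (J x + 1) / 2) has_integral (measure lebesgue (L ` E0) + measure lebesgue E0) / 2) E0"
    by (intro has_integral_divide has_integral_add)
  \<comment> \<open>The columns of the Jacobian matrix are the logarithmic derivatives
    \<open>Dg z z / g z\<close> and \<open>Dg z (\<i> * z) / g z\<close>, to which the pointwise
    inequality applies.\<close>
  have FJ: "F x \<le> (J x + 1) / 2" if "x \<in> E0" for x
  proof -
    define z where "z = e (x$1) (x$2)"
    have z: "z \<in> \<Omega>" using E0[OF that] by (simp add: z_def)
    have "Complex 0 1 = \<i>" by (simp add: complex_eq_iff)
    moreover have "Complex 1 0 = 1" by (simp add: complex_eq_iff)
    ultimately have "J x = \<bar>Re (Dg z z / g z) * Im (Dg z (\<i> * z) / g z) - Im (Dg z z / g z) * Re (Dg z (\<i> * z) / g z)\<bar>"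
      unfolding J_def det_2 matrix_def L'_def z_def[symmetric]
      by (simp add: Let_def axis_def mult.commute[of z \<i>] algebra_simps)
    then show ?thesis
      using log_derivative_bound[of "g z" "Dg z z" "Dg z (\<i> * z)"] g0[OF z] orth[of z] stretch[of z] z
      by (simp add: F_def z_def[symmetric] \<phi>_def \<Omega>)
  qed
  have "ennreal (2 * pi * m) \<le> (\<integral>\<^sup>+x. ennreal (F x) * indicator E x \<partial>lborel)" by (rule lower)
  also have "\<dots> = (\<integral>\<^sup>+x. ennreal (F x) * indicator E0 x \<partial>lborel)"
  proof (rule nn_integral_cong_AE)
    have "AE x in lebesgue. x \<notin> E - E0" by (rule AE_not_in) (use neg negligible_iff_null_sets in blast)
    then have "AE x in lborel. x \<notin> E - E0" by (simp add: AE_completion_iff)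
    then show "AE x in lborel. ennreal (F x) * indicator E x = ennreal (F x) * indicator E0 x"
      by eventually_elim (auto simp: indicator_def E0_def)
  qed
  also have "\<dots> \<le> (\<integral>\<^sup>+x. ennreal ((J x + 1) / 2) * indicator E0 x \<partial>lborel)"
    by (intro nn_integral_mono) (auto simp: indicator_def intro!: ennreal_leI FJ)
  also have "\<dots> = ennreal ((measure lebesgue (L ` E0) + measure lebesgue E0) / 2)"
    using JI by (intro nn_integral_has_integral_lebesgue') (auto simp: J_def)
  also have "\<dots> \<le> ennreal ((2 * pi * m + 2 * pi * l) / 2)"
    using area areaE by (intro ennreal_leI) simp
  finally have "2 * pi * m \<le> (2 * pi * m + 2 * pi * l) / 2" using l0 m0 by (simp add: ennreal_le_iff)
  then have "pi * m \<le> pi * l" by simp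
  then show ?thesis by (simp add: m_def l_def)
qed

section \<open>Maps of class C^k\<close>

text \<open>Continuity of g is upgraded to differentiability when A after g is differentiable and A
  has an injective derivative; A may map into a space of larger dimension. This serves for curves
  lifted to a chart and for transitions between charts. Injectivity gives c |w| \<le> |A' w|, which
  first makes g Lipschitz at x; then the errors of A and of the composite are both small compared
  with |y - x|, and L recovers the increment of g.\<close>

lemma has_derivative_lift:
  fixes A :: "'b::euclidean_space \<Rightarrow> 'c::euclidean_space" and g :: "'a::real_normed_vector \<Rightarrow> 'b"
  assumes A: "(A has_derivative A') (at (g x))" and L: "linear L" "L \<circ> A' = id"
    and g: "continuous (at x within S) g"
    and Ag: "((\<lambda>y. A (g y)) has_derivative B) (at x within S)"
  shows "(g has_derivative L \<circ> B) (at x within S)"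
proof -
  have linA: "linear A'" and linB: "bounded_linear B"
    using A Ag by (auto simp: has_derivative_linear has_derivative_bounded_linear)
  have "inj A'" using L by (metis inj_on_id inj_on_imageI2)
  then obtain c where c: "0 < c" "\<And>w. c * norm w \<le> norm (A' w)"
    using linear_inj_bounded_below_pos[OF linA] by (metis mult.commute)
  obtain K where K: "0 < K" "\<And>w. norm (L w) \<le> norm w * K"
    using bounded_linear.pos_bounded L(1) linear_conv_bounded_linear by blast
  obtain M where M: "0 < M" "\<And>h. norm (B h) \<le> norm h * M"
    using bounded_linear.pos_bounded[OF linB] by blast
  have tend: "(g \<longlongrightarrow> g x) (at x within S)" using g by (simp add: continuous_within)
  have A_near: "\<forall>\<^sub>F y in at x within S. norm (A (g y) - A (g x) - A' (g y - g x)) \<le> \<epsilon> * norm (g y - g x)" if "0 < \<epsilon>" for \<epsilon>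
  proof -
    have "\<forall>\<^sub>F w in at (g x). norm (A w - A (g x) - A' (w - g x)) \<le> \<epsilon> * norm (w - g x)"
      using A that unfolding has_derivative_within_alt2 by blast
    then have "\<forall>\<^sub>F w in nhds (g x). norm (A w - A (g x) - A' (w - g x)) \<le> \<epsilon> * norm (w - g x)"
      unfolding eventually_at_filter by eventually_elim (auto simp: linear_0[OF linA])
    then show ?thesis using tend by (rule eventually_compose_filterlim)
  qed
  have B_near: "\<forall>\<^sub>F y in at x within S. norm (A (g y) - A (g x) - B (y - x)) \<le> \<epsilon> * norm (y - x)" if "0 < \<epsilon>" for \<epsilon>
    using Ag that unfolding has_derivative_within_alt2 by blast
  \<comment> \<open>With error c/2 for A and 1 for the composite, c |g y - g x| is at most (M + 1)
    |y - x| plus half of itself.\<close>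
  define C where "C = 2 / c * (M + 1)"
  have C0: "0 < C" using c M by (simp add: C_def)
  have g_near: "\<forall>\<^sub>F y in at x within S. norm (g y - g x) \<le> C * norm (y - x)"
    using A_near[OF half_gt_zero[OF c(1)]] B_near[OF zero_less_one]
  proof eventually_elim
    case (elim y)
    have "c * norm (g y - g x) \<le> norm (A (g y) - A (g x)) + norm (A (g y) - A (g x) - A' (g y - g x))"
      by (rule order_trans[OF c(2)]) (metis add.commute norm_minus_commute norm_triangle_sub)
    also have "norm (A (g y) - A (g x)) \<le> norm (B (y - x)) + norm (A (g y) - A (g x) - B (y - x))"
      by (metis add.commute norm_triangle_sub)
    also have "norm (B (y - x)) \<le> norm (y - x) * M" by (rule M)
    finally have "c * norm (g y - g x) \<le> 2 * (M + 1) * norm (y - x)" using elim by (simp add: algebra_simps)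
    then show ?case using c by (simp add: C_def field_simps)
  qed
  show ?thesis unfolding has_derivative_within_alt2
  proof (intro conjI allI impI)
    show "bounded_linear (L \<circ> B)"
      using L(1) linB by (simp add: bounded_linear_compose comp_def linear_conv_bounded_linear)
    fix \<epsilon> :: real assume \<epsilon>: "0 < \<epsilon>"
    \<comment> \<open>The total error is at most K \<delta> (1 + C) |y - x|.\<close>
    define \<delta> where "\<delta> = \<epsilon> / (K * (1 + C))"
    have \<delta>: "0 < \<delta>" using \<epsilon> K C0 by (simp add: \<delta>_def)
    show "\<forall>\<^sub>F y in at x within S. norm (g y - g x - (L \<circ> B) (y - x)) \<le> \<epsilon> * norm (y - x)"
      using A_near[OF \<delta>] B_near[OF \<delta>] g_near
    proof eventually_elim
      case (elim y)
      have "g y - g x = L (A' (g y - g x))" using L(2) by (metis comp_apply id_apply)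
      then have "g y - g x - L (B (y - x)) = L (A' (g y - g x) - B (y - x))"
        using linear_diff[OF L(1)] by metis
      also have "\<dots> = L ((A (g y) - A (g x) - B (y - x)) - (A (g y) - A (g x) - A' (g y - g x)))" by (simp add: algebra_simps)
      finally have "norm (g y - g x - L (B (y - x))) \<le> norm ((A (g y) - A (g x) - B (y - x)) - (A (g y) - A (g x) - A' (g y - g x))) * K"
        using K by metis
      also have "\<dots> \<le> (\<delta> * norm (y - x) + \<delta> * norm (g y - g x)) * K"
        using elim K norm_triangle_ineq4[of "A (g y) - A (g x) - B (y - x)" "A (g y) - A (g x) - A' (g y - g x)"]
        by (intro mult_right_mono) auto
      also have "\<dots> \<le> (\<delta> * norm (y - x) + \<delta> * (C * norm (y - x))) * K"
        using elim K \<delta> by (intro mult_right_mono add_left_mono mult_left_mono) auto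
      also have "\<dots> = \<epsilon> * norm (y - x)" using K C0 by (simp add: \<delta>_def divide_simps) (simp add: algebra_simps)
      finally show ?case by simp
    qed
  qed
qed

section \<open>Partial derivatives and their stability under rotation\<close>

lemma frechet_derivative_eq_pd:
  assumes "f differentiable (at z)"
  shows "frechet_derivative f (at z) h = Re h *\<^sub>R pd_x f z + Im h *\<^sub>R pd_y f z"
proof -
  have "frechet_derivative f (at z) (Re h *\<^sub>R 1 + Im h *\<^sub>R \<i>) = Re h *\<^sub>R pd_x f z + Im h *\<^sub>R pd_y f z"
    using linear_frechet_derivative[OF assms] by (simp add: linear_add linear_scale pd_x_def pd_y_def)
  moreover have "Re h *\<^sub>R 1 + Im h *\<^sub>R \<i> = h" by (simp add: complex_eq_iff)
  ultimately show ?thesis by simp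
qed

lemma has_derivative_pd:
  assumes "f differentiable (at z)"
  shows "(f has_derivative (\<lambda>h. Re h *\<^sub>R pd_x f z + Im h *\<^sub>R pd_y f z)) (at z)"
proof -
  have "frechet_derivative f (at z) = (\<lambda>h. Re h *\<^sub>R pd_x f z + Im h *\<^sub>R pd_y f z)"
    using frechet_derivative_eq_pd[OF assms] by auto
  then show ?thesis using assms frechet_derivative_works by metis
qed

lemma pd_unique:
  assumes "(f has_derivative D) (at z)"
  shows "pd_x f z = D 1" "pd_y f z = D \<i>"
  using frechet_derivative_at[OF assms] by (simp_all add: pd_x_def pd_y_def)

lemma C_timesD:
  assumes "C_times (Suc k) f U" "open U" "z \<in> U"
  shows "f differentiable (at z)" "(f has_derivative (\<lambda>h. Re h *\<^sub>R pd_x f z + Im h *\<^sub>R pd_y f z)) (at z)"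
proof -
  show "f differentiable (at z)" using assms differentiable_on_eq_differentiable_at by auto
  then show "(f has_derivative (\<lambda>h. Re h *\<^sub>R pd_x f z + Im h *\<^sub>R pd_y f z)) (at z)" by (rule has_derivative_pd)
qed

lemma C_times_continuous: "C_times k f U \<Longrightarrow> continuous_on U f"
  by (cases k) (auto intro: differentiable_imp_continuous_on)

lemma C_infinity_pd:
  assumes "C_infinity f U"
  shows "C_infinity (pd_x f) U" "C_infinity (pd_y f) U"
proof -
  have "C_times (Suc k) f U" for k using assms unfolding C_infinity_def by (rule spec)
  then show "C_infinity (pd_x f) U" "C_infinity (pd_y f) U" by (auto simp: C_infinity_def)
qed

lemma C_infinity_continuous: "C_infinity f U \<Longrightarrow> continuous_on U f"
  unfolding C_infinity_def using C_times_continuous by blast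

lemma C_infinityD:
  assumes "C_infinity f U" "open U" "z \<in> U"
  shows "f differentiable (at z)" "(f has_derivative (\<lambda>h. Re h *\<^sub>R pd_x f z + Im h *\<^sub>R pd_y f z)) (at z)"
proof -
  have "C_times (Suc 0) f U" using assms(1) unfolding C_infinity_def by (rule spec)
  from C_timesD[OF this assms(2,3)] show "f differentiable (at z)"
    "(f has_derivative (\<lambda>h. Re h *\<^sub>R pd_x f z + Im h *\<^sub>R pd_y f z)) (at z)" by auto
qed

lemma C_times_cong:
  assumes "open U" "\<And>z. z \<in> U \<Longrightarrow> f z = g z" "C_times k f U"
  shows "C_times k g U"
  using assms(2,3)
proof (induction k arbitrary: f g)
  case 0
  then show ?case by (metis C_times.simps(1) continuous_on_eq)
next
  case (Suc k)
  have der: "(g has_derivative (\<lambda>h. Re h *\<^sub>R pd_x f z + Im h *\<^sub>R pd_y f z)) (at z)" if "z \<in> U" for z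
    by (rule has_derivative_transform_within_open[OF C_timesD(2)[OF Suc.prems(2) assms(1) that] assms(1) that])
      (rule Suc.prems(1))
  have "pd_x f z = pd_x g z" "pd_y f z = pd_y g z" if "z \<in> U" for z
    using pd_unique[OF der[OF that]] by simp_all
  moreover have "g differentiable_on U"
    using der by (meson differentiable_at_withinI differentiable_def differentiable_on_def)
  ultimately show ?case using Suc.IH[of "pd_x f" "pd_x g"] Suc.IH[of "pd_y f" "pd_y g"] Suc.prems by auto
qed

lemma C_times_lincomb:
  assumes "open U" "C_times k f U" "C_times k g U"
  shows "C_times k (\<lambda>z. a *\<^sub>R f z + b *\<^sub>R g z) U"
  using assms(2,3)
proof (induction k arbitrary: f g)
  case 0
  then show ?case by (auto intro!: continuous_intros)
next
  case (Suc k)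
  have der: "((\<lambda>z. a *\<^sub>R f z + b *\<^sub>R g z) has_derivative
      (\<lambda>h. a *\<^sub>R (Re h *\<^sub>R pd_x f z + Im h *\<^sub>R pd_y f z) + b *\<^sub>R (Re h *\<^sub>R pd_x g z + Im h *\<^sub>R pd_y g z))) (at z)" if "z \<in> U" for z
    by (intro has_derivative_add has_derivative_scaleR_right C_timesD(2)[OF Suc.prems(1) assms(1) that]
       C_timesD(2)[OF Suc.prems(2) assms(1) that])
  have "C_times k (pd_x (\<lambda>z. a *\<^sub>R f z + b *\<^sub>R g z)) U"
    by (rule C_times_cong[OF assms(1) _ Suc.IH[of "pd_x f" "pd_x g"]]) (use Suc.prems in \<open>simp_all add: pd_unique[OF der]\<close>)
  moreover have "C_times k (pd_y (\<lambda>z. a *\<^sub>R f z + b *\<^sub>R g z)) U"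
    by (rule C_times_cong[OF assms(1) _ Suc.IH[of "pd_y f" "pd_y g"]]) (use Suc.prems in \<open>simp_all add: pd_unique[OF der]\<close>)
  moreover have "(\<lambda>z. a *\<^sub>R f z + b *\<^sub>R g z) differentiable_on U"
    using der by (meson differentiable_at_withinI differentiable_def differentiable_on_def)
  ultimately show ?case by simp
qed

lemma has_derivative_rotate:
  assumes "C_times (Suc k) f U" "open U" "c * z \<in> U"
  shows "((\<lambda>z. f (c * z)) has_derivative (\<lambda>h. Re (c * h) *\<^sub>R pd_x f (c * z) + Im (c * h) *\<^sub>R pd_y f (c * z))) (at z)"
proof -
  have "((\<lambda>z. c * z) has_derivative (\<lambda>h. c * h)) (at z)" by (auto intro!: derivative_eq_intros)
  from has_derivative_compose[OF this, of f] C_timesD(2)[OF assms] show ?thesis by blast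
qed

text \<open>By the chain rule the partial derivatives of the rotated map are constant linear
  combinations of rotated partial derivatives of f, which closes the induction.\<close>

lemma C_times_rotate:
  assumes U: "open U" and cU: "\<And>z. z \<in> U \<Longrightarrow> c * z \<in> U" and "C_times k f U"
  shows "C_times k (\<lambda>z. f (c * z)) U"
  using assms(3)
proof (induction k arbitrary: f)
  case 0
  then show ?case by (auto intro!: continuous_on_compose2[of U f] continuous_intros cU)
next
  case (Suc k)
  have der: "((\<lambda>z. f (c * z)) has_derivative (\<lambda>h. Re (c * h) *\<^sub>R pd_x f (c * z) + Im (c * h) *\<^sub>R pd_y f (c * z))) (at z)"
    if "z \<in> U" for z
    by (rule has_derivative_rotate[OF Suc.prems U cU[OF that]])
  have "C_times k (pd_x (\<lambda>z. f (c * z))) U"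
    by (rule C_times_cong[OF U _ C_times_lincomb[OF U Suc.IH[of "pd_x f"] Suc.IH[of "pd_y f"], of "Re c" "Im c"]])
      (use Suc.prems in \<open>simp_all add: pd_unique[OF der]\<close>)
  \<comment> \<open>The coefficients are the real and imaginary parts of the product of c with the
    imaginary unit.\<close>
  moreover have "C_times k (pd_y (\<lambda>z. f (c * z))) U"
    by (rule C_times_cong[OF U _ C_times_lincomb[OF U Suc.IH[of "pd_x f"] Suc.IH[of "pd_y f"], of "- Im c" "Re c"]])
      (use Suc.prems in \<open>simp_all add: pd_unique[OF der]\<close>)
  moreover have "(\<lambda>z. f (c * z)) differentiable_on U"
    using der by (meson differentiable_at_withinI differentiable_def differentiable_on_def)
  ultimately show ?case by simp
qed

lemma has_vector_derivative_pd:
  assumes "f differentiable (at (Complex s t))"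
  shows "((\<lambda>s. f (Complex s t)) has_vector_derivative pd_x f (Complex s t)) (at s)"
    "((\<lambda>t. f (Complex s t)) has_vector_derivative pd_y f (Complex s t)) (at t)"
proof -
  have "((\<lambda>s. Complex s t) has_derivative (\<lambda>h. of_real h)) (at s)"
    "((\<lambda>t. Complex s t) has_derivative (\<lambda>h. \<i> * of_real h)) (at t)"
    unfolding Complex_eq by (auto intro!: derivative_eq_intros)
  note has_derivative_compose[OF this(1) has_derivative_pd[OF assms]]
    has_derivative_compose[OF this(2) has_derivative_pd[OF assms]]
  then show "((\<lambda>s. f (Complex s t)) has_vector_derivative pd_x f (Complex s t)) (at s)"
    "((\<lambda>t. f (Complex s t)) has_vector_derivative pd_y f (Complex s t)) (at t)"
    by (simp_all add: has_vector_derivative_def)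
qed

text \<open>Symmetry of second derivatives: f(x, t) - f(a, t) is the integral of
  \<open>pd_x f\<close> over [a, x]; differentiating it in t under the integral sign, and then in x
  at x = a, produces both orders of differentiation.\<close>

lemma pd_commute:
  fixes f :: "complex \<Rightarrow> 'b::banach"
  assumes U: "open U" and z: "z \<in> U" and f: "C_infinity f U"
  shows "pd_y (pd_x f) z = pd_x (pd_y f) z"
proof -
  obtain r where r: "0 < r" "ball z r \<subseteq> U" using U z openE by blast
  \<comment> \<open>The rectangle over [a, a + \<delta>] and [b - \<delta>/2, b + \<delta>/2] lies
    in the ball, since |s - a| + |t - b| is at most 3r/4 on it.\<close>
  define a b \<delta> where "a = Re z" "b = Im z" "\<delta> = r / 2"
  have zab: "z = Complex a b" by (simp add: a_b_\<delta>_def)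
  have \<delta>: "0 < \<delta>" using r by (simp add: a_b_\<delta>_def)
  define I where "I = {b - \<delta>/2..b + \<delta>/2}"
  have inU: "Complex s t \<in> U" if "s \<in> {a..a + \<delta>}" "t \<in> I" for s t
  proof -
    have "norm (Complex s t - z) \<le> \<bar>s - a\<bar> + \<bar>t - b\<bar>"
      using cmod_le[of "Complex s t - z"] by (simp add: zab)
    also have "\<dots> < r" using that \<delta> r unfolding I_def a_b_\<delta>_def(3) by (auto simp: abs_if)
    finally show ?thesis using r by (auto simp: dist_norm norm_minus_commute)
  qed
  note dif = C_infinityD(1)[OF f U] and difx = C_infinityD(1)[OF C_infinity_pd(1)[OF f] U]
    and dify = C_infinityD(1)[OF C_infinity_pd(2)[OF f] U]
  note pdx = has_vector_derivative_pd(1)[THEN has_vector_derivative_at_within]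
    and pdy = has_vector_derivative_pd(2)[THEN has_vector_derivative_at_within]
  have cC: "continuous_on A (\<lambda>(t, s). Complex s t)" for A
    unfolding Complex_eq split_beta by (intro continuous_intros)
  have cxy: "continuous_on (I \<times> {a..a+\<delta>}) (\<lambda>(t, s). pd_y (pd_x f) (Complex s t))"
    using continuous_on_compose2[OF C_infinity_continuous[OF C_infinity_pd(2)[OF C_infinity_pd(1)[OF f]]] cC, of "I \<times> {a..a+\<delta>}"] inU
    by (force simp: split_beta)
  have cx: "continuous_on {a..x} (\<lambda>s. pd_x f (Complex s t))" if "t \<in> I" "x \<le> a + \<delta>" for t x
    unfolding Complex_eq
    by (rule continuous_on_compose2[OF C_infinity_continuous[OF C_infinity_pd(1)[OF f]]])
      (use that inU[of _ t] in \<open>auto intro!: continuous_intros simp: Complex_eq\<close>)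
  have bI: "b \<in> I" using \<delta> by (auto simp: I_def)
  have key: "integral {a..x} (\<lambda>s. pd_y (pd_x f) (Complex s b)) = pd_y f (Complex x b) - pd_y f (Complex a b)"
    if x: "x \<in> {a..a+\<delta>}" for x
  proof -
    have "((\<lambda>t. integral (cbox a x) (\<lambda>s. pd_x f (Complex s t))) has_vector_derivative
       integral (cbox a x) (\<lambda>s. pd_y (pd_x f) (Complex s b))) (at b within I)"
    proof (rule leibniz_rule_vector_derivative[where f="\<lambda>t s. pd_x f (Complex s t)" and fx="\<lambda>t s. pd_y (pd_x f) (Complex s t)"])
      show "((\<lambda>t. pd_x f (Complex s t)) has_vector_derivative pd_y (pd_x f) (Complex s t)) (at t within I)"
        if "t \<in> I" "s \<in> cbox a x" for s t
        using that x by (intro pdy difx inU) auto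
      show "(\<lambda>s. pd_x f (Complex s t)) integrable_on cbox a x" if "t \<in> I" for t
        using cx[OF that, of x] x by (simp add: integrable_continuous_interval)
      show "continuous_on (I \<times> cbox a x) (\<lambda>(t, s). pd_y (pd_x f) (Complex s t))"
        by (rule continuous_on_subset[OF cxy]) (use x in auto)
    qed (use bI in \<open>auto simp: I_def\<close>)
    moreover have int: "integral (cbox a x) (\<lambda>s. pd_x f (Complex s t)) = f (Complex x t) - f (Complex a t)" if "t \<in> I" for t
      using x that by (intro integral_unique) (auto intro!: fundamental_theorem_of_calculus pdx dif inU)
    ultimately have "((\<lambda>t. f (Complex x t) - f (Complex a t)) has_vector_derivative
       integral (cbox a x) (\<lambda>s. pd_y (pd_x f) (Complex s b))) (at b within I)"
      by (intro has_vector_derivative_transform[OF bI int[symmetric]])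
    moreover have "((\<lambda>t. f (Complex x t) - f (Complex a t)) has_vector_derivative
       pd_y f (Complex x b) - pd_y f (Complex a b)) (at b within I)"
      using x bI \<delta> by (intro has_vector_derivative_diff pdy dif inU) auto
    ultimately show ?thesis
      using vector_derivative_unique_within_closed_interval[of "b - \<delta>/2" "b + \<delta>/2" b] \<delta>
      by (simp add: I_def)
  qed
  have "((\<lambda>x. integral {a..x} (\<lambda>s. pd_y (pd_x f) (Complex s b))) has_vector_derivative pd_y (pd_x f) (Complex a b)) (at a within {a..a+\<delta>})"
  proof (rule integral_has_vector_derivative)
    show "continuous_on {a..a+\<delta>} (\<lambda>s. pd_y (pd_x f) (Complex s b))"
      unfolding Complex_eq
      by (rule continuous_on_compose2[OF C_infinity_continuous[OF C_infinity_pd(2)[OF C_infinity_pd(1)[OF f]]]])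
        (use inU[of _ b] bI in \<open>auto intro!: continuous_intros simp: Complex_eq\<close>)
  qed (use \<delta> in auto)
  then have "((\<lambda>x. pd_y f (Complex x b) - pd_y f (Complex a b)) has_vector_derivative pd_y (pd_x f) (Complex a b)) (at a within {a..a+\<delta>})"
    by (rule has_vector_derivative_transform[rotated 2]) (use key \<delta> in auto)
  moreover have "((\<lambda>x. pd_y f (Complex x b) - pd_y f (Complex a b)) has_vector_derivative pd_x (pd_y f) (Complex a b) - 0) (at a within {a..a+\<delta>})"
    using bI \<delta> by (intro has_vector_derivative_diff pdx dify inU has_vector_derivative_const) auto
  ultimately show ?thesis
    using vector_derivative_unique_within_closed_interval[of a "a+\<delta>" a] \<delta> by (simp add: zab)
qed

section \<open>Comparison in geodesic normal coordinates\<close>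

text \<open>Lagrange's formula for the iterated cross product shows that the cross product of u with
  the normal vanishes, so u is a multiple of the normal.\<close>

lemma orthogonal_eq_normal_component:
  fixes u a b :: "real^3"
  assumes "u \<bullet> a = 0" "u \<bullet> b = 0" "cross3 a b \<noteq> 0"
  shows "u = (u \<bullet> sgn (cross3 a b)) *\<^sub>R sgn (cross3 a b)"
proof -
  define c where "c = cross3 a b"
  have "cross3 u c = 0" unfolding c_def by (simp add: Lagrange assms)
  then have "(c \<bullet> c) *\<^sub>R u = (c \<bullet> u) *\<^sub>R c" using Lagrange[of c u c] by simp
  moreover have "c \<bullet> c = (norm c)\<^sup>2" by (simp add: power2_norm_eq_inner)
  moreover have "norm c \<noteq> 0" using assms by (simp add: c_def)
  ultimately have "u = ((c \<bullet> u) / (norm c)\<^sup>2) *\<^sub>R c"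
    by (metis (no_types, lifting) divide_inverse mult.commute power2_eq_square scaleR_scaleR scaleR_one left_inverse mult_eq_0_iff)
  then show ?thesis unfolding c_def[symmetric]
    by (simp add: sgn_div_norm inner_commute power2_eq_square divide_inverse mult_ac)
qed

lemma has_real_derivative_inner_self:
  fixes f :: "real \<Rightarrow> 'a::real_inner"
  assumes "(f has_derivative (\<lambda>h. h *\<^sub>R f')) (at t)"
  shows "((\<lambda>t. f t \<bullet> f t) has_real_derivative 2 * (f t \<bullet> f')) (at t)"
  unfolding has_field_derivative_def
  by (rule has_derivative_eq_rhs[OF has_derivative_inner[OF assms assms]]) (auto simp: inner_commute)

lemma pd_cong:
  assumes "open U" "z \<in> U" "\<And>w. w \<in> U \<Longrightarrow> f w = g w" "f differentiable (at z)"
  shows "pd_x f z = pd_x g z" "pd_y f z = pd_y g z"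
proof -
  have "(g has_derivative (\<lambda>h. Re h *\<^sub>R pd_x f z + Im h *\<^sub>R pd_y f z)) (at z)"
    by (rule has_derivative_transform_within_open[OF has_derivative_pd[OF assms(4)] assms(1,2)]) (rule assms(3))
  from pd_unique[OF this] show "pd_x f z = pd_x g z" "pd_y f z = pd_y g z" by simp_all
qed

text \<open>The inner sum is a second derivative along the ray of x + iy. Multiplied by t^2 it
  becomes the Hessian form in the coordinates of the point t (x + iy), which is where normality is
  given.\<close>

lemma quadratic_form_scaleR:
  fixes u v w :: "'a::real_vector"
  shows "t\<^sup>2 *\<^sub>R (x *\<^sub>R (x *\<^sub>R u + y *\<^sub>R v) + y *\<^sub>R (x *\<^sub>R v + y *\<^sub>R w)) =
    (t * x)\<^sup>2 *\<^sub>R u + (2 * (t * x) * (t * y)) *\<^sub>R v + (t * y)\<^sup>2 *\<^sub>R w"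
proof -
  have "2 * (t * x) * (t * y) = t\<^sup>2 * (x * y) + t\<^sup>2 * (y * x)" by (simp add: power2_eq_square)
  then show ?thesis
    by (simp only: scaleR_add_left scaleR_add_right scaleR_scaleR) (simp add: power2_eq_square mult_ac)
qed

section \<open>Radial geodesics: constant speed, Gauss lemma, Jacobi inequality\<close>

text \<open>What a geodesic disk provides, in terms of Y alone: by \<open>radial\<close> the second
  derivative along the ray of z, taken at z, is normal to the surface, so rays are geodesics;
  \<open>iso\<close> normalizes the differential at the centre. Cartesian coordinates avoid the
  singularity of polar ones at 0.\<close>

locale radial_chart =
  fixes Y :: "complex \<Rightarrow> real^3" and \<rho> :: real
  assumes pos: "0 < \<rho>"
    and smooth: "C_infinity Y (ball 0 \<rho>)"
    and inj: "\<And>z. z \<in> ball 0 \<rho> \<Longrightarrow> inj (frechet_derivative Y (at z))"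
    and mean: "\<And>z. z \<in> ball 0 \<rho> \<Longrightarrow> mean_curvature Y z = 0"
    and radial: "\<And>z h. z \<in> ball 0 \<rho> \<Longrightarrow>
       ((Re z)\<^sup>2 *\<^sub>R pd_x (pd_x Y) z + (2 * Re z * Im z) *\<^sub>R pd_x (pd_y Y) z + (Im z)\<^sup>2 *\<^sub>R pd_y (pd_y Y) z)
         \<bullet> frechet_derivative Y (at z) h = 0"
    and iso: "\<And>h. norm (frechet_derivative Y (at 0) h) = norm h"
begin

abbreviation "P \<equiv> pd_x Y"
abbreviation "R \<equiv> pd_y Y"

lemmas smooth_P = C_infinity_pd(1)[OF smooth] and smooth_R = C_infinity_pd(2)[OF smooth]
lemmas dif_Y = C_infinityD(1)[OF smooth open_ball]
  and dif_P = C_infinityD(1)[OF smooth_P open_ball] and dif_R = C_infinityD(1)[OF smooth_R open_ball]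
  and dif_Px = C_infinityD(1)[OF C_infinity_pd(1)[OF smooth_P] open_ball]
  and dif_Rx = C_infinityD(1)[OF C_infinity_pd(1)[OF smooth_R] open_ball]
  and dif_Ry = C_infinityD(1)[OF C_infinity_pd(2)[OF smooth_R] open_ball]
  and dif_Py = C_infinityD(1)[OF C_infinity_pd(2)[OF smooth_P] open_ball]

lemma Py: "z \<in> ball 0 \<rho> \<Longrightarrow> pd_y P z = pd_x R z"
  by (rule pd_commute[OF open_ball _ smooth])

lemma dY: "z \<in> ball 0 \<rho> \<Longrightarrow> frechet_derivative Y (at z) h = Re h *\<^sub>R P z + Im h *\<^sub>R R z"
  by (rule frechet_derivative_eq_pd[OF dif_Y])

text \<open>The Hessian of Y at z evaluated on (z, z), which is the acceleration at t = 1 of the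
  curve Y(tz).\<close>

definition "H z = (Re z)\<^sup>2 *\<^sub>R pd_x P z + (2 * Re z * Im z) *\<^sub>R pd_x R z + (Im z)\<^sup>2 *\<^sub>R pd_y R z"

lemma H_orth: "H z \<bullet> P z = 0" "H z \<bullet> R z = 0" if "z \<in> ball 0 \<rho>"
  using radial[OF that, of 1] radial[OF that, of \<i>] dY[OF that] by (simp_all add: H_def)

lemma PR_0: "norm (P 0) = 1" "norm (R 0) = 1" "P 0 \<bullet> R 0 = 0"
proof -
  have 0: "(0::complex) \<in> ball 0 \<rho>" using pos by simp
  show "norm (P 0) = 1" "norm (R 0) = 1" using iso[of 1] iso[of \<i>] dY[OF 0] by simp_all
  moreover have "(norm (P 0 + R 0))\<^sup>2 = 2" using iso[of "1 + \<i>"] dY[OF 0, of "1 + \<i>"] by (simp add: cmod_power2)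
  moreover have "(norm (P 0 + R 0))\<^sup>2 = (norm (P 0))\<^sup>2 + (norm (R 0))\<^sup>2 + 2 * (P 0 \<bullet> R 0)"
    by (simp add: power2_norm_eq_inner inner_add_left inner_add_right inner_commute)
  ultimately show "P 0 \<bullet> R 0 = 0" by simp
qed

text \<open>Along a ray the acceleration is normal and the velocity tangential, so the squared speed
  is constant; at t = 0 it is |z|^2 by \<open>iso\<close>.\<close>

lemma radial_speed:
  assumes z: "z \<in> ball 0 \<rho>"
  shows "norm (Re z *\<^sub>R P z + Im z *\<^sub>R R z) = norm z"
proof -
  define x y where "x = Re z" and "y = Im z"
  define q where "q t = x *\<^sub>R P (of_real t * z) + y *\<^sub>R R (of_real t * z)" for t :: real
  define q' where "q' t = x *\<^sub>R (x *\<^sub>R pd_x P (of_real t * z) + y *\<^sub>R pd_y P (of_real t * z))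
     + y *\<^sub>R (x *\<^sub>R pd_x R (of_real t * z) + y *\<^sub>R pd_y R (of_real t * z))" for t :: real
  have in_ball: "of_real t * z \<in> ball 0 \<rho>" if "0 \<le> t" "t \<le> 1" for t
    using that z mult_left_le_one_le[of "norm z" t] by (simp add: norm_mult)
  have q_der: "(q has_vector_derivative q' t) (at t)" if "0 \<le> t" "t \<le> 1" for t
  proof -
    have m: "((\<lambda>t. of_real t * z) has_derivative (\<lambda>h. of_real h * z)) (at t)"
      by (auto intro!: derivative_eq_intros)
    note has_derivative_compose[OF m has_derivative_pd[OF dif_P[OF in_ball[OF that]]]]
      has_derivative_compose[OF m has_derivative_pd[OF dif_R[OF in_ball[OF that]]]]
    note has_derivative_add[OF has_derivative_scaleR_right[OF this(1), of x] has_derivative_scaleR_right[OF this(2), of y]]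
    then show ?thesis unfolding has_vector_derivative_def q_def[abs_def] q'_def
      by (simp add: x_def y_def algebra_simps)
  qed
  have qq: "((\<lambda>t. q t \<bullet> q t) has_real_derivative 2 * (q t \<bullet> q' t)) (at t)" if "0 \<le> t" "t \<le> 1" for t
    by (rule has_real_derivative_inner_self[OF q_der[OF that, unfolded has_vector_derivative_def]])
  have "q 1 \<bullet> q 1 = q 0 \<bullet> q 0"
  proof (rule DERIV_isconst_end[where f="\<lambda>t. q t \<bullet> q t" and a=0 and b=1])
    show "continuous_on {0..1} (\<lambda>t. q t \<bullet> q t)"
      using qq by (intro DERIV_atLeastAtMost_imp_continuous_on) blast
    show "((\<lambda>t. q t \<bullet> q t) has_real_derivative 0) (at t)" if "0 < t" "t < 1" for t
    proof -
      have t: "of_real t * z \<in> ball 0 \<rho>" using in_ball that by simp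
      \<comment> \<open>\<open>H\<close> at tz contains the coordinates of tz, whence the factor
        t^2, which is divided out for t > 0.\<close>
      have "t\<^sup>2 *\<^sub>R q' t = H (of_real t * z)"
        unfolding q'_def H_def Py[OF t]
        by (subst quadratic_form_scaleR) (simp add: x_def y_def)
      then have "t\<^sup>2 * (q t \<bullet> q' t) = q t \<bullet> H (of_real t * z)" by (metis inner_scaleR_right)
      also have "\<dots> = 0" using H_orth[OF t] by (simp add: q_def inner_add_right inner_commute[of _ "H _"])
      finally have "t\<^sup>2 * (q t \<bullet> q' t) = 0" .
      then show ?thesis using qq[of t] that by simp
    qed
  qed simp
  moreover have "q 0 \<bullet> q 0 = x\<^sup>2 + y\<^sup>2"
    using PR_0 by (simp add: q_def inner_add_left inner_add_right inner_commute norm_eq_1 power2_eq_square)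
  ultimately have "(norm (q 1))\<^sup>2 = (norm z)\<^sup>2" by (simp add: cmod_power2 x_def y_def flip: power2_norm_eq_inner)
  then show ?thesis by (simp add: q_def x_def y_def)
qed

lemma axis_in_ball: "0 \<le> s \<Longrightarrow> s < \<rho> \<Longrightarrow> Complex s 0 \<in> ball 0 \<rho>"
  by (simp add: complex_norm)

lemmas dX = has_vector_derivative_pd(1)[unfolded has_vector_derivative_def]
lemmas dT = has_vector_derivative_pd(2)[unfolded has_vector_derivative_def]

lemma axis_P:
  assumes "0 \<le> s" "s < \<rho>"
  shows "P (Complex s 0) \<bullet> P (Complex s 0) = 1"
proof (cases "s = 0")
  case True
  then show ?thesis using PR_0 by (simp add: norm_eq_1 flip: zero_complex.code)
next
  case False
  then show ?thesis using radial_speed[OF axis_in_ball[OF assms]] assms by (simp add: complex_norm norm_eq_1)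
qed

text \<open>For s > 0 this is the derivative in t, at t = 0, of the identity |s P + t R|^2 = s^2 +
  t^2 at the points (s, t), divided by 2s. At the centre it is the orthogonality of P and R.\<close>

lemma axis_P_variation:
  assumes "0 \<le> s" "s < \<rho>"
  shows "P (Complex s 0) \<bullet> (R (Complex s 0) + s *\<^sub>R pd_x R (Complex s 0)) = 0"
proof (cases "s = 0")
  case True
  then show ?thesis using PR_0 by (simp flip: zero_complex.code)
next
  case False
  define A where "A t = s *\<^sub>R P (Complex s t) + t *\<^sub>R R (Complex s t)" for t
  note b = axis_in_ball[OF assms]
  have "(A has_derivative (\<lambda>h. h *\<^sub>R (s *\<^sub>R pd_x R (Complex s 0) + R (Complex s 0)))) (at 0)"
    unfolding A_def[abs_def]
    by (rule has_derivative_eq_rhs, (rule derivative_eq_intros refl dT dif_P dif_R b)+)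
      (auto simp: Py[OF b] algebra_simps)
  then have "((\<lambda>t. A t \<bullet> A t) has_real_derivative 2 * (A 0 \<bullet> (s *\<^sub>R pd_x R (Complex s 0) + R (Complex s 0)))) (at 0)"
    by (rule has_real_derivative_inner_self)
  moreover have "((\<lambda>t. A t \<bullet> A t) has_real_derivative 0) (at 0)"
  proof -
    have "((\<lambda>t. s\<^sup>2 + t\<^sup>2) has_real_derivative 0) (at 0)" by (auto intro!: derivative_eq_intros)
    moreover have "open {t. Complex s t \<in> ball 0 \<rho>}"
      unfolding Complex_eq mem_ball dist_norm by (intro open_Collect_less continuous_intros)
    ultimately show ?thesis
    proof (rule has_field_derivative_transform_within_open)
      show "s\<^sup>2 + t\<^sup>2 = A t \<bullet> A t" if "t \<in> {t. Complex s t \<in> ball 0 \<rho>}" for t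
        using radial_speed[of "Complex s t"] that by (simp add: A_def complex_norm flip: power2_norm_eq_inner)
    qed (use b in simp)
  qed
  ultimately have "2 * (A 0 \<bullet> (s *\<^sub>R pd_x R (Complex s 0) + R (Complex s 0))) = 0" by (rule DERIV_unique)
  then show ?thesis using False by (simp add: A_def add.commute)
qed

lemma axis_Px:
  assumes "0 < s" "s < \<rho>"
  shows "pd_x P (Complex s 0) \<bullet> P (Complex s 0) = 0" "pd_x P (Complex s 0) \<bullet> R (Complex s 0) = 0"
  using H_orth[of "Complex s 0"] axis_in_ball[of s] assms by (auto simp: H_def)

text \<open>The Gauss lemma. Along the axis the derivative of s <P, R> is s <P_x, R> + <P, R + s
  R_x>; the first term vanishes because P_x is normal, the second by
  \<open>axis_P_variation\<close>.\<close>

lemma axis_orth: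
  assumes "0 \<le> s" "s < \<rho>"
  shows "P (Complex s 0) \<bullet> R (Complex s 0) = 0"
proof (cases "s = 0")
  case True
  then show ?thesis using PR_0 by (simp flip: zero_complex.code)
next
  case False
  define f where "f t = t * (P (Complex t 0) \<bullet> R (Complex t 0))" for t
  have f: "(f has_real_derivative P (Complex t 0) \<bullet> R (Complex t 0) + t * (pd_x P (Complex t 0) \<bullet> R (Complex t 0) +
       P (Complex t 0) \<bullet> pd_x R (Complex t 0))) (at t)" if "0 \<le> t" "t \<le> s" for t
  proof -
    have b: "Complex t 0 \<in> ball 0 \<rho>" using axis_in_ball[of t] that assms by simp
    have i: "((\<lambda>t. P (Complex t 0) \<bullet> R (Complex t 0)) has_real_derivative
      pd_x P (Complex t 0) \<bullet> R (Complex t 0) + P (Complex t 0) \<bullet> pd_x R (Complex t 0)) (at t)"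
      unfolding has_field_derivative_def
      by (rule has_derivative_eq_rhs[OF has_derivative_inner[OF dX[OF dif_P[OF b]] dX[OF dif_R[OF b]]]])
        (auto simp: algebra_simps)
    show ?thesis unfolding f_def[abs_def]
      by (rule derivative_eq_intros i refl)+ (simp add: algebra_simps)
  qed
  have "f s = f 0"
  proof (rule DERIV_isconst_end[where f=f and a=0 and b=s])
    show "0 < s" using assms False by simp
    show "continuous_on {0..s} f"
      using f by (intro DERIV_atLeastAtMost_imp_continuous_on) blast
    show "(f has_real_derivative 0) (at t)" if "0 < t" "t < s" for t
      using f[of t] axis_Px[of t] axis_P_variation[of t] that assms by (simp add: inner_add_right)
  qed
  then show ?thesis using False by (simp add: f_def)
qed

lemma axis_R_nonzero:
  assumes "0 \<le> s" "s < \<rho>"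
  shows "R (Complex s 0) \<noteq> 0"
proof
  assume "R (Complex s 0) = 0"
  then have "frechet_derivative Y (at (Complex s 0)) \<i> = frechet_derivative Y (at (Complex s 0)) 0"
    using dY[OF axis_in_ball[OF assms]] by simp
  then show False using inj[OF axis_in_ball[OF assms]] by (auto dest: injD)
qed

text \<open>On the axis E = 1 and F = 0, so vanishing mean curvature reads n = - G l, while P_x is
  the normal vector l N. The inner product is therefore l n = - G l^2: the sign of the Gauss
  curvature, in the form required by the Jacobi inequality.\<close>

lemma axis_curvature:
  assumes "0 < s" "s < \<rho>"
  shows "pd_x P (Complex s 0) \<bullet> pd_y R (Complex s 0) \<le> 0"
proof -
  define z where "z = Complex s 0"
  have b: "z \<in> ball 0 \<rho>" using axis_in_ball[of s] assms by (simp add: z_def)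
  have PP: "P z \<bullet> P z = 1" and PR: "P z \<bullet> R z = 0" and R0: "R z \<noteq> 0"
    using axis_P[of s] axis_orth[of s] axis_R_nonzero[of s] assms by (auto simp: z_def)
  have "cross3 (P z) (R z) \<noteq> 0"
  proof
    assume "cross3 (P z) (R z) = 0"
    then have "(norm (P z) * norm (R z))\<^sup>2 = 0" using norm_cross_dot[of "P z" "R z"] PR by simp
    then show False using PP R0 by auto
  qed
  define N where "N = unit_normal Y z"
  have Px: "pd_x P z = (pd_x P z \<bullet> N) *\<^sub>R N"
    unfolding N_def unit_normal_def
    by (rule orthogonal_eq_normal_component) (use axis_Px[OF assms] \<open>cross3 (P z) (R z) \<noteq> 0\<close> in \<open>auto simp: z_def\<close>)
  define G where "G = R z \<bullet> R z"
  have "0 < G" using R0 by (simp add: G_def)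
  then have "pd_y R z \<bullet> N = - G * (pd_x P z \<bullet> N)"
    using mean[OF b] PP PR by (simp add: mean_curvature_def Let_def N_def[symmetric] G_def[symmetric] add_eq_0_iff)
  then have "pd_x P z \<bullet> pd_y R z = - G * (pd_x P z \<bullet> N)\<^sup>2"
    by (subst Px) (simp add: power2_eq_square inner_commute)
  then show ?thesis using \<open>0 < G\<close> by (simp add: z_def)
qed

text \<open>Differentiating the orthogonality of \<open>H\<close> and R across the axis shows that
  the right side plus s^2 times the quantity of \<open>axis_curvature\<close> is zero. The variation
  field of the rays is J = s R, and s^2 R_xx + 2 s R_x = s J'', so the claim is <J, J''> \<ge>
  0.\<close>

lemma axis_Jacobi:
  assumes "0 \<le> s" "s < \<rho>"
  shows "0 \<le> R (Complex s 0) \<bullet> (s\<^sup>2 *\<^sub>R pd_x (pd_x R) (Complex s 0) + (2 * s) *\<^sub>R pd_x R (Complex s 0))"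
proof (cases "s = 0")
  case False
  then have s: "0 < s" using assms by simp
  define z where "z = Complex s 0"
  have b: "z \<in> ball 0 \<rho>" using axis_in_ball[OF assms] by (simp add: z_def)
  \<comment> \<open>Two exchanges of derivatives give P_xy = R_xx.\<close>
  have "pd_y (pd_x P) z = pd_x (pd_y P) z" by (rule pd_commute[OF open_ball b smooth_P])
  also have "\<dots> = pd_x (pd_x R) z" by (rule pd_cong[OF open_ball b Py dif_Py[OF b]])
  finally have Pxy: "pd_y (pd_x P) z = pd_x (pd_x R) z" .
  have "((\<lambda>t. H (Complex s t) \<bullet> R (Complex s t)) has_derivative (\<lambda>h. h *
     ((s\<^sup>2 *\<^sub>R pd_x (pd_x R) z + (2 * s) *\<^sub>R pd_x R z) \<bullet> R z + (s\<^sup>2 *\<^sub>R pd_x P z) \<bullet> pd_y R z))) (at 0)"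
    unfolding H_def complex.sel
    by (rule has_derivative_eq_rhs, (rule derivative_eq_intros refl dT dif_Px dif_Rx dif_Ry dif_R b[unfolded z_def])+)
       (auto simp: algebra_simps inner_commute Pxy[unfolded z_def] z_def)
  moreover have "((\<lambda>t. H (Complex s t) \<bullet> R (Complex s t)) has_derivative (\<lambda>h. h * 0)) (at 0)"
  proof -
    have "((\<lambda>t. 0) has_derivative (\<lambda>h. h * 0)) (at (0::real))" by (simp add: has_derivative_const)
    moreover have "open {t. Complex s t \<in> ball 0 \<rho>}"
      unfolding Complex_eq mem_ball dist_norm by (intro open_Collect_less continuous_intros)
    ultimately show ?thesis
      by (rule has_derivative_transform_within_open) (use b H_orth in \<open>auto simp: z_def\<close>)
  qed
  ultimately have "(s\<^sup>2 *\<^sub>R pd_x (pd_x R) z + (2 * s) *\<^sub>R pd_x R z) \<bullet> R z + (s\<^sup>2 *\<^sub>R pd_x P z) \<bullet> pd_y R z = 0"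
    using has_derivative_unique by (metis (no_types, lifting) mult_1 mult_zero_right)
  moreover have "s\<^sup>2 * (pd_x P z \<bullet> pd_y R z) \<le> 0"
    using axis_curvature[OF s assms(2)] by (simp add: z_def mult_le_0_iff)
  ultimately show ?thesis by (simp add: z_def inner_commute)
qed simp

text \<open>With f = t |R|, the length of the Jacobi field, the Wronskian t f' - f = t^2 |R|'
  vanishes at 0 and has derivative t f'' \<ge> 0. So |R| is nondecreasing, and it starts at
  1.\<close>

theorem axis_expanding:
  assumes "0 \<le> s" "s < \<rho>"
  shows "1 \<le> norm (R (Complex s 0))"
proof -
  define r where "r t = R (Complex t 0)" for t
  define r' where "r' t = pd_x R (Complex t 0)" for t
  define r'' where "r'' t = pd_x (pd_x R) (Complex t 0)" for t
  have b: "Complex t 0 \<in> ball 0 \<rho>" if "0 \<le> t" "t \<le> s" for t using axis_in_ball[of t] that assms by simp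
  have dr: "(r has_derivative (\<lambda>h. h *\<^sub>R r' t)) (at t)" "(r' has_derivative (\<lambda>h. h *\<^sub>R r'' t)) (at t)"
    if "0 \<le> t" "t \<le> s" for t
    unfolding r_def[abs_def] r'_def[abs_def] r''_def using dX[OF dif_R[OF b[OF that]]] dX[OF dif_Rx[OF b[OF that]]] by auto
  have r0: "norm (r t) \<noteq> 0" if "0 \<le> t" "t \<le> s" for t
    using axis_R_nonzero[of t] that assms by (simp add: r_def)
  define \<psi> where "\<psi> t = t\<^sup>2 * ((r t \<bullet> r' t) / norm (r t))" for t
  \<comment> \<open>The derivative is arranged in two summands, nonnegative by the Jacobi inequality
    and by the Cauchy-Schwarz inequality respectively.\<close>
  define \<psi>' where "\<psi>' t = (r t \<bullet> (t\<^sup>2 *\<^sub>R r'' t + (2 * t) *\<^sub>R r' t)) / norm (r t) +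
      t\<^sup>2 * ((norm (r' t))\<^sup>2 * (norm (r t))\<^sup>2 - (r t \<bullet> r' t)\<^sup>2) / norm (r t) ^ 3" for t
  have d\<psi>: "(\<psi> has_real_derivative \<psi>' t) (at t)" if "0 \<le> t" "t \<le> s" for t
  proof -
    have n: "((\<lambda>t. norm (r t)) has_derivative (\<lambda>h. h * (r t \<bullet> r' t) / norm (r t))) (at t)"
      using has_derivative_compose[OF dr(1)[OF that] has_derivative_norm[of "r t"]] r0[OF that]
      by (simp add: sgn_div_norm inner_commute divide_inverse mult.commute mult.left_commute)
    show ?thesis unfolding \<psi>_def[abs_def] has_field_derivative_def
      by (rule has_derivative_eq_rhs, (rule derivative_eq_intros refl dr n that r0)+)
       (use r0[OF that] in \<open>auto simp: \<psi>'_def fun_eq_iff power2_norm_eq_inner divide_simps inner_add_right inner_add_left inner_commute;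
          simp add: algebra_simps power2_eq_square power3_eq_cube flip: power2_norm_eq_inner\<close>)
  qed
  have \<psi>'_nonneg: "0 \<le> \<psi>' t" if "0 \<le> t" "t \<le> s" for t
  proof -
    have "0 \<le> r t \<bullet> (t\<^sup>2 *\<^sub>R r'' t + (2 * t) *\<^sub>R r' t)"
      using axis_Jacobi[of t] that assms by (simp add: r_def r'_def r''_def)
    moreover have "(r t \<bullet> r' t)\<^sup>2 \<le> (norm (r t))\<^sup>2 * (norm (r' t))\<^sup>2"
      using Cauchy_Schwarz_ineq by (simp add: power2_norm_eq_inner)
    ultimately show ?thesis unfolding \<psi>'_def by (simp add: mult.commute)
  qed
  have \<psi>: "\<psi> 0 \<le> \<psi> t" if t: "0 \<le> t" "t \<le> s" for t
  proof (rule DERIV_nonneg_imp_nondecreasing[OF t(1)])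
    fix x assume "0 \<le> x" "x \<le> t"
    then show "\<exists>y. (\<psi> has_real_derivative y) (at x) \<and> 0 \<le> y" using d\<psi>[of x] \<psi>'_nonneg[of x] t by auto
  qed
  have rr': "0 \<le> r t \<bullet> r' t" if "0 < t" "t \<le> s" for t
    using \<psi>[of t] r0[of t] that by (simp add: \<psi>_def zero_le_mult_iff zero_le_divide_iff)
  have drr: "((\<lambda>t. r t \<bullet> r t) has_real_derivative 2 * (r t \<bullet> r' t)) (at t)" if "0 \<le> t" "t \<le> s" for t
    using dr(1)[OF that] by (rule has_real_derivative_inner_self)
  have "r 0 \<bullet> r 0 \<le> r s \<bullet> r s"
  proof (cases "s = 0")
    case False
    then have "0 < s" using assms by simp
    then obtain t where "0 < t" "t < s" "r s \<bullet> r s - r 0 \<bullet> r 0 = (s - 0) * (2 * (r t \<bullet> r' t))"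
      using MVT2[of 0 s "\<lambda>t. r t \<bullet> r t" "\<lambda>t. 2 * (r t \<bullet> r' t)"] drr by blast
    then show ?thesis using rr'[of t] \<open>0 < s\<close> by (smt (verit) mult_nonneg_nonneg)
  qed simp
  moreover have "r 0 \<bullet> r 0 = 1" using PR_0(2) by (simp add: r_def norm_eq_1 flip: zero_complex.code)
  ultimately show ?thesis by (simp add: r_def norm_eq_sqrt_inner)
qed

end

section \<open>Uniqueness of geodesics\<close>

text \<open>The factor exp (- K t) makes w nonincreasing, the factor exp (K t) makes it
  nondecreasing. The sign \<sigma> treats both at once, for times after and before
  \<open>t0\<close>.\<close>

lemma Gronwall_zero:
  fixes w :: "real \<Rightarrow> real"
  assumes der: "\<And>t. t \<in> {a..b} \<Longrightarrow> (w has_real_derivative w' t) (at t within {a..b})"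
    and bound: "\<And>t. t \<in> {a..b} \<Longrightarrow> \<bar>w' t\<bar> \<le> K * w t"
    and nonneg: "\<And>t. t \<in> {a..b} \<Longrightarrow> 0 \<le> w t"
    and t0: "t0 \<in> {a..b}" "w t0 = 0" and t: "t \<in> {a..b}"
  shows "w t = 0"
proof -
  have mono: "\<sigma> * (w y * exp (- (\<sigma> * K * y))) \<le> \<sigma> * (w x * exp (- (\<sigma> * K * x)))"
    if xy: "a \<le> x" "x < y" "y \<le> b" and \<sigma>: "\<sigma> = 1 \<or> \<sigma> = -1"
    and s: "\<And>t. t \<in> {a..b} \<Longrightarrow> \<sigma> * (w' t - \<sigma> * K * w t) \<le> 0" for x y \<sigma>
  proof -
    have "((\<lambda>t. w t * exp (- (\<sigma> * K * t))) has_real_derivative (w' t - \<sigma> * K * w t) * exp (- (\<sigma> * K * t))) (at t within {x..y})"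
      if "x \<le> t" "t \<le> y" for t
    proof -
      have d: "(w has_real_derivative w' t) (at t within {x..y})"
        by (rule DERIV_subset[OF der]) (use that xy in auto)
      have "((\<lambda>t. exp (- (\<sigma> * K * t))) has_real_derivative exp (- (\<sigma> * K * t)) * (- (\<sigma> * K))) (at t within {x..y})"
        by (rule derivative_eq_intros refl)+ simp
      from DERIV_mult[OF d this] show ?thesis by (rule DERIV_cong) (simp add: algebra_simps)
    qed
    note der' = this[unfolded has_field_derivative_def]
    from mvt_simple[OF xy(2) der'] obtain t where t: "t \<in> {x<..<y}" "w y * exp (- (\<sigma> * K * y)) - w x * exp (- (\<sigma> * K * x)) =
       (w' t - \<sigma> * K * w t) * exp (- (\<sigma> * K * t)) * (y - x)"
      by blast
    have "\<sigma> * (w' t - \<sigma> * K * w t) \<le> 0" using s[of t] t xy by auto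
    then have "(\<sigma> * (w' t - \<sigma> * K * w t)) * (exp (- (\<sigma> * K * t)) * (y - x)) \<le> 0"
      by (rule mult_nonpos_nonneg) (use xy in simp)
    moreover have "\<sigma> * (w y * exp (- (\<sigma> * K * y))) - \<sigma> * (w x * exp (- (\<sigma> * K * x))) =
       (\<sigma> * (w' t - \<sigma> * K * w t)) * (exp (- (\<sigma> * K * t)) * (y - x))"
      unfolding right_diff_distrib[of \<sigma> "w y * _", symmetric] t(2) by (simp only: mult.assoc)
    ultimately show ?thesis by simp
  qed
  have bound_le: "1 * (w' t - 1 * K * w t) \<le> 0" "-1 * (w' t - -1 * K * w t) \<le> 0" if "t \<in> {a..b}" for t
    using bound[OF that] by (simp_all add: abs_le_iff)
  consider "t = t0" | "t0 < t" | "t < t0" by linarith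
  then show ?thesis
  proof cases
    case 2
    have "1 * (w t * exp (- (1 * K * t))) \<le> 1 * (w t0 * exp (- (1 * K * t0)))"
      by (rule mono) (use 2 t0 t bound_le(1) in auto)
    then show ?thesis using nonneg[OF t] t0 by (simp add: mult_le_0_iff)
  next
    case 3
    have "-1 * (w t0 * exp (- (-1 * K * t0))) \<le> -1 * (w t * exp (- (-1 * K * t)))"
      by (rule mono) (use 3 t0 t bound_le(2) in auto)
    then show ?thesis using nonneg[OF t] t0 by (simp add: mult_le_0_iff)
  qed (use t0 in simp)
qed

text \<open>Boundedness together with a difference estimate in terms of the error \<open>e\<close> is stable under
  algebraic operations, which spares all explicit Lipschitz constants below.\<close>

definition close_pair :: "'p set \<Rightarrow> ('p \<Rightarrow> real) \<Rightarrow> ('p \<Rightarrow> 'b::real_normed_vector) \<Rightarrow> ('p \<Rightarrow> 'b) \<Rightarrow> bool" where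
  "close_pair J e f1 f2 \<longleftrightarrow> (\<exists>B\<ge>0. \<forall>t\<in>J. norm (f1 t) \<le> B \<and> norm (f2 t) \<le> B \<and> norm (f1 t - f2 t) \<le> B * e t)"

lemma close_pairE:
  assumes "close_pair J e f1 f2"
  obtains B where "0 \<le> B" "\<And>t. t \<in> J \<Longrightarrow> norm (f1 t) \<le> B" "\<And>t. t \<in> J \<Longrightarrow> norm (f2 t) \<le> B"
    "\<And>t. t \<in> J \<Longrightarrow> norm (f1 t - f2 t) \<le> B * e t"
  using assms unfolding close_pair_def by blast

lemma close_pairI:
  assumes e: "\<And>t. t \<in> J \<Longrightarrow> 0 \<le> e t"
    and "\<And>t. t \<in> J \<Longrightarrow> norm (f1 t) \<le> B" "\<And>t. t \<in> J \<Longrightarrow> norm (f2 t) \<le> B"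
    "\<And>t. t \<in> J \<Longrightarrow> norm (f1 t - f2 t) \<le> C * e t"
  shows "close_pair J e f1 f2"
  unfolding close_pair_def
proof (intro exI conjI ballI)
  let ?M = "max 0 (max B C)"
  show "0 \<le> ?M" by simp
  fix t assume t: "t \<in> J"
  show "norm (f1 t) \<le> ?M" "norm (f2 t) \<le> ?M" using assms(2,3)[OF t] by auto
  show "norm (f1 t - f2 t) \<le> ?M * e t"
    by (rule order_trans[OF assms(4)[OF t]]) (intro mult_right_mono e[OF t], simp)
qed

lemma close_pair_bilinear:
  assumes "bounded_bilinear bop" and e: "\<And>t. t \<in> J \<Longrightarrow> 0 \<le> e t"
    and f: "close_pair J e f1 f2" and g: "close_pair J e g1 g2"
  shows "close_pair J e (\<lambda>t. bop (f1 t) (g1 t)) (\<lambda>t. bop (f2 t) (g2 t))"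
proof -
  interpret bounded_bilinear bop by fact
  obtain K where K: "0 \<le> K" "\<And>a b. norm (bop a b) \<le> norm a * norm b * K" using nonneg_bounded by blast
  obtain A where A: "0 \<le> A" "\<And>t. t \<in> J \<Longrightarrow> norm (f1 t) \<le> A" "\<And>t. t \<in> J \<Longrightarrow> norm (f2 t) \<le> A"
    "\<And>t. t \<in> J \<Longrightarrow> norm (f1 t - f2 t) \<le> A * e t" using f by (rule close_pairE) blast
  obtain B where B: "0 \<le> B" "\<And>t. t \<in> J \<Longrightarrow> norm (g1 t) \<le> B" "\<And>t. t \<in> J \<Longrightarrow> norm (g2 t) \<le> B"
    "\<And>t. t \<in> J \<Longrightarrow> norm (g1 t - g2 t) \<le> B * e t" using g by (rule close_pairE) blast
  show ?thesis
  proof (rule close_pairI[OF e, where B="A * B * K" and C="2 * (A * B * K)"])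
    fix t assume t: "t \<in> J"
    show "norm (bop (f1 t) (g1 t)) \<le> A * B * K" "norm (bop (f2 t) (g2 t)) \<le> A * B * K"
      by (rule order_trans[OF K(2)], intro mult_mono A B t K mult_nonneg_nonneg norm_ge_zero order_refl)+
    have "bop (f1 t) (g1 t) - bop (f2 t) (g2 t) = bop (f1 t) (g1 t - g2 t) + bop (f1 t - f2 t) (g2 t)"
      by (simp add: diff_left diff_right)
    then have "norm (bop (f1 t) (g1 t) - bop (f2 t) (g2 t)) \<le> norm (bop (f1 t) (g1 t - g2 t)) + norm (bop (f1 t - f2 t) (g2 t))"
      by (metis norm_triangle_ineq)
    also have "norm (bop (f1 t) (g1 t - g2 t)) \<le> A * (B * e t) * K"
      by (rule order_trans[OF K(2)], intro mult_mono A B t K mult_nonneg_nonneg norm_ge_zero order_refl e)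
    also have "norm (bop (f1 t - f2 t) (g2 t)) \<le> (A * e t) * B * K"
      by (rule order_trans[OF K(2)], intro mult_mono A B t K mult_nonneg_nonneg norm_ge_zero order_refl e)
    finally show "norm (bop (f1 t) (g1 t) - bop (f2 t) (g2 t)) \<le> 2 * (A * B * K) * e t" by (simp add: algebra_simps)
  qed
qed

lemma close_pair_add:
  assumes e: "\<And>t. t \<in> J \<Longrightarrow> 0 \<le> e t"
    and f: "close_pair J e f1 f2" and g: "close_pair J e g1 g2"
  shows "close_pair J e (\<lambda>t. f1 t + g1 t) (\<lambda>t. f2 t + g2 t)"
proof -
  obtain A where A: "0 \<le> A" "\<And>t. t \<in> J \<Longrightarrow> norm (f1 t) \<le> A" "\<And>t. t \<in> J \<Longrightarrow> norm (f2 t) \<le> A"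
    "\<And>t. t \<in> J \<Longrightarrow> norm (f1 t - f2 t) \<le> A * e t" using f by (rule close_pairE) blast
  obtain B where B: "0 \<le> B" "\<And>t. t \<in> J \<Longrightarrow> norm (g1 t) \<le> B" "\<And>t. t \<in> J \<Longrightarrow> norm (g2 t) \<le> B"
    "\<And>t. t \<in> J \<Longrightarrow> norm (g1 t - g2 t) \<le> B * e t" using g by (rule close_pairE) blast
  show ?thesis
  proof (rule close_pairI[OF e, where B="A + B" and C="A + B"])
    fix t assume t: "t \<in> J"
    show "norm (f1 t + g1 t) \<le> A + B" "norm (f2 t + g2 t) \<le> A + B"
      by (intro norm_triangle_mono A B t)+
    have "f1 t + g1 t - (f2 t + g2 t) = (f1 t - f2 t) + (g1 t - g2 t)" by simp
    then show "norm (f1 t + g1 t - (f2 t + g2 t)) \<le> (A + B) * e t"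
      unfolding distrib_right by (metis norm_triangle_mono A(4) B(4) t)
  qed
qed

lemma close_pair_minus: "close_pair J e f1 f2 \<Longrightarrow> close_pair J e (\<lambda>t. - f1 t) (\<lambda>t. - f2 t)"
  unfolding close_pair_def by (simp add: norm_minus_commute add.commute)

lemma close_pair_inverse:
  fixes f1 f2 :: "'p \<Rightarrow> real"
  assumes e: "\<And>t. t \<in> J \<Longrightarrow> 0 \<le> e t" and f: "close_pair J e f1 f2"
    and \<kappa>: "0 < \<kappa>" "\<And>t. t \<in> J \<Longrightarrow> \<kappa> \<le> f1 t" "\<And>t. t \<in> J \<Longrightarrow> \<kappa> \<le> f2 t"
  shows "close_pair J e (\<lambda>t. inverse (f1 t)) (\<lambda>t. inverse (f2 t))"
proof -
  obtain A where A: "0 \<le> A" "\<And>t. t \<in> J \<Longrightarrow> norm (f1 t - f2 t) \<le> A * e t" using f by (rule close_pairE) blast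
  show ?thesis
  proof (rule close_pairI[OF e, where B="inverse \<kappa>" and C="inverse \<kappa> * inverse \<kappa> * A"])
    fix t assume t: "t \<in> J"
    have f12: "0 < f1 t" "0 < f2 t" using \<kappa>(2,3)[OF t] \<kappa>(1) by auto
    have i: "inverse (f1 t) \<le> inverse \<kappa>" "inverse (f2 t) \<le> inverse \<kappa>"
      using \<kappa>(2,3)[OF t] \<kappa>(1) by (auto intro!: le_imp_inverse_le)
    then show "norm (inverse (f1 t)) \<le> inverse \<kappa>" "norm (inverse (f2 t)) \<le> inverse \<kappa>" using f12 by simp_all
    have "inverse (f1 t) - inverse (f2 t) = inverse (f1 t) * inverse (f2 t) * (f2 t - f1 t)"
      using f12 by (simp add: field_simps)
    then have "norm (inverse (f1 t) - inverse (f2 t)) = inverse (f1 t) * inverse (f2 t) * norm (f1 t - f2 t)"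
      using f12 by (simp add: abs_mult abs_minus_commute)
    also have "\<dots> \<le> inverse \<kappa> * inverse \<kappa> * (A * e t)"
      using f12 \<kappa>(1) by (intro mult_mono i A t mult_nonneg_nonneg) auto
    finally show "norm (inverse (f1 t) - inverse (f2 t)) \<le> inverse \<kappa> * inverse \<kappa> * A * e t" by simp
  qed
qed

text \<open>A closed ball is compact and convex, so bounds for the partial derivatives on it yield a
  Lipschitz constant.\<close>

lemma close_pair_smooth:
  fixes f :: "complex \<Rightarrow> 'b::real_normed_vector"
  assumes f: "C_infinity f U" and U: "open U" "cball c0 r \<subseteq> U"
    and c: "\<And>t. t \<in> J \<Longrightarrow> c1 t \<in> cball c0 r" "\<And>t. t \<in> J \<Longrightarrow> c2 t \<in> cball c0 r"
    and e: "\<And>t. t \<in> J \<Longrightarrow> norm (c1 t - c2 t) \<le> e t"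
  shows "close_pair J e (\<lambda>t. f (c1 t)) (\<lambda>t. f (c2 t))"
proof -
  have bdd: "\<exists>B. \<forall>z\<in>cball c0 r. norm (g z) \<le> B" if g: "C_infinity g U" for g :: "complex \<Rightarrow> 'b"
  proof -
    have "continuous_on (cball c0 r) g" using C_infinity_continuous[OF g] U(2) by (rule continuous_on_subset)
    then have "compact (g ` cball c0 r)" by (rule compact_continuous_image) simp
    then have "bounded (g ` cball c0 r)" by (rule compact_imp_bounded)
    then show ?thesis by (auto simp: bounded_iff)
  qed
  obtain B0 where B0: "\<And>z. z \<in> cball c0 r \<Longrightarrow> norm (f z) \<le> B0" using bdd[OF f] by blast
  obtain Bx where Bx: "\<And>z. z \<in> cball c0 r \<Longrightarrow> norm (pd_x f z) \<le> Bx" using bdd[OF C_infinity_pd(1)[OF f]] by blast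
  obtain By where By: "\<And>z. z \<in> cball c0 r \<Longrightarrow> norm (pd_y f z) \<le> By" using bdd[OF C_infinity_pd(2)[OF f]] by blast
  have lip: "norm (f z - f w) \<le> (Bx + By) * norm (z - w)" if "z \<in> cball c0 r" "w \<in> cball c0 r" for z w
  proof (rule differentiable_bound[OF convex_cball _ _ that])
    fix x assume x: "x \<in> cball c0 r"
    show "(f has_derivative (\<lambda>h. Re h *\<^sub>R pd_x f x + Im h *\<^sub>R pd_y f x)) (at x within cball c0 r)"
      by (rule has_derivative_at_withinI, rule C_infinityD(2)[OF f U(1)]) (use x U(2) in auto)
    show "onorm (\<lambda>h. Re h *\<^sub>R pd_x f x + Im h *\<^sub>R pd_y f x) \<le> Bx + By"
    proof (rule onorm_le)
      fix h :: complex
      have "norm (Re h *\<^sub>R pd_x f x + Im h *\<^sub>R pd_y f x) \<le> \<bar>Re h\<bar> * norm (pd_x f x) + \<bar>Im h\<bar> * norm (pd_y f x)"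
        by (metis norm_scaleR norm_triangle_ineq)
      also have "\<dots> \<le> norm h * Bx + norm h * By"
        by (intro add_mono mult_mono abs_Re_le_cmod abs_Im_le_cmod Bx By x) auto
      finally show "norm (Re h *\<^sub>R pd_x f x + Im h *\<^sub>R pd_y f x) \<le> (Bx + By) * norm h" by (simp add: algebra_simps)
    qed
  qed
  show ?thesis
  proof (rule close_pairI[where B=B0 and C="Bx + By"])
    fix t assume t: "t \<in> J"
    show "0 \<le> e t" using e[OF t] norm_ge_zero order_trans by blast
    have "0 \<le> Bx" "0 \<le> By" using Bx[OF c(1)[OF t]] By[OF c(1)[OF t]] norm_ge_zero order_trans by blast+
    then show "norm (f (c1 t) - f (c2 t)) \<le> (Bx + By) * e t"
      by (intro order_trans[OF lip[OF c(1)[OF t] c(2)[OF t]]] mult_left_mono e t) simp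
  qed (use B0 c in auto)
qed

section \<open>The geodesic equation in a chart as a first order system\<close>

lemma bounded_bilinear_cross3: "bounded_bilinear cross3"
  using bilinear_cross bilinear_conv_bounded_bilinear by blast

text \<open>The normal field is left unnormalized. It and its partial derivatives
  \<open>nrm_x\<close> and \<open>nrm_y\<close> are then sums of cross products of derivatives of Y,
  and the only quantity to be inverted is its squared length.\<close>

definition "nrm Y c = cross3 (pd_x Y c) (pd_y Y c)"
definition "nrm_x Y c = cross3 (pd_x (pd_x Y) c) (pd_y Y c) + cross3 (pd_x Y c) (pd_x (pd_y Y) c)"
definition "nrm_y Y c = cross3 (pd_y (pd_x Y) c) (pd_y Y c) + cross3 (pd_x Y c) (pd_y (pd_y Y) c)"

text \<open>The coordinate velocity solving \<open>DY(c) u = v\<close>, by Cramer's rule for the Gram matrix.\<close>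

definition "lift_x Y c v = inverse (nrm Y c \<bullet> nrm Y c) *
   ((v \<bullet> pd_x Y c) * (pd_y Y c \<bullet> pd_y Y c) + - ((v \<bullet> pd_y Y c) * (pd_x Y c \<bullet> pd_y Y c)))"
definition "lift_y Y c v = inverse (nrm Y c \<bullet> nrm Y c) *
   ((v \<bullet> pd_y Y c) * (pd_x Y c \<bullet> pd_x Y c) + - ((v \<bullet> pd_x Y c) * (pd_x Y c \<bullet> pd_y Y c)))"

text \<open>The geodesic equation solved for the acceleration. The acceleration is a multiple of the
  normal n, and differentiating <v, n> = 0 along the curve gives <acc, n> = - <v, n'>, where n' is
  the derivative of n in the direction of the coordinate velocity.\<close>

definition "geodesic_acc Y c v =
   (- (inverse (nrm Y c \<bullet> nrm Y c) * (v \<bullet> (lift_x Y c v *\<^sub>R nrm_x Y c + lift_y Y c v *\<^sub>R nrm_y Y c)))) *\<^sub>R nrm Y c"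

text \<open>The right sides of the system are built from derivatives of Y and the velocity by sums,
  bilinear operations and one inversion, so the closure rules apply. On the compact ball the
  inverted quantity has a positive lower bound.\<close>

lemma close_pair_geodesic_field:
  fixes Y :: "complex \<Rightarrow> real^3"
  assumes Y: "C_infinity Y U" and U: "open U" "cball c0 r \<subseteq> U"
    and inj: "\<And>z. z \<in> U \<Longrightarrow> nrm Y z \<noteq> 0"
    and c: "\<And>t. t \<in> J \<Longrightarrow> c1 t \<in> cball c0 r" "\<And>t. t \<in> J \<Longrightarrow> c2 t \<in> cball c0 r"
    and e: "\<And>t. t \<in> J \<Longrightarrow> norm (c1 t - c2 t) \<le> e t"
    and v: "close_pair J e v1 v2"
  shows "close_pair J e (\<lambda>t. lift_x Y (c1 t) (v1 t)) (\<lambda>t. lift_x Y (c2 t) (v2 t))"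
    "close_pair J e (\<lambda>t. lift_y Y (c1 t) (v1 t)) (\<lambda>t. lift_y Y (c2 t) (v2 t))"
    "close_pair J e (\<lambda>t. geodesic_acc Y (c1 t) (v1 t)) (\<lambda>t. geodesic_acc Y (c2 t) (v2 t))"
proof -
  have e0: "0 \<le> e t" if "t \<in> J" for t using e[OF that] norm_ge_zero order_trans by blast
  note sm = close_pair_smooth[OF _ U c e]
  note Px = C_infinity_pd(1)[OF Y] and Py = C_infinity_pd(2)[OF Y]
  note base = sm[OF Px] sm[OF Py] sm[OF C_infinity_pd(1)[OF Px]] sm[OF C_infinity_pd(2)[OF Px]]
    sm[OF C_infinity_pd(1)[OF Py]] sm[OF C_infinity_pd(2)[OF Py]]
  note add = close_pair_add[OF e0] and minus = close_pair_minus
    and cross = close_pair_bilinear[OF bounded_bilinear_cross3 e0]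
    and inner = close_pair_bilinear[OF bounded_bilinear_inner e0]
    and mult = close_pair_bilinear[OF bounded_bilinear_mult e0]
    and scale = close_pair_bilinear[OF bounded_bilinear_scaleR e0]
  have nrm: "close_pair J e (\<lambda>t. nrm Y (c1 t)) (\<lambda>t. nrm Y (c2 t))"
    unfolding nrm_def by (intro cross base)
  have nx: "close_pair J e (\<lambda>t. nrm_x Y (c1 t)) (\<lambda>t. nrm_x Y (c2 t))"
    unfolding nrm_x_def by (intro add cross base)
  have ny: "close_pair J e (\<lambda>t. nrm_y Y (c1 t)) (\<lambda>t. nrm_y Y (c2 t))"
    unfolding nrm_y_def by (intro add cross base)
  have "continuous_on (cball c0 r) (\<lambda>z. nrm Y z \<bullet> nrm Y z)" unfolding nrm_def
    by (intro continuous_intros continuous_on_cross continuous_on_subset[OF C_infinity_continuous[OF Px]]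
      continuous_on_subset[OF C_infinity_continuous[OF Py]] U)
  then have "\<exists>\<kappa>>0. \<forall>z\<in>cball c0 r. \<kappa> \<le> nrm Y z \<bullet> nrm Y z"
  proof (cases "cball c0 r = {}")
    case True
    then show ?thesis by (intro exI[of _ 1]) auto
  next
    case False
    then obtain z where z: "z \<in> cball c0 r" "\<And>w. w \<in> cball c0 r \<Longrightarrow> nrm Y z \<bullet> nrm Y z \<le> nrm Y w \<bullet> nrm Y w"
      using continuous_attains_inf[OF compact_cball False \<open>continuous_on _ _\<close>] by blast
    then show ?thesis using inj[of z] U by (intro exI[of _ "nrm Y z \<bullet> nrm Y z"]) auto
  qed
  then obtain \<kappa> where \<kappa>: "0 < \<kappa>" "\<And>z. z \<in> cball c0 r \<Longrightarrow> \<kappa> \<le> nrm Y z \<bullet> nrm Y z" by blast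
  have inv: "close_pair J e (\<lambda>t. inverse (nrm Y (c1 t) \<bullet> nrm Y (c1 t))) (\<lambda>t. inverse (nrm Y (c2 t) \<bullet> nrm Y (c2 t)))"
    by (intro close_pair_inverse[OF e0 _ \<kappa>(1)] inner nrm \<kappa>(2) c)
  show lx: "close_pair J e (\<lambda>t. lift_x Y (c1 t) (v1 t)) (\<lambda>t. lift_x Y (c2 t) (v2 t))"
    unfolding lift_x_def by (intro mult add minus inner base v inv)
  show ly: "close_pair J e (\<lambda>t. lift_y Y (c1 t) (v1 t)) (\<lambda>t. lift_y Y (c2 t) (v2 t))"
    unfolding lift_y_def by (intro mult add minus inner base v inv)
  show "close_pair J e (\<lambda>t. geodesic_acc Y (c1 t) (v1 t)) (\<lambda>t. geodesic_acc Y (c2 t) (v2 t))"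
    unfolding geodesic_acc_def by (intro mult add minus inner scale nrm nx ny lx ly v inv)
qed

text \<open>The squared length of the cross product is E G - F^2, the determinant of the linear
  system for a and b obtained by pairing v with P and Q.\<close>

lemma gram_cramer:
  fixes P Q v :: "real^3"
  assumes n: "cross3 P Q \<noteq> 0" and v: "v = a *\<^sub>R P + b *\<^sub>R Q"
  shows "a = inverse (cross3 P Q \<bullet> cross3 P Q) * ((v \<bullet> P) * (Q \<bullet> Q) + - ((v \<bullet> Q) * (P \<bullet> Q)))"
    "b = inverse (cross3 P Q \<bullet> cross3 P Q) * ((v \<bullet> Q) * (P \<bullet> P) + - ((v \<bullet> P) * (P \<bullet> Q)))"
proof -
  define E F G where "E = P \<bullet> P" and "F = P \<bullet> Q" and "G = Q \<bullet> Q"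
  have vP: "v \<bullet> P = a * E + b * F" and vQ: "v \<bullet> Q = a * F + b * G"
    unfolding v E_def F_def G_def by (simp_all add: inner_add_left inner_commute[of Q P])
  have nn: "cross3 P Q \<bullet> cross3 P Q = E * G - F * F"
    using norm_cross_dot[of P Q] unfolding power_mult_distrib power2_norm_eq_inner E_def F_def G_def
    by (simp add: power2_eq_square)
  have "E * G - F * F \<noteq> 0" using n nn by (metis inner_eq_zero_iff)
  moreover have "(v \<bullet> P) * G + - ((v \<bullet> Q) * F) = a * (E * G - F * F)" "(v \<bullet> Q) * E + - ((v \<bullet> P) * F) = b * (E * G - F * F)"
    unfolding vP vQ by (simp_all add: algebra_simps)
  ultimately show "a = inverse (cross3 P Q \<bullet> cross3 P Q) * ((v \<bullet> P) * (Q \<bullet> Q) + - ((v \<bullet> Q) * (P \<bullet> Q)))"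
    "b = inverse (cross3 P Q \<bullet> cross3 P Q) * ((v \<bullet> Q) * (P \<bullet> P) + - ((v \<bullet> P) * (P \<bullet> Q)))"
    unfolding nn E_def[symmetric] F_def[symmetric] G_def[symmetric] by simp_all
qed

lemma nrm_nonzero:
  assumes dif: "Y differentiable (at z)" and inj: "inj (frechet_derivative Y (at z))"
  shows "nrm Y z \<noteq> 0"
proof
  assume "nrm Y z = 0"
  then have "collinear {0, pd_x Y z, pd_y Y z}" by (simp add: nrm_def cross_eq_0)
  then obtain a b where ab: "a \<noteq> 0 \<or> b \<noteq> 0" "a *\<^sub>R pd_x Y z + b *\<^sub>R pd_y Y z = 0"
    unfolding collinear_lemma
  proof (elim disjE exE)
    fix c assume "pd_y Y z = c *\<^sub>R pd_x Y z"
    then show thesis using that[of c "-1"] by simp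
  qed (use that[of 1 0] that[of 0 1] in simp_all)
  then have "frechet_derivative Y (at z) (Complex a b) = frechet_derivative Y (at z) 0"
    using frechet_derivative_eq_pd[OF dif, of "Complex a b"] frechet_derivative_eq_pd[OF dif, of 0] by simp
  then have "Complex a b = 0" using inj by (auto dest: injD)
  then show False using ab by (simp add: complex_eq_iff)
qed

lemma regular_paramD:
  assumes "regular_param X S U \<phi> V"
  shows "open U" "openin (top_of_set S) V" "C_infinity (X \<circ> \<phi>) U"
    "\<And>z. z \<in> U \<Longrightarrow> inj (frechet_derivative (X \<circ> \<phi>) (at z))" "\<And>z. z \<in> U \<Longrightarrow> (X \<circ> \<phi>) differentiable (at z)"
    "\<exists>\<psi>. homeomorphism U V \<phi> \<psi>"
  using assms C_infinityD(1)[of "X \<circ> \<phi>" U] unfolding regular_param_def by blast+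

lemma pd_in_tangent_plane:
  assumes reg: "regular_param X S U \<phi> V" and z: "z \<in> U"
  shows "frechet_derivative (X \<circ> \<phi>) (at z) h \<in> tangent_plane X S (\<phi> z)"
  unfolding tangent_plane_def using assms by blast

lemma pd_tangent:
  assumes reg: "regular_param X S U \<phi> V" and z: "z \<in> U"
  shows "pd_x (X \<circ> \<phi>) z \<in> tangent_plane X S (\<phi> z)" "pd_y (X \<circ> \<phi>) z \<in> tangent_plane X S (\<phi> z)"
  unfolding pd_x_def pd_y_def using pd_in_tangent_plane[OF assms] by blast+

text \<open>A piece of a geodesic that runs inside one chart. The state of the system is the chart
  point \<open>c\<close> together with the ambient velocity \<open>vel\<close>, which avoids
  Christoffel symbols. A priori \<open>c\<close> is only continuous, as the image of the path under
  a homeomorphism.\<close>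

locale geodesic_in_chart =
  fixes X :: "'a::topological_space \<Rightarrow> real^3" and S :: "'a set" and U \<phi> V \<psi> \<gamma> vel acc and \<alpha> \<beta> :: real
  assumes reg: "regular_param X S U \<phi> V" and hom: "homeomorphism U V \<phi> \<psi>"
    and \<alpha>\<beta>: "\<alpha> < \<beta>" and J: "{\<alpha>..\<beta>} \<subseteq> {0..1}"
    and cont: "continuous_on {0..1} \<gamma>" and inV: "\<And>t. t \<in> {\<alpha>..\<beta>} \<Longrightarrow> \<gamma> t \<in> V"
    and vel: "\<And>t. t \<in> {0..1} \<Longrightarrow> ((X \<circ> \<gamma>) has_vector_derivative vel t) (at t within {0..1})"
    and acc: "\<And>t. t \<in> {0..1} \<Longrightarrow> (vel has_vector_derivative acc t) (at t within {0..1})"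
    and acc_orth: "\<And>t w. t \<in> {0..1} \<Longrightarrow> w \<in> tangent_plane X S (\<gamma> t) \<Longrightarrow> acc t \<bullet> w = 0"
begin

definition "Y = X \<circ> \<phi>"
definition "c = \<psi> \<circ> \<gamma>"

lemma cU: "c t \<in> U" and \<phi>c: "\<phi> (c t) = \<gamma> t" if "t \<in> {\<alpha>..\<beta>}"
  using hom inV[OF that] unfolding homeomorphism_def c_def by auto

lemma cont_c: "continuous_on {\<alpha>..\<beta>} c"
proof -
  have "continuous_on V \<psi>" using hom by (simp add: homeomorphism_def)
  then have "continuous_on (\<gamma> ` {\<alpha>..\<beta>}) \<psi>" by (rule continuous_on_subset) (use inV in auto)
  with continuous_on_subset[OF cont J] show ?thesis unfolding c_def by (rule continuous_on_compose)
qed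

text \<open>Only X after the path is differentiable by assumption. Injectivity of the differential
  of Y transfers this to \<open>c\<close>, and the chain rule then exhibits \<open>vel\<close> as a
  tangential vector.\<close>

lemma velocity:
  assumes t: "t \<in> {\<alpha>..\<beta>}"
  obtains u where "(c has_vector_derivative u) (at t within {\<alpha>..\<beta>})" "vel t = Re u *\<^sub>R pd_x Y (c t) + Im u *\<^sub>R pd_y Y (c t)"
proof -
  note r = regular_paramD[OF reg, folded Y_def]
  define D where "D h = Re h *\<^sub>R pd_x Y (c t) + Im h *\<^sub>R pd_y Y (c t)" for h
  have D: "(Y has_derivative D) (at (c t))" unfolding D_def[abs_def] by (rule has_derivative_pd[OF r(5)[OF cU[OF t]]])
  have "D = frechet_derivative Y (at (c t))" using frechet_derivative_at[OF D] by simp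
  then have "inj D" using r(4)[OF cU[OF t]] by simp
  then obtain L where L: "linear L" "L \<circ> D = id"
    using linear_injective_left_inverse[OF has_derivative_linear[OF D]] by auto
  have "((X \<circ> \<gamma>) has_vector_derivative vel t) (at t within {\<alpha>..\<beta>})"
    by (rule has_vector_derivative_within_subset[OF vel J]) (use t J in auto)
  then have Yc: "((\<lambda>s. Y (c s)) has_vector_derivative vel t) (at t within {\<alpha>..\<beta>})"
    by (rule has_vector_derivative_transform[OF t, rotated]) (use \<phi>c in \<open>auto simp: Y_def\<close>)
  have "(c has_derivative L \<circ> (\<lambda>h. h *\<^sub>R vel t)) (at t within {\<alpha>..\<beta>})"
    using D L Yc cont_c t by (intro has_derivative_lift) (auto simp: has_vector_derivative_def continuous_on_eq_continuous_within)
  then have c': "(c has_vector_derivative L (vel t)) (at t within {\<alpha>..\<beta>})"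
    using L(1) by (simp add: has_vector_derivative_def o_def linear_scale)
  have "((\<lambda>s. Y (c s)) has_vector_derivative D (L (vel t))) (at t within {\<alpha>..\<beta>})"
  proof -
    have "((\<lambda>s. Y (c s)) has_derivative (\<lambda>h. D (h *\<^sub>R L (vel t)))) (at t within {\<alpha>..\<beta>})"
      by (rule has_derivative_compose[OF c'[unfolded has_vector_derivative_def] D])
    then show ?thesis
      using linear_scale[OF has_derivative_linear[OF D]] by (simp add: has_vector_derivative_def)
  qed
  then have "vel t = D (L (vel t))"
    using vector_derivative_unique_within_closed_interval[OF \<alpha>\<beta>] t Yc by simp
  then show thesis using that[OF c'] by (simp add: D_def)
qed

lemma nrm_nz: "z \<in> U \<Longrightarrow> nrm Y z \<noteq> 0"
  using regular_paramD[OF reg, folded Y_def] by (intro nrm_nonzero) auto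

lemma c_der:
  assumes t: "t \<in> {\<alpha>..\<beta>}"
  shows "(c has_vector_derivative Complex (lift_x Y (c t) (vel t)) (lift_y Y (c t) (vel t))) (at t within {\<alpha>..\<beta>})"
proof -
  obtain u where u: "(c has_vector_derivative u) (at t within {\<alpha>..\<beta>})" "vel t = Re u *\<^sub>R pd_x Y (c t) + Im u *\<^sub>R pd_y Y (c t)"
    by (rule velocity[OF t])
  have "u = Complex (lift_x Y (c t) (vel t)) (lift_y Y (c t) (vel t))"
    unfolding complex_eq_iff complex.sel lift_x_def lift_y_def nrm_def
    by (intro conjI gram_cramer[OF nrm_nz[OF cU[OF t], unfolded nrm_def] u(2)])
  then show ?thesis using u by simp
qed

lemma vel_eq:
  assumes t: "t \<in> {\<alpha>..\<beta>}"
  shows "vel t = lift_x Y (c t) (vel t) *\<^sub>R pd_x Y (c t) + lift_y Y (c t) (vel t) *\<^sub>R pd_y Y (c t)"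
proof -
  obtain u where u: "(c has_vector_derivative u) (at t within {\<alpha>..\<beta>})" "vel t = Re u *\<^sub>R pd_x Y (c t) + Im u *\<^sub>R pd_y Y (c t)"
    by (rule velocity[OF t])
  have "Re u = lift_x Y (c t) (vel t)" "Im u = lift_y Y (c t) (vel t)"
    unfolding lift_x_def lift_y_def nrm_def by (rule gram_cramer[OF nrm_nz[OF cU[OF t], unfolded nrm_def] u(2)])+
  then show ?thesis using u(2) by metis
qed

text \<open>Since \<open>vel\<close> is tangential at all times, its inner product with the normal
  vanishes identically. The derivative of this identity gives the normal component of the
  acceleration, which is all of it.\<close>

lemma acc_eq:
  assumes t: "t \<in> {\<alpha>..\<beta>}"
  shows "acc t = geodesic_acc Y (c t) (vel t)"
proof -
  note r = regular_paramD[OF reg, folded Y_def]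
  define z where "z = c t"
  define u where "u = Complex (lift_x Y z (vel t)) (lift_y Y z (vel t))"
  have z: "z \<in> U" using cU[OF t] by (simp add: z_def)
  have t01: "t \<in> {0..1}" using t J by auto
  have c': "(c has_derivative (\<lambda>h. h *\<^sub>R u)) (at t within {\<alpha>..\<beta>})"
    using c_der[OF t] by (simp add: u_def z_def has_vector_derivative_def)
  note dP = has_derivative_compose[OF c' C_infinityD(2)[OF C_infinity_pd(1)[OF r(3)] r(1) z, unfolded z_def]]
  note dQ = has_derivative_compose[OF c' C_infinityD(2)[OF C_infinity_pd(2)[OF r(3)] r(1) z, unfolded z_def]]
  have dn: "((\<lambda>s. nrm Y (c s)) has_derivative (\<lambda>h. h *\<^sub>R (Re u *\<^sub>R nrm_x Y z + Im u *\<^sub>R nrm_y Y z))) (at t within {\<alpha>..\<beta>})"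
    unfolding nrm_def
    by (rule has_derivative_eq_rhs[OF bounded_bilinear.FDERIV[OF bounded_bilinear_cross3 dP dQ]])
      (auto simp: nrm_x_def nrm_y_def z_def cross_add_left cross_add_right cross_mult_left cross_mult_right algebra_simps)
  have dv: "(vel has_derivative (\<lambda>h. h *\<^sub>R acc t)) (at t within {\<alpha>..\<beta>})"
    using has_vector_derivative_within_subset[OF acc[OF t01] J] by (simp add: has_vector_derivative_def)
  have "((\<lambda>s. vel s \<bullet> nrm Y (c s)) has_vector_derivative (acc t \<bullet> nrm Y z + vel t \<bullet> (Re u *\<^sub>R nrm_x Y z + Im u *\<^sub>R nrm_y Y z))) (at t within {\<alpha>..\<beta>})"
    unfolding has_vector_derivative_def
    by (rule has_derivative_eq_rhs[OF has_derivative_inner[OF dv dn]]) (auto simp: z_def algebra_simps)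
  moreover have "((\<lambda>s. vel s \<bullet> nrm Y (c s)) has_vector_derivative 0) (at t within {\<alpha>..\<beta>})"
  proof (rule has_vector_derivative_transform[OF t _ has_vector_derivative_const])
    fix s assume s: "s \<in> {\<alpha>..\<beta>}"
    show "vel s \<bullet> nrm Y (c s) = 0"
      by (subst vel_eq[OF s]) (simp add: nrm_def inner_add_left dot_cross_self)
  qed
  ultimately have an: "acc t \<bullet> nrm Y z + vel t \<bullet> (Re u *\<^sub>R nrm_x Y z + Im u *\<^sub>R nrm_y Y z) = 0"
    using vector_derivative_unique_within_closed_interval[OF \<alpha>\<beta>] t by simp
  have "acc t \<bullet> pd_x Y z = 0" "acc t \<bullet> pd_y Y z = 0"
    using acc_orth[OF t01] pd_tangent[OF reg z] \<phi>c[OF t] by (auto simp: Y_def z_def)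
  from orthogonal_eq_normal_component[OF this nrm_nz[OF z, unfolded nrm_def]]
  have "acc t = (acc t \<bullet> sgn (nrm Y z)) *\<^sub>R sgn (nrm Y z)" by (simp add: nrm_def)
  also have "\<dots> = (inverse (nrm Y z \<bullet> nrm Y z) * (acc t \<bullet> nrm Y z)) *\<^sub>R nrm Y z"
    by (simp add: sgn_div_norm power2_eq_square flip: power2_norm_eq_inner)
  also have "acc t \<bullet> nrm Y z = - (vel t \<bullet> (Re u *\<^sub>R nrm_x Y z + Im u *\<^sub>R nrm_y Y z))" using an by linarith
  finally show ?thesis by (simp add: geodesic_acc_def u_def z_def)
qed

end

section \<open>Uniqueness, locally in a chart and on the whole interval\<close>

lemma close_pair_diffE:
  assumes "close_pair J e f1 f2"
  obtains B where "0 \<le> B" "\<And>t. t \<in> J \<Longrightarrow> norm (f1 t - f2 t) \<le> B * e t"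
  using assms unfolding close_pair_def by blast

text \<open>The squared distance w between the two states satisfies |w'| \<le> K w by the Lipschitz
  estimates for the right sides, so it vanishes once it vanishes somewhere. Squares are used because
  they remain differentiable where the states meet.\<close>

lemma geodesics_in_chart_agree:
  assumes "geodesic_in_chart X S U \<phi> V \<psi> \<gamma>1 vel1 acc1 \<alpha> \<beta>" "geodesic_in_chart X S U \<phi> V \<psi> \<gamma>2 vel2 acc2 \<alpha> \<beta>"
    and r: "cball c0 r \<subseteq> U" "\<And>t. t \<in> {\<alpha>..\<beta>} \<Longrightarrow> \<psi> (\<gamma>1 t) \<in> cball c0 r" "\<And>t. t \<in> {\<alpha>..\<beta>} \<Longrightarrow> \<psi> (\<gamma>2 t) \<in> cball c0 r"
    and t0: "t0 \<in> {\<alpha>..\<beta>}" "\<gamma>1 t0 = \<gamma>2 t0" "vel1 t0 = vel2 t0" and t: "t \<in> {\<alpha>..\<beta>}"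
  shows "\<gamma>1 t = \<gamma>2 t \<and> vel1 t = vel2 t"
proof -
  interpret g1: geodesic_in_chart X S U \<phi> V \<psi> \<gamma>1 vel1 acc1 \<alpha> \<beta> by fact
  interpret g2: geodesic_in_chart X S U \<phi> V \<psi> \<gamma>2 vel2 acc2 \<alpha> \<beta> by fact
  define Y where "Y = X \<circ> \<phi>"
  have Y12: "g1.Y = Y" "g2.Y = Y" unfolding g1.Y_def g2.Y_def Y_def by simp_all
  define J where "J = {\<alpha>..\<beta>}"
  note reg = regular_paramD[OF g1.reg, folded Y_def]
  define c1 where "c1 = g1.c" define c2 where "c2 = g2.c"
  define e where "e t = norm (c1 t - c2 t) + norm (vel1 t - vel2 t)" for t
  have ball: "c1 t \<in> cball c0 r" "c2 t \<in> cball c0 r" if "t \<in> J" for t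
    using r that by (auto simp: J_def c1_def c2_def g1.c_def g2.c_def)
  have e: "norm (c1 t - c2 t) \<le> e t" "0 \<le> e t" for t by (auto simp: e_def)
  have bdd: "\<exists>B. \<forall>t\<in>J. norm (v t) \<le> B"
    if v: "\<And>t. t \<in> {0..1} \<Longrightarrow> (v has_vector_derivative a t) (at t within {0..1})" for v a :: "real \<Rightarrow> real^3"
  proof -
    have "continuous_on {0..1} v"
      by (rule continuous_on_vector_derivative[OF v])
    then have "bounded (v ` {0..1})" using compact_continuous_image compact_Icc compact_imp_bounded by blast
    then show ?thesis using g1.J unfolding J_def bounded_iff by blast
  qed
  obtain B1 where B1: "\<And>t. t \<in> J \<Longrightarrow> norm (vel1 t) \<le> B1" using bdd[OF g1.acc] by blast
  obtain B2 where B2: "\<And>t. t \<in> J \<Longrightarrow> norm (vel2 t) \<le> B2" using bdd[OF g2.acc] by blast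
  have cv: "close_pair J e vel1 vel2"
  proof (rule close_pairI[where B="max B1 B2" and C=1])
    show "norm (vel1 t) \<le> max B1 B2" "norm (vel2 t) \<le> max B1 B2" if "t \<in> J" for t using B1[OF that] B2[OF that] by auto
  qed (auto simp: e_def)
  have nz: "nrm Y z \<noteq> 0" if "z \<in> U" for z by (rule nrm_nonzero[OF reg(5)[OF that] reg(4)[OF that]])
  have field: "close_pair J e (\<lambda>t. lift_x Y (c1 t) (vel1 t)) (\<lambda>t. lift_x Y (c2 t) (vel2 t))"
    "close_pair J e (\<lambda>t. lift_y Y (c1 t) (vel1 t)) (\<lambda>t. lift_y Y (c2 t) (vel2 t))"
    "close_pair J e (\<lambda>t. geodesic_acc Y (c1 t) (vel1 t)) (\<lambda>t. geodesic_acc Y (c2 t) (vel2 t))"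
    by (rule close_pair_geodesic_field[OF reg(3,1) r(1)]; (rule cv e(1) | erule nz ball))+
  obtain A where A: "0 \<le> A" "\<And>t. t \<in> J \<Longrightarrow> norm (lift_x Y (c1 t) (vel1 t) - lift_x Y (c2 t) (vel2 t)) \<le> A * e t"
    using field(1) by (rule close_pair_diffE) (rule that)
  obtain B where B: "0 \<le> B" "\<And>t. t \<in> J \<Longrightarrow> norm (lift_y Y (c1 t) (vel1 t) - lift_y Y (c2 t) (vel2 t)) \<le> B * e t"
    using field(2) by (rule close_pair_diffE) (rule that)
  obtain C where C: "0 \<le> C" "\<And>t. t \<in> J \<Longrightarrow> norm (geodesic_acc Y (c1 t) (vel1 t) - geodesic_acc Y (c2 t) (vel2 t)) \<le> C * e t"
    using field(3) by (rule close_pair_diffE) (rule that)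
  define d where "d t = Complex (lift_x Y (c1 t) (vel1 t)) (lift_y Y (c1 t) (vel1 t)) - Complex (lift_x Y (c2 t) (vel2 t)) (lift_y Y (c2 t) (vel2 t))" for t
  define a where "a t = acc1 t - acc2 t" for t
  have dd: "((\<lambda>s. c1 s - c2 s) has_derivative (\<lambda>h. h *\<^sub>R d t)) (at t within {\<alpha>..\<beta>})" if "t \<in> J" for t
    using has_vector_derivative_diff[OF g1.c_der g2.c_der, of t] that
    by (simp add: has_vector_derivative_def d_def c1_def c2_def Y12 J_def)
  have da: "((\<lambda>s. vel1 s - vel2 s) has_derivative (\<lambda>h. h *\<^sub>R a t)) (at t within {\<alpha>..\<beta>})" if "t \<in> J" for t
    using has_vector_derivative_within_subset[OF has_vector_derivative_diff[OF g1.acc g2.acc, of t] g1.J] that g1.J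
    by (auto simp: has_vector_derivative_def a_def J_def)
  have nd: "norm (d t) \<le> (A + B) * e t" if "t \<in> J" for t
    using cmod_le[of "d t"] A(2)[OF that] B(2)[OF that] by (simp add: d_def algebra_simps)
  have na: "norm (a t) \<le> C * e t" if "t \<in> J" for t
    using C(2)[OF that] g1.acc_eq[of t] g2.acc_eq[of t] that by (simp add: a_def J_def Y12 c1_def c2_def)
  define w where "w t = (c1 t - c2 t) \<bullet> (c1 t - c2 t) + (vel1 t - vel2 t) \<bullet> (vel1 t - vel2 t)" for t
  define w' where "w' t = 2 * ((c1 t - c2 t) \<bullet> d t) + 2 * ((vel1 t - vel2 t) \<bullet> a t)" for t
  have "w t = 0"
  \<comment> \<open>In the constant, one factor 2 comes from differentiating squares, the other from
    \<open>(e t)\<^sup>2 \<le> 2 * w t\<close>.\<close>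
  proof (rule Gronwall_zero[where w=w and w'=w' and K="4 * (A + B + C)" and a=\<alpha> and b=\<beta> and ?t0.0=t0])
    show "(w has_real_derivative w' t) (at t within {\<alpha>..\<beta>})" if "t \<in> {\<alpha>..\<beta>}" for t
      unfolding w_def[abs_def] has_field_derivative_def
      by (rule has_derivative_eq_rhs[OF has_derivative_add[OF has_derivative_inner[OF dd dd] has_derivative_inner[OF da da]]])
        (use that in \<open>auto simp: J_def w'_def inner_commute algebra_simps\<close>)
    show "0 \<le> w t" if "t \<in> {\<alpha>..\<beta>}" for t by (simp add: w_def)
    show "w t0 = 0" using t0 by (simp add: w_def c1_def c2_def g1.c_def g2.c_def)
    show "\<bar>w' t\<bar> \<le> 4 * (A + B + C) * w t" if "t \<in> {\<alpha>..\<beta>}" for t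
    proof -
      have tJ: "t \<in> J" using that by (simp add: J_def)
      have "\<bar>(c1 t - c2 t) \<bullet> d t\<bar> \<le> e t * ((A + B) * e t)"
        by (rule order_trans[OF Cauchy_Schwarz_ineq2]) (intro mult_mono nd tJ e norm_ge_zero)
      moreover have "\<bar>(vel1 t - vel2 t) \<bullet> a t\<bar> \<le> e t * (C * e t)"
        by (rule order_trans[OF Cauchy_Schwarz_ineq2]) (intro mult_mono na tJ e norm_ge_zero, simp add: e_def)
      ultimately have "\<bar>w' t\<bar> \<le> 2 * (A + B + C) * (e t)\<^sup>2"
        unfolding w'_def by (simp add: power2_eq_square algebra_simps)
      also have "\<dots> \<le> 2 * (A + B + C) * (2 * w t)"
      proof (rule mult_left_mono)
        show "(e t)\<^sup>2 \<le> 2 * w t"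
          using sum_squares_bound[of "norm (c1 t - c2 t)" "norm (vel1 t - vel2 t)"]
          by (simp add: e_def w_def power2_sum flip: power2_norm_eq_inner)
      qed (use A(1) B(1) C(1) in simp)
      finally show ?thesis by (simp add: algebra_simps)
    qed
  qed (use t0 t in auto)
  then have "c1 t = c2 t" "vel1 t = vel2 t"
    unfolding w_def by (auto simp: add_nonneg_eq_0_iff)
  then show ?thesis using g1.\<phi>c[OF t] g2.\<phi>c[OF t] by (simp add: c1_def c2_def)
qed

text \<open>The times at which both positions and velocities agree form a nonempty subset of the
  connected interval [0, 1]; it is closed because the space is Hausdorff, and open by uniqueness
  inside a chart. Velocities are included because agreement of positions alone does not
  propagate.\<close>

theorem geodesic_unique:
  fixes X :: "'a::t2_space \<Rightarrow> real^3"
  assumes S: "immersed_surface X S" and g1: "geodesic_from X S p v \<gamma>1" and g2: "geodesic_from X S p v \<gamma>2"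
    and t: "t \<in> {0..1}"
  shows "\<gamma>1 t = \<gamma>2 t"
proof -
  obtain vel1 acc1 where 1: "vel1 0 = v"
     "\<And>t. t \<in> {0..1} \<Longrightarrow> ((X \<circ> \<gamma>1) has_vector_derivative vel1 t) (at t within {0..1})"
     "\<And>t. t \<in> {0..1} \<Longrightarrow> (vel1 has_vector_derivative acc1 t) (at t within {0..1})"
     "\<And>t w. t \<in> {0..1} \<Longrightarrow> w \<in> tangent_plane X S (\<gamma>1 t) \<Longrightarrow> acc1 t \<bullet> w = 0"
    using g1 unfolding geodesic_from_def by blast
  obtain vel2 acc2 where 2: "vel2 0 = v"
     "\<And>t. t \<in> {0..1} \<Longrightarrow> ((X \<circ> \<gamma>2) has_vector_derivative vel2 t) (at t within {0..1})"
     "\<And>t. t \<in> {0..1} \<Longrightarrow> (vel2 has_vector_derivative acc2 t) (at t within {0..1})"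
     "\<And>t w. t \<in> {0..1} \<Longrightarrow> w \<in> tangent_plane X S (\<gamma>2 t) \<Longrightarrow> acc2 t \<bullet> w = 0"
    using g2 unfolding geodesic_from_def by blast
  have \<gamma>: "continuous_on {0..1} \<gamma>1" "continuous_on {0..1} \<gamma>2" "\<gamma>1 0 = p" "\<gamma>2 0 = p" "\<gamma>1 ` {0..1} \<subseteq> S" "\<gamma>2 ` {0..1} \<subseteq> S"
    using g1 g2 by (auto simp: geodesic_from_def path_def pathstart_def path_image_def)
  have cv: "continuous_on {0..1} vel1" "continuous_on {0..1} vel2"
    by (rule continuous_on_vector_derivative, erule 1(3)) (rule continuous_on_vector_derivative, erule 2(3))
  define A where "A = {t\<in>{0..1}. \<gamma>1 t = \<gamma>2 t \<and> vel1 t = vel2 t}"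
  have "closedin (top_of_set {0..1}) A"
  proof -
    let ?F = "\<lambda>t. ((\<gamma>1 t, vel1 t), (\<gamma>2 t, vel2 t))"
    have "closedin (top_of_set {0..1}) ({0..1} \<inter> ?F -` {y. \<exists>x. y = (x, x)})"
      by (intro continuous_closedin_preimage closed_diagonal continuous_on_Pair \<gamma> cv)
    also have "{0..1} \<inter> ?F -` {y. \<exists>x. y = (x, x)} = A" by (auto simp: A_def)
    finally show ?thesis .
  qed
  moreover have "openin (top_of_set {0..1}) A"
    unfolding openin_contains_cball
  proof (intro conjI ballI)
    show "A \<subseteq> {0..1}" by (auto simp: A_def)
    fix t0 assume "t0 \<in> A"
    then have t0: "0 \<le> t0" "t0 \<le> 1" "\<gamma>1 t0 = \<gamma>2 t0" "vel1 t0 = vel2 t0" by (auto simp: A_def)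
    then have "\<gamma>1 t0 \<in> S" using subsetD[OF \<gamma>(5) imageI[of t0]] t0(1,2) by simp
    then obtain U \<phi> V where reg: "regular_param X S U \<phi> V" "\<gamma>1 t0 \<in> V" using S unfolding immersed_surface_def by blast
    obtain \<psi> where hom: "homeomorphism U V \<phi> \<psi>" using regular_paramD(6)[OF reg(1)] by blast
    define c0 where "c0 = \<psi> (\<gamma>1 t0)"
    have c0: "c0 \<in> U" "\<phi> c0 = \<gamma>1 t0" using hom reg(2) unfolding c0_def homeomorphism_def by auto
    obtain r where r: "0 < r" "cball c0 r \<subseteq> U" using regular_paramD(1)[OF reg(1)] c0(1) open_contains_cball by blast
    \<comment> \<open>Points of \<open>W\<close> have coordinates in a ball whose closure lies in
      the chart domain, where the Lipschitz estimates hold.\<close>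
    define W where "W = \<phi> ` (U \<inter> ball c0 r)"
    have "openin (top_of_set U) (U \<inter> ball c0 r)" by (auto simp: openin_open)
    then have "openin (top_of_set V) W" unfolding W_def by (rule homeomorphism_imp_open_map[OF hom])
    then have oW: "openin (top_of_set S) W" using regular_paramD(2)[OF reg(1)] openin_trans by blast
    have W: "x \<in> V" "\<psi> x \<in> cball c0 r" if "x \<in> W" for x
      using that hom unfolding W_def homeomorphism_def by auto
    have "\<gamma>1 t0 \<in> W" using c0 r unfolding W_def by force
    define T where "T = ({0..1} \<inter> \<gamma>1 -` W) \<inter> ({0..1} \<inter> \<gamma>2 -` W)"
    have "openin (top_of_set {0..1}) T" unfolding T_def
      using \<gamma> oW by (intro openin_Int continuous_openin_preimage[where T=S]) auto
    moreover have "t0 \<in> T" using t0 \<open>\<gamma>1 t0 \<in> W\<close> by (auto simp: T_def)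
    ultimately obtain \<epsilon> where \<epsilon>: "0 < \<epsilon>" "cball t0 \<epsilon> \<inter> {0..1} \<subseteq> T" unfolding openin_contains_cball by blast
    \<comment> \<open>Clipping to [0, 1] leaves an interval of positive length, on which one-sided
      derivatives at the end points are still unique.\<close>
    define \<alpha> \<beta> where "\<alpha> = max 0 (t0 - \<epsilon>)" and "\<beta> = min 1 (t0 + \<epsilon>)"
    have J: "{\<alpha>..\<beta>} = cball t0 \<epsilon> \<inter> {0..1}" by (auto simp: \<alpha>_def \<beta>_def cball_eq_atLeastAtMost)
    have "\<alpha> < \<beta>" using t0 \<epsilon>(1) by (auto simp: \<alpha>_def \<beta>_def)
    have inW: "\<gamma>1 t \<in> W" "\<gamma>2 t \<in> W" if "t \<in> {\<alpha>..\<beta>}" for t using that \<epsilon>(2) unfolding J T_def by auto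
    have G1: "geodesic_in_chart X S U \<phi> V \<psi> \<gamma>1 vel1 acc1 \<alpha> \<beta>"
      by unfold_locales (use reg(1) hom \<open>\<alpha> < \<beta>\<close> J \<gamma> inW(1) W(1) 1 in auto)
    have G2: "geodesic_in_chart X S U \<phi> V \<psi> \<gamma>2 vel2 acc2 \<alpha> \<beta>"
      by unfold_locales (use reg(1) hom \<open>\<alpha> < \<beta>\<close> J \<gamma> inW(2) W(1) 2 in auto)
    have "\<gamma>1 t = \<gamma>2 t \<and> vel1 t = vel2 t" if "t \<in> {\<alpha>..\<beta>}" for t
    proof (rule geodesics_in_chart_agree[OF G1 G2 r(2) _ _ _ t0(3,4) that])
      show "t0 \<in> {\<alpha>..\<beta>}" using t0 \<epsilon>(1) by (auto simp: \<alpha>_def \<beta>_def)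
    qed (use inW W in auto)
    then show "\<exists>e>0. cball t0 e \<inter> {0..1} \<subseteq> A" using \<epsilon>(1) J by (intro exI[of _ \<epsilon>]) (auto simp: A_def)
  qed
  moreover have "0 \<in> A" using 1(1) 2(1) \<gamma> by (simp add: A_def)
  ultimately have "A = {0..1}" using connected_Icc[of "0::real" 1] unfolding connected_clopen by blast
  then have "t \<in> A" using t by simp
  then show ?thesis by (simp add: A_def)
qed

section \<open>The exponential map\<close>

text \<open>Uniqueness of geodesics makes the definite description in \<open>exp_map\<close> denote
  the end point.\<close>

lemma exp_map_eq:
  fixes X :: "'a::t2_space \<Rightarrow> real^3"
  assumes S: "immersed_surface X S" and \<gamma>: "geodesic_from X S p v \<gamma>"
  shows "exp_map X S p v = \<gamma> 1"
  unfolding exp_map_def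
proof (rule the_equality)
  show "\<exists>\<gamma>'. geodesic_from X S p v \<gamma>' \<and> pathfinish \<gamma>' = \<gamma> 1" using \<gamma> by (auto simp: pathfinish_def)
  fix q assume "\<exists>\<gamma>'. geodesic_from X S p v \<gamma>' \<and> pathfinish \<gamma>' = q"
  then show "q = \<gamma> 1" using geodesic_unique[OF S _ \<gamma>, of _ 1] by (auto simp: pathfinish_def)
qed

text \<open>Reparametrization exhibits \<gamma>(s) as the end point of the geodesic with initial
  velocity \<open>s *\<^sub>R v\<close>, so rays of the tangent plane are carried to geodesics. The
  bound \<open>s \<le> 1\<close> keeps s t in the parameter interval.\<close>

lemma geodesic_from_scale:
  assumes \<gamma>: "geodesic_from X S p v \<gamma>" and s: "0 \<le> s" "s \<le> 1"
  shows "geodesic_from X S p (s *\<^sub>R v) (\<lambda>t. \<gamma> (s * t))"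
proof -
  obtain vel acc where va: "vel 0 = v"
     "\<And>t. t \<in> {0..1} \<Longrightarrow> ((X \<circ> \<gamma>) has_vector_derivative vel t) (at t within {0..1})"
     "\<And>t. t \<in> {0..1} \<Longrightarrow> (vel has_vector_derivative acc t) (at t within {0..1})"
     "\<And>t w. t \<in> {0..1} \<Longrightarrow> w \<in> tangent_plane X S (\<gamma> t) \<Longrightarrow> acc t \<bullet> w = 0"
    using \<gamma> unfolding geodesic_from_def by blast
  have st: "s * t \<in> {0..1}" if "t \<in> {0..1}" for t using s that by (auto simp: mult_le_one)
  have chain: "((\<lambda>t. f (s * t)) has_vector_derivative s *\<^sub>R f' (s * t)) (at t within {0..1})"
    if f: "\<And>t. t \<in> {0..1} \<Longrightarrow> (f has_vector_derivative f' t) (at t within {0..1})" and t: "t \<in> {0..1}" for f :: "real \<Rightarrow> 'b" and f' t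
  proof -
    have "((\<lambda>t. s * t) has_vector_derivative s) (at t within {0..1})"
      by (auto intro!: derivative_eq_intros)
    moreover have "(f has_vector_derivative f' (s * t)) (at (s * t) within (\<lambda>t. s * t) ` {0..1})"
      by (rule has_vector_derivative_within_subset[OF f[OF st[OF t]]]) (use st in auto)
    ultimately show ?thesis using vector_diff_chain_within unfolding o_def by blast
  qed
  show ?thesis unfolding geodesic_from_def
  proof (intro conjI exI ballI)
    show "path (\<lambda>t. \<gamma> (s * t))" using \<gamma> st unfolding geodesic_from_def path_def
      by (elim conjE, elim continuous_on_compose2) (auto intro!: continuous_intros)
    show "path_image (\<lambda>t. \<gamma> (s * t)) \<subseteq> S" using \<gamma> st unfolding geodesic_from_def path_image_def by auto
    show "pathstart (\<lambda>t. \<gamma> (s * t)) = p" using \<gamma> by (simp add: geodesic_from_def pathstart_def)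
    show "(\<lambda>t. s *\<^sub>R vel (s * t)) 0 = s *\<^sub>R v" using va(1) by simp
    fix t :: real assume t: "t \<in> {0..1}"
    show "((X \<circ> (\<lambda>t. \<gamma> (s * t))) has_vector_derivative s *\<^sub>R vel (s * t)) (at t within {0..1})"
      using chain[OF va(2) t] by (simp add: o_def)
    show "((\<lambda>t. s *\<^sub>R vel (s * t)) has_vector_derivative (\<lambda>t. s *\<^sub>R s *\<^sub>R acc (s * t)) t) (at t within {0..1})"
      using bounded_linear.has_vector_derivative[OF bounded_linear_scaleR_right chain[OF va(3) t], of s] by simp
    show "(\<lambda>t. s *\<^sub>R s *\<^sub>R acc (s * t)) t \<bullet> w = 0" if "w \<in> tangent_plane X S (\<gamma> (s * t))" for w
      using va(4)[OF st[OF t] that] by simp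
  qed
qed

section \<open>Normal charts and their expansion property\<close>

lemma vector_derivative_unique_unit_interval:
  assumes "t \<in> {0..1}" "(f has_vector_derivative a) (at t within {0..1})" "(f has_vector_derivative b) (at t within {0..1})"
  shows "a = b"
  using vector_derivative_unique_within_closed_interval[of 0 1 t f a b] assms by simp

text \<open>A geodesic disk with a chosen identification \<iota> of the plane with the tangent
  plane. It is a parameter because the comparison is made along one axis, and \<iota> will be
  rotated to bring any given ray there.\<close>

locale normal_chart =
  fixes X :: "'a::t2_space \<Rightarrow> real^3" and S :: "'a set" and p :: 'a and \<rho> :: real and \<iota> :: "complex \<Rightarrow> real^3"
  assumes minimal: "minimal_surface X S"
    and \<rho>: "0 < \<rho>"
    and dom: "{v \<in> tangent_plane X S p. norm v < \<rho>} \<subseteq> exp_dom X S p"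
    and lin: "linear \<iota>" and isom: "\<And>z. norm (\<iota> z) = norm z" and range: "range \<iota> = tangent_plane X S p"
    and param: "regular_param X S (ball 0 \<rho>) (exp_map X S p \<circ> \<iota>) (surface_ball X S p \<rho>)"
begin

definition "E = exp_map X S p \<circ> \<iota>"
definition "Y = X \<circ> E"

lemma immersed: "immersed_surface X S" using minimal by (simp add: minimal_surface_def)

lemmas param' = param[folded E_def]
lemmas paramD = regular_paramD[OF param', folded Y_def]

lemma geodesic:
  assumes z: "z \<in> ball 0 \<rho>"
  obtains \<gamma> where "geodesic_from X S p (\<iota> z) \<gamma>" "\<And>t. t \<in> {0..1} \<Longrightarrow> \<gamma> t = E (of_real t * z)"
proof -
  have "\<iota> z \<in> tangent_plane X S p" by (simp flip: range)
  then have "\<iota> z \<in> exp_dom X S p" using dom isom[of z] z by auto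
  then obtain \<gamma> where \<gamma>: "geodesic_from X S p (\<iota> z) \<gamma>" by (auto simp: exp_dom_def)
  have "\<gamma> t = E (of_real t * z)" if "t \<in> {0..1}" for t
  proof -
    have "geodesic_from X S p (t *\<^sub>R \<iota> z) (\<lambda>s. \<gamma> (t * s))" using geodesic_from_scale[OF \<gamma>, of t] that by simp
    moreover have "of_real t * z = t *\<^sub>R z" by (simp add: scaleR_conv_of_real)
    ultimately show ?thesis using exp_map_eq[OF immersed] linear_scale[OF lin] by (simp add: E_def)
  qed
  then show thesis using that \<gamma> by blast
qed

lemma E_0: "E 0 = p"
proof -
  obtain \<gamma> where \<gamma>: "geodesic_from X S p (\<iota> 0) \<gamma>" "\<And>t. t \<in> {0..1} \<Longrightarrow> \<gamma> t = E (of_real t * 0)"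
    by (rule geodesic[of 0]) (use \<rho> in auto)
  then show ?thesis using \<gamma>(2)[of 0] by (simp add: geodesic_from_def pathstart_def)
qed

lemma ray_in_ball: "z \<in> ball 0 \<rho> \<Longrightarrow> t \<in> {0..1} \<Longrightarrow> of_real t * z \<in> ball 0 \<rho>" for z :: complex
  using mult_left_le_one_le[of "norm z" t] by (simp add: norm_mult)

lemma frechet_Y: "z \<in> ball 0 \<rho> \<Longrightarrow> frechet_derivative Y (at z) h = Re h *\<^sub>R pd_x Y z + Im h *\<^sub>R pd_y Y z"
  by (rule frechet_derivative_eq_pd[OF paramD(5)])

lemma ray_derivative:
  assumes z: "z \<in> ball 0 \<rho>" and t: "t \<in> {0..1}"
    and f: "C_infinity f (ball 0 \<rho>)"
  shows "((\<lambda>t. f (of_real t * z)) has_vector_derivative Re z *\<^sub>R pd_x f (of_real t * z) + Im z *\<^sub>R pd_y f (of_real t * z)) (at t within A)"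
proof -
  have m: "((\<lambda>t. of_real t * z) has_derivative (\<lambda>h. of_real h * z)) (at t within A)"
    by (auto intro!: derivative_eq_intros)
  have "((\<lambda>t. f (of_real t * z)) has_derivative (\<lambda>h. Re (of_real h * z) *\<^sub>R pd_x f (of_real t * z) + Im (of_real h * z) *\<^sub>R pd_y f (of_real t * z))) (at t within A)"
    by (rule has_derivative_compose[OF m C_infinityD(2)[OF f open_ball ray_in_ball[OF z t]]])
  then show ?thesis by (simp add: has_vector_derivative_def scaleR_add_right)
qed

text \<open>The geodesic with initial velocity \<open>\<iota> z\<close> is E(tz), so its velocity
  and acceleration are the first and second derivatives of Y along the ray. The acceleration at t =
  1 gives \<open>radial\<close>, the velocity at t = 0 gives \<open>iso\<close>.\<close>

lemma radial_chart: "radial_chart Y \<rho>"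
proof
  show "0 < \<rho>" by (rule \<rho>)
  show Ysm: "C_infinity Y (ball 0 \<rho>)" by (rule paramD(3))
  show "inj (frechet_derivative Y (at z))" if "z \<in> ball 0 \<rho>" for z by (rule paramD(4)[OF that])
  show "mean_curvature Y z = 0" if "z \<in> ball 0 \<rho>" for z
    using minimal param' that unfolding minimal_surface_def Y_def by blast
  note Px = C_infinity_pd(1)[OF Ysm] and Py = C_infinity_pd(2)[OF Ysm]
  have vel: "\<exists>vel acc. vel 0 = \<iota> z \<and> (\<forall>t\<in>{0..1}. vel t = frechet_derivative Y (at (of_real t * z)) z \<and>
      (vel has_vector_derivative acc t) (at t within {0..1}) \<and> (\<forall>h. acc t \<bullet> frechet_derivative Y (at (of_real t * z)) h = 0))"
    if z: "z \<in> ball 0 \<rho>" for z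
  proof -
    obtain \<gamma> where \<gamma>: "geodesic_from X S p (\<iota> z) \<gamma>" "\<And>t. t \<in> {0..1} \<Longrightarrow> \<gamma> t = E (of_real t * z)"
      by (rule geodesic[OF z]) (rule that)
    obtain vel acc where va: "vel 0 = \<iota> z"
     "\<And>t. t \<in> {0..1} \<Longrightarrow> ((X \<circ> \<gamma>) has_vector_derivative vel t) (at t within {0..1})"
     "\<And>t. t \<in> {0..1} \<Longrightarrow> (vel has_vector_derivative acc t) (at t within {0..1})"
     "\<And>t w. t \<in> {0..1} \<Longrightarrow> w \<in> tangent_plane X S (\<gamma> t) \<Longrightarrow> acc t \<bullet> w = 0"
      using \<gamma>(1) unfolding geodesic_from_def by blast
    have "vel t = frechet_derivative Y (at (of_real t * z)) z" if t: "t \<in> {0..1}" for t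
    proof -
      have "((\<lambda>t. Y (of_real t * z)) has_vector_derivative vel t) (at t within {0..1})"
        by (rule has_vector_derivative_transform[OF t _ va(2)[OF t]]) (simp add: Y_def \<gamma>(2))
      then show ?thesis
        unfolding frechet_Y[OF ray_in_ball[OF z t]] by (rule vector_derivative_unique_unit_interval[OF t _ ray_derivative[OF z t Ysm]])
    qed
    moreover have "acc t \<bullet> frechet_derivative Y (at (of_real t * z)) h = 0" if t: "t \<in> {0..1}" for t h
      using va(4)[OF t] pd_in_tangent_plane[OF param' ray_in_ball[OF z t]] \<gamma>(2)[OF t] by (simp add: Y_def)
    ultimately show ?thesis using va by blast
  qed
  show "((Re z)\<^sup>2 *\<^sub>R pd_x (pd_x Y) z + (2 * Re z * Im z) *\<^sub>R pd_x (pd_y Y) z + (Im z)\<^sup>2 *\<^sub>R pd_y (pd_y Y) z)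
         \<bullet> frechet_derivative Y (at z) h = 0" if z: "z \<in> ball 0 \<rho>" for z h
  proof -
    obtain vel acc where *: "\<forall>t\<in>{0..1}. vel t = frechet_derivative Y (at (of_real t * z)) z \<and>
      (vel has_vector_derivative acc t) (at t within {0..1}) \<and> (\<forall>h. acc t \<bullet> frechet_derivative Y (at (of_real t * z)) h = 0)"
      using vel[OF z] by blast
    have va: "\<And>t. t \<in> {0..1} \<Longrightarrow> vel t = frechet_derivative Y (at (of_real t * z)) z"
      "(vel has_vector_derivative acc 1) (at 1 within {0..1})" "acc 1 \<bullet> frechet_derivative Y (at z) h = 0"
      using * bspec[OF *, of 1] by auto
    have 1: "(1::real) \<in> {0..1}" by simp
    have "((\<lambda>t. Re z *\<^sub>R pd_x Y (of_real t * z) + Im z *\<^sub>R pd_y Y (of_real t * z)) has_vector_derivative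
        Re z *\<^sub>R (Re z *\<^sub>R pd_x (pd_x Y) (of_real 1 * z) + Im z *\<^sub>R pd_y (pd_x Y) (of_real 1 * z)) +
        Im z *\<^sub>R (Re z *\<^sub>R pd_x (pd_y Y) (of_real 1 * z) + Im z *\<^sub>R pd_y (pd_y Y) (of_real 1 * z))) (at 1 within {0..1})"
      by (intro has_vector_derivative_add bounded_linear.has_vector_derivative[OF bounded_linear_scaleR_right]
          ray_derivative[OF z 1 Px] ray_derivative[OF z 1 Py])
    moreover have "((\<lambda>t. Re z *\<^sub>R pd_x Y (of_real t * z) + Im z *\<^sub>R pd_y Y (of_real t * z)) has_vector_derivative acc 1) (at 1 within {0..1})"
      by (rule has_vector_derivative_transform[OF 1 _ va(2)]) (simp add: va(1) frechet_Y[OF ray_in_ball[OF z]])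
    ultimately have "acc 1 = Re z *\<^sub>R (Re z *\<^sub>R pd_x (pd_x Y) z + Im z *\<^sub>R pd_y (pd_x Y) z) +
        Im z *\<^sub>R (Re z *\<^sub>R pd_x (pd_y Y) z + Im z *\<^sub>R pd_y (pd_y Y) z)"
      using vector_derivative_unique_unit_interval[OF 1] by fastforce
    moreover have "pd_y (pd_x Y) z = pd_x (pd_y Y) z" by (rule pd_commute[OF open_ball z Ysm])
    ultimately have "acc 1 = (Re z)\<^sup>2 *\<^sub>R pd_x (pd_x Y) z + (2 * Re z * Im z) *\<^sub>R pd_x (pd_y Y) z + (Im z)\<^sup>2 *\<^sub>R pd_y (pd_y Y) z"
      using quadratic_form_scaleR[of 1 "Re z" "pd_x (pd_x Y) z" "Im z" "pd_x (pd_y Y) z" "pd_y (pd_y Y) z"] by simp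
    then show ?thesis using va(3) by simp
  qed
  show "norm (frechet_derivative Y (at 0) h) = norm h" for h
  proof (cases "h = 0")
    case False
    \<comment> \<open>Rays are available only inside the ball, so h is scaled to length \<rho>/2;
      linearity of the differential undoes the scaling.\<close>
    define k where "k = \<rho> / (2 * norm h)"
    have k: "0 < k" using False \<rho> by (simp add: k_def)
    have kh: "k *\<^sub>R h \<in> ball 0 \<rho>" using False \<rho> by (simp add: k_def)
    obtain vel and acc :: "real \<Rightarrow> real^3" where va: "vel 0 = \<iota> (k *\<^sub>R h)" "\<And>t. t \<in> {0..1} \<Longrightarrow> vel t = frechet_derivative Y (at (of_real t * (k *\<^sub>R h))) (k *\<^sub>R h)"
      using vel[OF kh] by blast
    have "frechet_derivative Y (at 0) (k *\<^sub>R h) = \<iota> (k *\<^sub>R h)" using va(1) va(2)[of 0] by simp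
    then have "norm (frechet_derivative Y (at 0) (k *\<^sub>R h)) = k * norm h" using isom[of "k *\<^sub>R h"] k by simp
    moreover have "linear (frechet_derivative Y (at 0))" using \<rho> by (intro linear_frechet_derivative paramD(5)) simp
    ultimately show ?thesis using k by (simp add: linear_scale)
  next
    case True
    have "linear (frechet_derivative Y (at 0))" using \<rho> by (intro linear_frechet_derivative paramD(5)) simp
    then show ?thesis using True by (simp add: linear_0)
  qed
qed

text \<open>Multiplication by c is an isometry preserving the ball, so precomposing with it keeps
  every property of the chart while moving the ray of c onto the positive real axis.\<close>

lemma rotated:
  assumes c: "norm c = 1"
  shows "normal_chart X S p \<rho> (\<lambda>z. \<iota> (c * z))"
proof (rule normal_chart.intro[OF minimal \<rho> dom])
  show "linear (\<lambda>z. \<iota> (c * z))"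
    using lin by (intro linearI) (simp_all add: linear_add linear_scale distrib_left)
  show "norm (\<iota> (c * z)) = norm z" for z by (simp add: isom norm_mult c)
  have c0: "c \<noteq> 0" using c by auto
  show "range (\<lambda>z. \<iota> (c * z)) = tangent_plane X S p"
  proof -
    have "range (\<lambda>z. c * z) = UNIV" using c0 by (metis surj_def nonzero_mult_div_cancel_left times_divide_eq_right)
    then have "range (\<iota> \<circ> (\<lambda>z. c * z)) = range \<iota>" by (simp only: image_comp[symmetric])
    then show ?thesis using range by (simp add: o_def)
  qed
  have cb: "c * z \<in> ball 0 \<rho>" if "z \<in> ball 0 \<rho>" for z using that c by (simp add: norm_mult)
  have eq: "exp_map X S p \<circ> (\<lambda>z. \<iota> (c * z)) = E \<circ> (\<lambda>z. c * z)" "X \<circ> (E \<circ> (\<lambda>z. c * z)) = (\<lambda>z. Y (c * z))"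
    by (auto simp: E_def Y_def)
  show "regular_param X S (ball 0 \<rho>) (exp_map X S p \<circ> (\<lambda>z. \<iota> (c * z))) (surface_ball X S p \<rho>)"
    unfolding regular_param_def eq
  proof (intro conjI ballI)
    show "openin (top_of_set S) (surface_ball X S p \<rho>)" by (rule paramD(2))
    have "homeomorphism (ball 0 \<rho>) (ball 0 \<rho>) (\<lambda>z. c * z) (\<lambda>z. z / c)"
      using c c0 by (intro homeomorphismI) (auto intro!: continuous_intros simp: norm_mult norm_divide)
    then show "\<exists>\<psi>. homeomorphism (ball 0 \<rho>) (surface_ball X S p \<rho>) (E \<circ> (\<lambda>z. c * z)) \<psi>"
      using paramD(6) homeomorphism_compose by blast
    show "C_infinity (\<lambda>z. Y (c * z)) (ball 0 \<rho>)"
      using paramD(3) C_times_rotate[OF open_ball cb] unfolding C_infinity_def by blast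
    fix z :: complex assume z: "z \<in> ball 0 \<rho>"
    have "((\<lambda>z. c * z) has_derivative (\<lambda>h. c * h)) (at z)" by (auto intro!: derivative_eq_intros)
    then have "((\<lambda>z. Y (c * z)) has_derivative (\<lambda>h. frechet_derivative Y (at (c * z)) (c * h))) (at z)"
      by (rule has_derivative_compose) (use paramD(5)[OF cb[OF z]] frechet_derivative_works in blast)
    from frechet_derivative_at[OF this] have "frechet_derivative (\<lambda>z. Y (c * z)) (at z) = frechet_derivative Y (at (c * z)) \<circ> (\<lambda>h. c * h)"
      by (simp add: o_def)
    moreover have "inj ((*) c)" using c0 by (auto intro: injI)
    ultimately show "inj (frechet_derivative (\<lambda>z. Y (c * z)) (at z))"
      using paramD(4)[OF cb[OF z]] by (simp add: inj_compose)
  qed simp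
qed

text \<open>In the chart rotated by the direction c of z, the point z sits at |z| on the real axis,
  and the partial derivatives there are the derivatives of Y at z along c and ic.\<close>

lemma polar_frame:
  assumes z: "z \<in> ball 0 \<rho>"
  obtains c where "norm c = 1" "z = of_real (norm z) * c" "norm (frechet_derivative Y (at z) c) = 1"
    "frechet_derivative Y (at z) c \<bullet> frechet_derivative Y (at z) (\<i> * c) = 0" "1 \<le> norm (frechet_derivative Y (at z) (\<i> * c))"
proof -
  \<comment> \<open>At the centre any unit vector serves; 1 is chosen.\<close>
  define c where "c = (if z = 0 then 1 else sgn z)"
  have "norm c = 1" by (simp add: c_def norm_sgn)
  moreover have "z = of_real (norm z) * c" by (simp add: c_def sgn_div_norm scaleR_conv_of_real)
  ultimately have c: "norm c = 1" "z = of_real (norm z) * c" .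
  interpret r: normal_chart X S p \<rho> "\<lambda>z. \<iota> (c * z)" by (rule rotated[OF c(1)])
  have rY: "r.Y = (\<lambda>z. Y (c * z))" by (auto simp: r.Y_def r.E_def Y_def E_def)
  interpret rc: radial_chart r.Y \<rho> by (rule r.radial_chart)
  define s where "s = norm z"
  have s: "0 \<le> s" "s < \<rho>" using z by (auto simp: s_def)
  have cs: "c * Complex s 0 = z" using c(2) by (simp add: s_def complex_of_real_def mult.commute)
  have "((\<lambda>z. c * z) has_derivative (\<lambda>h. c * h)) (at (Complex s 0))" by (auto intro!: derivative_eq_intros)
  moreover have "(Y has_derivative frechet_derivative Y (at z)) (at (c * Complex s 0))"
    unfolding cs using paramD(5)[OF z] frechet_derivative_works by blast
  ultimately have d: "((\<lambda>z. Y (c * z)) has_derivative (\<lambda>h. frechet_derivative Y (at z) (c * h))) (at (Complex s 0))"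
    by (rule has_derivative_compose)
  have "pd_x r.Y (Complex s 0) = frechet_derivative Y (at z) c" "pd_y r.Y (Complex s 0) = frechet_derivative Y (at z) (\<i> * c)"
    unfolding rY using pd_unique[OF d] by (simp_all add: mult.commute)
  then show thesis
    using that[OF c] rc.axis_P[OF s] rc.axis_orth[OF s] rc.axis_expanding[OF s] by (simp add: norm_eq_1)
qed

text \<open>The frame of \<open>polar_frame\<close> multiplied by |z|, the form in which logarithmic
  polar coordinates use it.\<close>

lemma radial_stretch:
  assumes z: "z \<in> ball 0 \<rho>"
  shows "norm (frechet_derivative Y (at z) z) = norm z"
    "frechet_derivative Y (at z) z \<bullet> frechet_derivative Y (at z) (\<i> * z) = 0"
    "norm z \<le> norm (frechet_derivative Y (at z) (\<i> * z))"
proof -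
  obtain c where c: "norm c = 1" "z = of_real (norm z) * c" "norm (frechet_derivative Y (at z) c) = 1"
    "frechet_derivative Y (at z) c \<bullet> frechet_derivative Y (at z) (\<i> * c) = 0" "1 \<le> norm (frechet_derivative Y (at z) (\<i> * c))"
    by (rule polar_frame[OF z]) (rule that)
  have l: "linear (frechet_derivative Y (at z))" using z by (intro linear_frechet_derivative paramD(5))
  have "z = norm z *\<^sub>R c" "\<i> * z = norm z *\<^sub>R (\<i> * c)" using c(2) by (simp_all add: scaleR_conv_of_real)
  then have D: "frechet_derivative Y (at z) z = norm z *\<^sub>R frechet_derivative Y (at z) c"
    "frechet_derivative Y (at z) (\<i> * z) = norm z *\<^sub>R frechet_derivative Y (at z) (\<i> * c)"
    using linear_scale[OF l] by metis+
  show "norm (frechet_derivative Y (at z) z) = norm z"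
    "frechet_derivative Y (at z) z \<bullet> frechet_derivative Y (at z) (\<i> * z) = 0"
    "norm z \<le> norm (frechet_derivative Y (at z) (\<i> * z))"
    unfolding D using c mult_left_mono[OF c(5), of "norm z"] by simp_all
qed

text \<open>The unit frame c, ic has orthogonal images of length 1 and at least 1, so Pythagoras
  bounds the image of every vector from below.\<close>

lemma expanding:
  assumes z: "z \<in> ball 0 \<rho>"
  shows "norm h \<le> norm (frechet_derivative Y (at z) h)"
proof -
  obtain c where c: "norm c = 1" "z = of_real (norm z) * c" "norm (frechet_derivative Y (at z) c) = 1"
    "frechet_derivative Y (at z) c \<bullet> frechet_derivative Y (at z) (\<i> * c) = 0" "1 \<le> norm (frechet_derivative Y (at z) (\<i> * c))"
    by (rule polar_frame[OF z]) (rule that)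
  define u v where "u = frechet_derivative Y (at z) c" and "v = frechet_derivative Y (at z) (\<i> * c)"
  have l: "linear (frechet_derivative Y (at z))" using z by (intro linear_frechet_derivative paramD(5))
  define a where "a = h / c"
  have "c \<noteq> 0" using c by auto
  then have "h = a * c" by (simp add: a_def)
  also have "\<dots> = (of_real (Re a) + \<i> * of_real (Im a)) * c" by (simp flip: complex_eq)
  finally have "h = Re a *\<^sub>R c + Im a *\<^sub>R (\<i> * c)" by (simp add: scaleR_conv_of_real algebra_simps)
  then have D: "frechet_derivative Y (at z) h = Re a *\<^sub>R u + Im a *\<^sub>R v"
    by (simp only: linear_add[OF l] linear_scale[OF l] u_def v_def)
  have "(norm h)\<^sup>2 = (Re a)\<^sup>2 + (Im a)\<^sup>2" using \<open>h = a * c\<close> c by (simp add: norm_mult cmod_power2)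
  also have "\<dots> \<le> (Re a)\<^sup>2 * (norm u)\<^sup>2 + (Im a)\<^sup>2 * (norm v)\<^sup>2"
    using c(3,5) by (intro add_mono) (auto simp: u_def v_def mult_le_cancel_left1)
  also have "\<dots> = (norm (Re a *\<^sub>R u + Im a *\<^sub>R v))\<^sup>2"
    using c(4) unfolding power2_norm_eq_inner u_def[symmetric] v_def[symmetric]
    by (simp add: inner_add_left inner_add_right inner_commute[of v u] power2_eq_square)
  finally show ?thesis unfolding D by (rule power2_le_imp_le) simp
qed

end

section \<open>Distances from the centre and geodesic annuli\<close>

context normal_chart
begin

lemma E_ball: "E ` ball 0 \<rho> = surface_ball X S p \<rho>" and E_inj: "inj_on E (ball 0 \<rho>)"
  and E_cont: "continuous_on (ball 0 \<rho>) E" and E_in_S: "z \<in> ball 0 \<rho> \<Longrightarrow> E z \<in> S"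
proof -
  obtain \<psi> where "homeomorphism (ball 0 \<rho>) (surface_ball X S p \<rho>) E \<psi>" using paramD(6) by blast
  then show "E ` ball 0 \<rho> = surface_ball X S p \<rho>" "continuous_on (ball 0 \<rho>) E" "inj_on E (ball 0 \<rho>)"
    unfolding homeomorphism_def by (auto intro: inj_on_inverseI)
  then show "z \<in> ball 0 \<rho> \<Longrightarrow> E z \<in> S" unfolding surface_ball_def by blast
qed

text \<open>Away from t = 0 this is \<open>radial_stretch\<close> at tz divided by t; at the centre
  it is the isometry of the differential.\<close>

lemma ray_speed:
  assumes z: "z \<in> ball 0 \<rho>" and t: "t \<in> {0..1}"
  shows "norm (frechet_derivative Y (at (of_real t * z)) z) = norm z"
proof (cases "t = 0")
  case True
  interpret radial_chart Y \<rho> by (rule radial_chart)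
  show ?thesis using iso True by simp
next
  case False
  note b = ray_in_ball[OF z t]
  have l: "linear (frechet_derivative Y (at (of_real t * z)))" by (intro linear_frechet_derivative paramD(5) b)
  have "of_real t * z = t *\<^sub>R z" by (simp add: scaleR_conv_of_real)
  then have "frechet_derivative Y (at (of_real t * z)) (of_real t * z) = t *\<^sub>R frechet_derivative Y (at (of_real t * z)) z"
    using linear_scale[OF l, of t z] by simp
  then have "t * norm (frechet_derivative Y (at (of_real t * z)) z) = t * norm z"
    using radial_stretch(1)[OF b] t by (simp add: norm_mult)
  then show ?thesis using False by simp
qed

text \<open>The radial segment has constant speed |z|, which makes it an admissible competitor of
  length |z| in the infimum that defines the distance.\<close>

lemma radial_path:
  assumes z: "z \<in> ball 0 \<rho>"
  shows "path (\<lambda>t. E (of_real t * z))" "path_image (\<lambda>t. E (of_real t * z)) \<subseteq> S"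
    "valid_path (X \<circ> (\<lambda>t. E (of_real t * z)))"
    "((\<lambda>t. norm (vector_derivative (X \<circ> (\<lambda>t. E (of_real t * z))) (at t))) has_integral norm z) {0..1}"
proof -
  have c: "continuous_on {0..1} (\<lambda>t. of_real t * z)" by (intro continuous_intros)
  show "path (\<lambda>t. E (of_real t * z))" unfolding path_def
    by (rule continuous_on_compose2[OF E_cont c]) (use ray_in_ball[OF z] in auto)
  show "path_image (\<lambda>t. E (of_real t * z)) \<subseteq> S"
    unfolding path_image_def using E_in_S[OF ray_in_ball[OF z]] by auto
  have XE: "X \<circ> (\<lambda>t. E (of_real t * z)) = (\<lambda>t. Y (of_real t * z))" by (auto simp: Y_def)
  note Ysm = paramD(3)
  define D where "D t = Re z *\<^sub>R pd_x Y (of_real t * z) + Im z *\<^sub>R pd_y Y (of_real t * z)" for t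
  have D: "((\<lambda>t. Y (of_real t * z)) has_vector_derivative D t) (at t)" if "t \<in> {0..1}" for t
    unfolding D_def using ray_derivative[OF z that Ysm, of UNIV] by simp
  have "continuous_on {0..1} D" unfolding D_def
    by (intro continuous_intros continuous_on_compose2[OF C_infinity_continuous[OF C_infinity_pd(1)[OF Ysm]] c]
      continuous_on_compose2[OF C_infinity_continuous[OF C_infinity_pd(2)[OF Ysm]] c]) (use ray_in_ball[OF z] in auto)
  then have "(\<lambda>t. Y (of_real t * z)) C1_differentiable_on {0..1}"
    unfolding C1_differentiable_on_def using D by blast
  then show "valid_path (X \<circ> (\<lambda>t. E (of_real t * z)))"
    unfolding XE valid_path_def by (rule C1_differentiable_imp_piecewise)
  have "norm (vector_derivative (\<lambda>t. Y (of_real t * z)) (at t)) = norm z" if t: "t \<in> {0..1}" for t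
    using vector_derivative_at[OF D[OF t]] ray_speed[OF z t] frechet_Y[OF ray_in_ball[OF z t], of z] by (simp add: D_def)
  then show "((\<lambda>t. norm (vector_derivative (X \<circ> (\<lambda>t. E (of_real t * z))) (at t))) has_integral norm z) {0..1}"
    unfolding XE using has_integral_const_real[of "norm z" 0 1] by (subst has_integral_cong) auto
qed

text \<open>The lift of a path through the chart, stopped when it first meets the circle of radius \<open>norm z\<close>,
  is no longer than the path itself because the chart is expanding.\<close>

lemma norm_le_length:
  assumes z: "z \<in> ball 0 \<rho>"
    and \<gamma>: "path \<gamma>" "path_image \<gamma> \<subseteq> S" "pathstart \<gamma> = p" "pathfinish \<gamma> = E z" "valid_path (X \<circ> \<gamma>)"
    and L: "((\<lambda>t. norm (vector_derivative (X \<circ> \<gamma>) (at t))) has_integral L) {0..1}"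
  shows "norm z \<le> L"
proof (cases "z = 0")
  case True
  then show ?thesis using has_integral_nonneg[OF L] by simp
next
  case False
  define c where "c = norm z"
  have c: "0 < c" "c < \<rho>" using z False by (auto simp: c_def)
  obtain \<psi> where \<psi>: "homeomorphism (ball 0 \<rho>) (surface_ball X S p \<rho>) E \<psi>" using paramD(6) by blast
  have \<psi>E: "\<psi> (E w) = w" if "w \<in> ball 0 \<rho>" for w using \<psi> that unfolding homeomorphism_def by auto
  have \<psi>c: "continuous_on (surface_ball X S p \<rho>) \<psi>" using \<psi> unfolding homeomorphism_def by auto
  have \<gamma>c: "continuous_on {0..1} \<gamma>" and \<gamma>S: "\<And>t. t \<in> {0..1} \<Longrightarrow> \<gamma> t \<in> S" and \<gamma>01: "\<gamma> 0 = p" "\<gamma> 1 = E z"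
    using \<gamma> by (auto simp: path_def path_image_def pathstart_def pathfinish_def)
  have sub: "sphere 0 c \<subseteq> ball 0 \<rho>" "cball 0 c \<subseteq> ball 0 \<rho>" "ball 0 c \<subseteq> ball 0 \<rho>" using c by auto
  \<comment> \<open>Compact images are closed because the space is Hausdorff. Closedness inside the
    geodesic disk would not suffice, as the path may leave the disk.\<close>
  have closed: "closed (E ` sphere 0 c)" "closed (E ` cball 0 c)"
    by (auto intro!: compact_imp_closed compact_continuous_image continuous_on_subset[OF E_cont] sub)
  define T where "T = {0..1} \<inter> \<gamma> -` (E ` sphere 0 c)"
  have T: "closed T" unfolding T_def by (intro continuous_closed_preimage \<gamma>c closed) auto
  have "1 \<in> T" using \<gamma>01 by (auto simp: T_def c_def)
  define \<tau> where "\<tau> = Inf T"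
  have bdd: "bdd_below T" by (auto simp: T_def intro!: bdd_belowI[of _ 0])
  have \<tau>T: "\<tau> \<in> T" unfolding \<tau>_def by (rule closed_contains_Inf[OF _ bdd T]) (use \<open>1 \<in> T\<close> in auto)
  then have \<tau>01: "0 \<le> \<tau>" "\<tau> \<le> 1" by (auto simp: T_def)
  have notT: "t \<notin> T" if "t < \<tau>" for t using cInf_lower[OF _ bdd, of t] that unfolding \<tau>_def by fastforce
  have p0: "p \<in> E ` ball 0 c" using E_0 c by (force intro: image_eqI[of _ _ 0])
  have disj: "E ` ball 0 c \<inter> E ` sphere 0 c = {}"
    using inj_on_image_Int[OF E_inj sub(3) sub(1)] by (auto simp: set_eq_iff)
  have "\<tau> \<noteq> 0" using \<tau>T \<gamma>01 p0 disj by (auto simp: T_def)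
  then have \<tau>: "0 < \<tau>" using \<tau>01 by simp
  \<comment> \<open>Off the image of the circle, S is split by two relatively open sets, the image
    of the open disk and the complement of the image of the closed disk. Before \<tau> the path
    stays off the circle and starts in the former.\<close>
  have inside: "\<gamma> t \<in> E ` ball 0 c" if t: "0 \<le> t" "t < \<tau>" for t
  proof (rule ccontr)
    assume n: "\<gamma> t \<notin> E ` ball 0 c"
    let ?I = "{0..<\<tau>}"
    have cI: "continuous_on ?I \<gamma>" by (rule continuous_on_subset[OF \<gamma>c]) (use \<tau>01 in auto)
    have IS: "\<gamma> \<in> ?I \<rightarrow> S" using \<gamma>S \<tau>01 by auto
    have "openin (top_of_set (ball 0 \<rho>)) (ball 0 c)" by (intro open_subset sub open_ball)
    then have "openin (top_of_set (surface_ball X S p \<rho>)) (E ` ball 0 c)" by (rule homeomorphism_imp_open_map[OF \<psi>])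
    then have o1: "openin (top_of_set S) (E ` ball 0 c)" using paramD(2) openin_trans by blast
    have o2: "openin (top_of_set S) (S - E ` cball 0 c)" using closed(2) by (simp add: openin_closedin_eq closedin_closed Diff_Diff_Int) blast
    have "openin (top_of_set ?I) (?I \<inter> \<gamma> -` (E ` ball 0 c))" "openin (top_of_set ?I) (?I \<inter> \<gamma> -` (S - E ` cball 0 c))"
      using continuous_openin_preimage[OF cI IS o1] continuous_openin_preimage[OF cI IS o2] by auto
    moreover have "connected ?I" by simp
    moreover have "?I \<subseteq> (?I \<inter> \<gamma> -` (E ` ball 0 c)) \<union> (?I \<inter> \<gamma> -` (S - E ` cball 0 c))"
    proof
      fix s assume s: "s \<in> ?I"
      have "\<gamma> s \<notin> E ` sphere 0 c" using notT[of s] s \<tau>01 by (auto simp: T_def)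
      moreover have "cball 0 c = ball 0 c \<union> sphere (0::complex) c" by auto
      then have "E ` cball 0 c = E ` ball 0 c \<union> E ` sphere 0 c" by (simp add: image_Un)
      ultimately show "s \<in> (?I \<inter> \<gamma> -` (E ` ball 0 c)) \<union> (?I \<inter> \<gamma> -` (S - E ` cball 0 c))" using s IS by auto
    qed
    moreover have "(?I \<inter> \<gamma> -` (E ` ball 0 c)) \<inter> (?I \<inter> \<gamma> -` (S - E ` cball 0 c)) = {}" by auto
    moreover have "0 \<in> ?I \<inter> \<gamma> -` (E ` ball 0 c)" using \<tau> p0 \<gamma>01 by auto
    ultimately have "?I \<inter> \<gamma> -` (S - E ` cball 0 c) = {}" unfolding connected_openin by blast
    moreover have "t \<in> ?I" using t by simp
    ultimately show False using n \<open>?I \<subseteq> _\<close> by blast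
  qed
  define u where "u = \<psi> \<circ> \<gamma>"
  have u: "u t \<in> ball 0 \<rho>" "E (u t) = \<gamma> t" if "t \<in> {0..\<tau>}" for t
  proof -
    have "\<gamma> t \<in> E ` cball 0 c"
    proof (cases "t = \<tau>")
      case True then show ?thesis using \<tau>T by (auto simp: T_def)
    next
      case False then show ?thesis using inside[of t] that by auto
    qed
    then obtain w where "w \<in> ball 0 \<rho>" "\<gamma> t = E w" using sub by auto
    then show "u t \<in> ball 0 \<rho>" "E (u t) = \<gamma> t" using \<psi>E by (auto simp: u_def)
  qed
  have uc: "continuous_on {0..\<tau>} u"
  proof -
    have "\<gamma> ` {0..\<tau>} \<subseteq> surface_ball X S p \<rho>" using u E_ball by (metis image_eqI image_subsetI)
    then have "continuous_on (\<gamma> ` {0..\<tau>}) \<psi>" by (rule continuous_on_subset[OF \<psi>c])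
    moreover have "continuous_on {0..\<tau>} \<gamma>" by (rule continuous_on_subset[OF \<gamma>c]) (use \<tau>01 in auto)
    ultimately show ?thesis unfolding u_def by (intro continuous_on_compose)
  qed
  have u0: "u 0 = 0" using \<gamma>01 E_0 \<psi>E[of 0] \<rho> by (simp add: u_def)
  have u\<tau>: "norm (u \<tau>) = c"
  proof -
    obtain w where "w \<in> sphere 0 c" "\<gamma> \<tau> = E w" using \<tau>T by (auto simp: T_def)
    then show ?thesis using \<psi>E[of w] c(2) by (auto simp: u_def)
  qed
  obtain K where K: "finite K" "(X \<circ> \<gamma>) C1_differentiable_on ({0..1} - K)"
    using \<gamma>(5) unfolding valid_path_def piecewise_C1_differentiable_on_def by blast
  define g where "g t = norm (vector_derivative (X \<circ> \<gamma>) (at t))" for t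
  \<comment> \<open>Where X after the path is differentiable, injectivity of the differential of Y
    makes the lift u differentiable too, and expansion bounds its speed by that of the path.\<close>
  have u': "\<exists>d. (u has_vector_derivative d) (at t) \<and> norm d \<le> g t" if t: "t \<in> {0<..<\<tau>} - K" for t
  proof -
    obtain v where v: "((X \<circ> \<gamma>) has_vector_derivative v) (at t)"
      using K(2) t \<tau>01 unfolding C1_differentiable_on_def by force
    then have gt: "g t = norm v" by (simp add: g_def vector_derivative_at)
    have tt: "t \<in> {0..\<tau>}" using t by auto
    define D where "D = frechet_derivative Y (at (u t))"
    have D: "(Y has_derivative D) (at (u t))" unfolding D_def using paramD(5)[OF u(1)[OF tt]] frechet_derivative_works by blast
    obtain l where l: "linear l" "l \<circ> D = id"
      using linear_injective_left_inverse[OF has_derivative_linear[OF D]] paramD(4)[OF u(1)[OF tt]] by (auto simp: D_def)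
    have Yu: "((\<lambda>s. Y (u s)) has_derivative (\<lambda>h. h *\<^sub>R v)) (at t)"
    proof (rule has_derivative_transform_within_open[OF v[unfolded has_vector_derivative_def], of "{0<..<\<tau>}"])
      show "(X \<circ> \<gamma>) s = Y (u s)" if "s \<in> {0<..<\<tau>}" for s using u(2)[of s] that by (simp add: Y_def)
    qed (use t in auto)
    have "continuous (at t) u"
      using uc t by (metis DiffD1 continuous_on_interior interior_atLeastAtMost_real)
    from has_derivative_lift[OF D l this Yu] have "(u has_derivative (l \<circ> (\<lambda>h. h *\<^sub>R v))) (at t)" .
    then have d: "(u has_vector_derivative l v) (at t)" using l(1) by (simp add: has_vector_derivative_def o_def linear_scale)
    have "((\<lambda>s. Y (u s)) has_derivative (\<lambda>h. D (h *\<^sub>R l v))) (at t)"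
      by (rule has_derivative_compose[OF d[unfolded has_vector_derivative_def] D])
    with Yu have "(\<lambda>h. h *\<^sub>R v) = (\<lambda>h. D (h *\<^sub>R l v))" by (rule has_derivative_unique)
    from fun_cong[OF this, of 1] have "v = D (l v)" by simp
    then have "norm (l v) \<le> norm v" using expanding[OF u(1)[OF tt], of "l v"] by (simp add: D_def)
    then show ?thesis using d gt by auto
  qed
  then obtain d where d: "\<And>t. t \<in> {0<..<\<tau>} - K \<Longrightarrow> (u has_vector_derivative d t) (at t) \<and> norm (d t) \<le> g t" by metis
  \<comment> \<open>At the exceptional points the value 0 is taken, so that the norm is bounded by g
    everywhere.\<close>
  define d' where "d' t = (if t \<in> {0<..<\<tau>} - K then d t else 0)" for t
  have I: "(d' has_integral (u \<tau> - u 0)) {0..\<tau>}"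
    by (rule fundamental_theorem_of_calculus_interior_strong[OF K(1)]) (use \<tau> d uc in \<open>auto simp: d'_def\<close>)
  have g01: "g integrable_on {0..1}" "integral {0..1} g = L" using L by (auto simp: g_def[abs_def] has_integral_iff)
  have g\<tau>: "g integrable_on {0..\<tau>}" by (rule integrable_subinterval_real[OF g01(1)]) (use \<tau>01 in auto)
  have "norm (u \<tau> - u 0) \<le> integral {0..\<tau>} g"
    using I g\<tau> d by (subst integral_unique[OF I, symmetric], intro integral_norm_bound_integral) (auto simp: d'_def g_def)
  \<comment> \<open>The part of the path after \<tau> only adds length.\<close>
  also have "\<dots> \<le> integral {0..1} g"
    by (rule integral_subset_le) (use \<tau>01 g\<tau> g01 in \<open>auto simp: g_def\<close>)
  finally show ?thesis using u0 u\<tau> g01 by (simp add: c_def)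
qed

text \<open>The radial segment attains the lower bound \<open>norm_le_length\<close>, so the infimum
  is a minimum.\<close>

theorem surface_dist_E:
  assumes z: "z \<in> ball 0 \<rho>"
  shows "surface_dist X S p (E z) = norm z"
  unfolding surface_dist_def
proof (rule cInf_eq_minimum)
  show "norm z \<in> {L. \<exists>\<gamma>. path \<gamma> \<and> path_image \<gamma> \<subseteq> S \<and> pathstart \<gamma> = p \<and> pathfinish \<gamma> = E z \<and> valid_path (X \<circ> \<gamma>) \<and>
      ((\<lambda>t. norm (vector_derivative (X \<circ> \<gamma>) (at t))) has_integral L) {0..1}}"
    using radial_path[OF z] E_0 by (auto intro!: exI[of _ "\<lambda>t. E (of_real t * z)"] simp: pathstart_def pathfinish_def)
qed (use norm_le_length[OF z] in blast)

lemma surface_annulus_eq: "surface_annulus X S p \<rho>1 \<rho> = E ` {z. \<rho>1 < norm z \<and> norm z < \<rho>}"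
proof (intro equalityI subsetI)
  fix q assume q: "q \<in> surface_annulus X S p \<rho>1 \<rho>"
  then have "q \<in> E ` ball 0 \<rho>" unfolding E_ball by (auto simp: surface_annulus_def surface_ball_def)
  then obtain z where "z \<in> ball 0 \<rho>" "q = E z" by auto
  with q surface_dist_E[of z] show "q \<in> E ` {z. \<rho>1 < norm z \<and> norm z < \<rho>}" by (auto simp: surface_annulus_def)
next
  fix q assume "q \<in> E ` {z. \<rho>1 < norm z \<and> norm z < \<rho>}"
  then obtain z where z: "\<rho>1 < norm z" "norm z < \<rho>" "q = E z" by auto
  then show "q \<in> surface_annulus X S p \<rho>1 \<rho>"
    using surface_dist_E[of z] E_in_S[of z] by (auto simp: surface_annulus_def)
qed

lemma tangent_annulus_eq: "tangent_annulus X S p \<rho>1 \<rho> = \<iota> ` {z. \<rho>1 < norm z \<and> norm z < \<rho>}"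
  unfolding tangent_annulus_def range[symmetric] using isom by auto

lemma exp_tangent_annulus: "exp_map X S p ` tangent_annulus X S p \<rho>1 \<rho> = surface_annulus X S p \<rho>1 \<rho>"
  unfolding tangent_annulus_eq surface_annulus_eq by (simp add: E_def image_comp)

end

section \<open>Moduli of geodesic annuli\<close>

lemma frechet_radial_frame:
  assumes "f differentiable (at z)"
  shows "frechet_derivative f (at z) z = Re z *\<^sub>R pd_x f z + Im z *\<^sub>R pd_y f z"
    "frechet_derivative f (at z) (\<i> * z) = - Im z *\<^sub>R pd_x f z + Re z *\<^sub>R pd_y f z"
  using frechet_derivative_eq_pd[OF assms] by simp_all

text \<open>The vectors a and b are the columns of a similarity with factor |a|.\<close>

lemma conformal_inner:
  fixes a b :: "'b::real_inner"
  assumes "norm a = norm b" "a \<bullet> b = 0"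
  shows "(Re h *\<^sub>R a + Im h *\<^sub>R b) \<bullet> (Re h' *\<^sub>R a + Im h' *\<^sub>R b) = (norm a)\<^sup>2 * (h \<bullet> h')"
proof -
  have "b \<bullet> b = (norm a)\<^sup>2" "a \<bullet> a = (norm a)\<^sup>2" using assms(1) by (simp_all flip: power2_norm_eq_inner)
  then show ?thesis using assms(2) by (simp add: inner_add_left inner_add_right inner_commute[of b a] inner_complex_def algebra_simps)
qed

text \<open>A and B parametrize the same set, B conformally, and g is the transition between them.
  It is differentiable because B is an immersion, and as the differential of B is a similarity,
  orthogonality and stretching pass from A to g. The formulation with two abstract maps covers both
  uses: normal against isothermal parameters on the surface, and isothermal against linear ones in
  the tangent plane.\<close>

lemma annulus_modulus_le:
  fixes A B :: "complex \<Rightarrow> 'b::euclidean_space" and g k :: "complex \<Rightarrow> complex"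
  assumes \<rho>: "0 < \<rho>1" "\<rho>1 < \<rho>2"
    and hom: "homeomorphism {z. \<rho>1 < norm z \<and> norm z < \<rho>2} (circular_annulus R1 R2) g k"
    and B: "C_times (Suc 0) B (circular_annulus R1 R2)" "open (circular_annulus R1 R2)"
    and conf: "\<And>w. w \<in> circular_annulus R1 R2 \<Longrightarrow> norm (pd_x B w) = norm (pd_y B w) \<and> pd_x B w \<bullet> pd_y B w = 0 \<and> pd_x B w \<noteq> 0"
    and A: "C_times (Suc 0) A {z. \<rho>1 < norm z \<and> norm z < \<rho>2}"
    and AB: "\<And>z. \<rho>1 < norm z \<Longrightarrow> norm z < \<rho>2 \<Longrightarrow> B (g z) = A z"
    and nz: "\<And>z. \<rho>1 < norm z \<Longrightarrow> norm z < \<rho>2 \<Longrightarrow> frechet_derivative A (at z) z \<noteq> 0"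
    and orth: "\<And>z. \<rho>1 < norm z \<Longrightarrow> norm z < \<rho>2 \<Longrightarrow> frechet_derivative A (at z) z \<bullet> frechet_derivative A (at z) (\<i> * z) = 0"
    and stretch: "\<And>z. \<rho>1 < norm z \<Longrightarrow> norm z < \<rho>2 \<Longrightarrow> norm (frechet_derivative A (at z) z) \<le> norm (frechet_derivative A (at z) (\<i> * z))"
    and s: "0 \<le> R1" "s1 < s2" "R1 < ereal s1" "ereal s2 < R2"
  shows "ln s2 - ln s1 \<le> ln \<rho>2 - ln \<rho>1"
proof -
  define \<Omega> where "\<Omega> = {z::complex. \<rho>1 < norm z \<and> norm z < \<rho>2}"
  have \<Omega>: "z \<in> \<Omega> \<longleftrightarrow> \<rho>1 < norm z \<and> norm z < \<rho>2" for z :: complex by (simp add: \<Omega>_def)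
  have o: "open \<Omega>" unfolding \<Omega>_def by (intro open_Collect_conj open_Collect_less continuous_intros)
  have A': "C_times (Suc 0) A \<Omega>" using A by (simp add: \<Omega>_def)
  have g: "continuous_on \<Omega> g" "\<And>z. z \<in> \<Omega> \<Longrightarrow> g z \<in> circular_annulus R1 R2"
    using hom unfolding homeomorphism_def \<Omega>_def by auto
  \<comment> \<open>The adjoint of the differential of B divided by the square of the conformal
    factor, hence a left inverse of that differential.\<close>
  define L where "L w y = Complex ((pd_x B w \<bullet> y) / (norm (pd_x B w))\<^sup>2) ((pd_y B w \<bullet> y) / (norm (pd_x B w))\<^sup>2)" for w y
  define D where "D z = frechet_derivative A (at z)" for z
  define Dg where "Dg z = L (g z) \<circ> D z" for z
  define DB where "DB w h = Re h *\<^sub>R pd_x B w + Im h *\<^sub>R pd_y B w" for w h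
  have lin: "linear (L w)" for w
    by (intro linearI) (simp_all add: L_def inner_add_right add_divide_distrib complex_eq_iff)
  have LB: "L w \<circ> DB w = id" if w: "w \<in> circular_annulus R1 R2" for w
  proof
    fix h
    have "pd_x B w \<bullet> pd_x B w = (norm (pd_x B w))\<^sup>2" "pd_y B w \<bullet> pd_y B w = (norm (pd_x B w))\<^sup>2"
      using conf[OF w] by (simp_all flip: power2_norm_eq_inner)
    moreover have "pd_y B w \<noteq> 0" using conf[OF w] by auto
    ultimately show "(L w \<circ> DB w) h = id h"
      using conf[OF w] by (simp add: L_def DB_def inner_add_right inner_commute[of "pd_y B w" "pd_x B w"] complex_eq_iff)
  qed
  have derB: "(B has_derivative DB w) (at w)" if "w \<in> circular_annulus R1 R2" for w
    unfolding DB_def[abs_def] by (rule C_timesD(2)[OF B that])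
  have derA: "(A has_derivative D z) (at z)" if "z \<in> \<Omega>" for z :: complex
    unfolding D_def using C_timesD(1)[OF A' o that] frechet_derivative_works by blast
  have derBg: "((\<lambda>z. B (g z)) has_derivative D z) (at z)" if z: "z \<in> \<Omega>" for z
    by (rule has_derivative_transform_within_open[OF derA[OF z] o z]) (use AB in \<open>auto simp: \<Omega>\<close>)
  have derg: "(g has_derivative Dg z) (at z)" if z: "z \<in> \<Omega>" for z
    unfolding Dg_def using g(1) o z
    by (intro has_derivative_lift[OF derB[OF g(2)[OF z]] lin LB[OF g(2)[OF z]] _ derBg[OF z]])
      (simp add: continuous_on_eq_continuous_at)
  have DBg: "D z h = DB (g z) (Dg z h)" if z: "z \<in> \<Omega>" for z h
    using has_derivative_unique[OF derBg[OF z] has_derivative_compose[OF derg[OF z] derB[OF g(2)[OF z]]]]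
    by (rule fun_cong)
  have inner: "D z h \<bullet> D z h' = (norm (pd_x B (g z)))\<^sup>2 * (Dg z h \<bullet> Dg z h')" if z: "z \<in> \<Omega>" for z h h'
    unfolding DBg[OF z] DB_def using conf[OF g(2)[OF z]] by (intro conformal_inner) auto
  have pos: "0 < norm (pd_x B (g z))" if z: "z \<in> \<Omega>" for z
    unfolding zero_less_norm_iff using conf[OF g(2)[OF z]] by blast
  have norm: "norm (D z h) = norm (pd_x B (g z)) * norm (Dg z h)" if z: "z \<in> \<Omega>" for z h
  proof -
    have "(norm (D z h))\<^sup>2 = (norm (pd_x B (g z)) * norm (Dg z h))\<^sup>2"
      using inner[OF z, of h h] by (simp add: power_mult_distrib power2_norm_eq_inner)
    then show ?thesis by (simp add: power2_eq_iff_nonneg)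
  qed
  have Dz: "D z z = Re z *\<^sub>R pd_x A z + Im z *\<^sub>R pd_y A z" if "z \<in> \<Omega>" for z :: complex
    unfolding D_def by (rule frechet_radial_frame[OF C_timesD(1)[OF A' o that]])
  have cA: "continuous_on \<Omega> (\<lambda>z. D z z)"
  proof -
    have "continuous_on \<Omega> (\<lambda>z. Re z *\<^sub>R pd_x A z + Im z *\<^sub>R pd_y A z)"
      using A' by (intro continuous_intros) auto
    then show ?thesis using Dz by (simp cong: continuous_on_cong)
  qed
  have cB: "continuous_on \<Omega> (\<lambda>z. pd_x B (g z))" "continuous_on \<Omega> (\<lambda>z. pd_y B (g z))"
    using B(1) by (auto intro!: continuous_on_compose2[OF _ g(1)] g(2))
  have cont: "continuous_on \<Omega> (\<lambda>z. Dg z z)"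
    unfolding Dg_def L_def o_def Complex_eq using pos
    by (intro continuous_intros cA cB) force+
  show ?thesis
  proof (rule homeomorphic_annulus_modulus_le[OF \<rho> hom[unfolded circular_annulus_def], of Dg])
    show "continuous_on {z. \<rho>1 < norm z \<and> norm z < \<rho>2} (\<lambda>z. Dg z z)" using cont by (simp add: \<Omega>_def)
    fix z :: complex assume "\<rho>1 < norm z" "norm z < \<rho>2"
    then have z: "z \<in> \<Omega>" and b: "\<rho>1 < norm z" "norm z < \<rho>2" by (auto simp: \<Omega>)
    show "(g has_derivative Dg z) (at z)" by (rule derg[OF z])
    show "Dg z z \<noteq> 0" using nz[OF b] norm[OF z, of z] by (auto simp: D_def)
    show "Dg z z \<bullet> Dg z (\<i> * z) = 0" using orth[OF b] inner[OF z, of z "\<i> * z"] pos[OF z] by (simp add: D_def)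
    show "norm (Dg z z) \<le> norm (Dg z (\<i> * z))"
      using stretch[OF b] norm[OF z] pos[OF z] by (simp add: D_def[symmetric])
  qed (use s in auto)
qed

text \<open>Were \<open>R1 = 0\<close> or \<open>R2 = \<infinity>\<close>, two radii with quotient
  exp (l + 1) would fit inside the annulus. For finite radii the annulus is shrunk slightly at both
  ends. Positivity is recorded because the final strict inequality rests on it.\<close>

lemma exhaust_annulus:
  fixes R1 R2 :: ereal
  assumes R: "0 \<le> R1" "R1 < R2" and l: "0 \<le> l"
    and sub: "\<And>s1 s2. s1 < s2 \<Longrightarrow> R1 < ereal s1 \<Longrightarrow> ereal s2 < R2 \<Longrightarrow> ln s2 - ln s1 \<le> l"
  shows "R1 \<noteq> 0" "R2 \<noteq> \<infinity>" "ln (real_of_ereal R2 / real_of_ereal R1) \<le> l" "0 < ln (real_of_ereal R2 / real_of_ereal R1)"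
proof -
  have scale: "s < s * exp (l + 1)" if "0 < s" for s :: real using that l by simp
  show R1: "R1 \<noteq> 0"
  proof
    assume "R1 = 0"
    obtain s where s: "0 < ereal s" "ereal s < R2" using ereal_dense2[of 0 R2] R \<open>R1 = 0\<close> by auto
    then have "ln s - ln (s * exp (- (l + 1))) \<le> l"
      using l \<open>R1 = 0\<close> by (intro sub) auto
    then show False using s by (simp add: ln_mult)
  qed
  show R2: "R2 \<noteq> \<infinity>"
  proof
    assume "R2 = \<infinity>"
    obtain s where s: "R1 < ereal s" using ereal_dense2[of R1 R2] R by auto
    then have "0 < ereal s" using R by (metis le_less_trans)
    then have s0: "0 < s" by simp
    have "ln (s * exp (l + 1)) - ln s \<le> l"
      using s s0 scale \<open>R2 = \<infinity>\<close> by (intro sub) auto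
    then show False using s0 by (simp add: ln_mult)
  qed
  obtain a b where ab: "R1 = ereal a" "R2 = ereal b" using R R1 R2 by (cases R1; cases R2) auto
  have a: "0 < a" "a < b" using R R1 ab by auto
  then have lnab: "ln a < ln b" by simp
  have "ln b - ln a \<le> l"
  proof (rule ccontr)
    assume n: "\<not> ?thesis"
    \<comment> \<open>A quarter of the supposed excess over l: shrinking at both ends costs 2
      \<epsilon> and leaves half of the excess.\<close>
    define \<epsilon> where "\<epsilon> = (ln b - ln a - l) / 4"
    have \<epsilon>: "0 < \<epsilon>" using n by (simp add: \<epsilon>_def)
    have lns: "ln (b * exp (- \<epsilon>)) - ln (a * exp \<epsilon>) = ln b - ln a - 2 * \<epsilon>" using a by (simp add: ln_mult)
    moreover have "l < ln b - ln a - 2 * \<epsilon>" using n by (simp add: \<epsilon>_def field_simps)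
    ultimately have less: "l < ln (b * exp (- \<epsilon>)) - ln (a * exp \<epsilon>)" by simp
    then have "ln (a * exp \<epsilon>) < ln (b * exp (- \<epsilon>))" using l by linarith
    then have "a * exp \<epsilon> < b * exp (- \<epsilon>)" using a by (subst (asm) ln_less_cancel_iff) auto
    then have "ln (b * exp (- \<epsilon>)) - ln (a * exp \<epsilon>) \<le> l" using a \<epsilon> by (intro sub) (auto simp: ab)
    with less show False by simp
  qed
  then show "ln (real_of_ereal R2 / real_of_ereal R1) \<le> l" "0 < ln (real_of_ereal R2 / real_of_ereal R1)"
    using a lnab by (simp_all add: ab ln_div)
qed

lemma isothermal_paramD:
  assumes "isothermal_param X S U \<phi> V"
  shows "regular_param X S U \<phi> V"
    "\<And>w. w \<in> U \<Longrightarrow> norm (pd_x (X \<circ> \<phi>) w) = norm (pd_y (X \<circ> \<phi>) w) \<and> pd_x (X \<circ> \<phi>) w \<bullet> pd_y (X \<circ> \<phi>) w = 0 \<and> pd_x (X \<circ> \<phi>) w \<noteq> 0"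
proof -
  show reg: "regular_param X S U \<phi> V" using assms by (simp add: isothermal_param_def)
  fix w assume w: "w \<in> U"
  have "pd_x (X \<circ> \<phi>) w \<noteq> 0"
  proof
    assume "pd_x (X \<circ> \<phi>) w = 0"
    then have "frechet_derivative (X \<circ> \<phi>) (at w) 1 = frechet_derivative (X \<circ> \<phi>) (at w) 0"
      using frechet_derivative_eq_pd[OF regular_paramD(5)[OF reg w], of 0] by (simp add: pd_x_def)
    then show False using regular_paramD(4)[OF reg w] by (auto dest: injD)
  qed
  then show "norm (pd_x (X \<circ> \<phi>) w) = norm (pd_y (X \<circ> \<phi>) w) \<and> pd_x (X \<circ> \<phi>) w \<bullet> pd_y (X \<circ> \<phi>) w = 0 \<and> pd_x (X \<circ> \<phi>) w \<noteq> 0"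
    using assms w by (simp add: isothermal_param_def)
qed

section \<open>The moduli of the geodesic annulus and of the flat one\<close>

context normal_chart
begin

text \<open>The length-area estimate is applied to the transition from normal to isothermal
  coordinates, with the stretching supplied by \<open>radial_stretch\<close>. Exhausting the
  conformal annulus shows that M is finite as well.\<close>

lemma modulus_surface_annulus_le:
  assumes \<rho>1: "0 < \<rho>1" "\<rho>1 < \<rho>"
    and M: "has_conformal_modulus X S (surface_annulus X S p \<rho>1 \<rho>) M"
  obtains m where "M = ereal m" "0 < m" "m \<le> ln \<rho> - ln \<rho>1"
proof -
  obtain R1 R2 h where R: "0 \<le> R1" "R1 < R2"
    and iso: "isothermal_param X S (circular_annulus R1 R2) h (surface_annulus X S p \<rho>1 \<rho>)"
    and M: "M = (if R1 = 0 \<or> R2 = \<infinity> then \<infinity> else ereal (ln (real_of_ereal R2 / real_of_ereal R1)))"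
    using M unfolding has_conformal_modulus_def by blast
  note reg = regular_paramD[OF isothermal_paramD(1)[OF iso]]
  define \<Omega> where "\<Omega> = {z::complex. \<rho>1 < norm z \<and> norm z < \<rho>}"
  have \<Omega>: "\<Omega> \<subseteq> ball 0 \<rho>" "E ` \<Omega> = surface_annulus X S p \<rho>1 \<rho>" "open \<Omega>"
    unfolding \<Omega>_def by (auto simp: surface_annulus_eq intro!: open_Collect_conj open_Collect_less continuous_intros)
  obtain \<psi> where \<psi>: "homeomorphism (ball 0 \<rho>) (surface_ball X S p \<rho>) E \<psi>" using paramD(6) by blast
  have hE: "homeomorphism \<Omega> (surface_annulus X S p \<rho>1 \<rho>) E \<psi>"
    by (rule homeomorphism_of_subsets[OF \<psi> \<Omega>(1) _ \<Omega>(2)]) (use \<Omega> E_ball in auto)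
  obtain k where k: "homeomorphism (circular_annulus R1 R2) (surface_annulus X S p \<rho>1 \<rho>) h k" using reg(6) by blast
  have hom: "homeomorphism \<Omega> (circular_annulus R1 R2) (k \<circ> E) (\<psi> \<circ> h)"
    by (rule homeomorphism_compose[OF hE homeomorphism_symD[OF k]])
  have l: "0 \<le> ln \<rho> - ln \<rho>1" using \<rho>1 by simp
  have "ln s2 - ln s1 \<le> ln \<rho> - ln \<rho>1" if s: "s1 < s2" "R1 < ereal s1" "ereal s2 < R2" for s1 s2
  proof (rule annulus_modulus_le[OF \<rho>1 hom[unfolded \<Omega>_def], of "X \<circ> h" Y])
    show "C_times (Suc 0) (X \<circ> h) (circular_annulus R1 R2)" using reg(3) unfolding C_infinity_def by blast
    show "open (circular_annulus R1 R2)" by (rule reg(1))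
    have "C_times (Suc 0) Y (ball 0 \<rho>)" using paramD(3) unfolding C_infinity_def by blast
    then show "C_times (Suc 0) Y {z. \<rho>1 < norm z \<and> norm z < \<rho>}"
      using \<Omega>(1) unfolding \<Omega>_def[symmetric] by (auto intro: differentiable_on_subset continuous_on_subset)
    fix z :: complex assume z: "\<rho>1 < norm z" "norm z < \<rho>"
    then have zb: "z \<in> ball 0 \<rho>" by simp
    have "E z \<in> surface_annulus X S p \<rho>1 \<rho>" using z by (auto simp: surface_annulus_eq)
    then show "(X \<circ> h) ((k \<circ> E) z) = Y z" using k by (simp add: homeomorphism_def Y_def)
    show "frechet_derivative Y (at z) z \<noteq> 0" using radial_stretch(1)[OF zb] z \<rho>1 by auto
    show "frechet_derivative Y (at z) z \<bullet> frechet_derivative Y (at z) (\<i> * z) = 0" by (rule radial_stretch(2)[OF zb])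
    show "norm (frechet_derivative Y (at z) z) \<le> norm (frechet_derivative Y (at z) (\<i> * z))"
      using radial_stretch(1,3)[OF zb] by simp
  qed (use isothermal_paramD(2)[OF iso] R s in auto)
  note ex = exhaust_annulus[OF R l this]
  show thesis using that[of "ln (real_of_ereal R2 / real_of_ereal R1)"] ex M by auto
qed

text \<open>The roles are exchanged: the isothermal parameter domain is the source, and the round
  annulus, seen through \<iota>, is the target. Both parametrizations are conformal, so rays and
  circles are stretched equally, and the same estimate bounds ln \<rho> - ln \<rho>1 by m, the
  direction needed to pass from \<rho>/\<rho>1 to exp m.\<close>

lemma modulus_tangent_annulus_ge:
  assumes \<rho>1: "0 < \<rho>1" "\<rho>1 < \<rho>"
    and m: "has_conformal_modulus id (tangent_plane X S p) (tangent_annulus X S p \<rho>1 \<rho>) (ereal m)"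
  shows "ln \<rho> - ln \<rho>1 \<le> m"
proof -
  obtain R1 R2 h where R: "0 \<le> R1" "R1 < R2"
    and iso: "isothermal_param id (tangent_plane X S p) (circular_annulus R1 R2) h (tangent_annulus X S p \<rho>1 \<rho>)"
    and m: "ereal m = (if R1 = 0 \<or> R2 = \<infinity> then \<infinity> else ereal (ln (real_of_ereal R2 / real_of_ereal R1)))"
    using m unfolding has_conformal_modulus_def by blast
  \<comment> \<open>A finite modulus excludes the degenerate radii.\<close>
  then have R': "R1 \<noteq> 0" "R2 \<noteq> \<infinity>" by auto
  obtain a b where ab: "R1 = ereal a" "R2 = ereal b" using R R' by (cases R1; cases R2) auto
  have a: "0 < a" "a < b" using R R' ab by auto
  have m': "m = ln b - ln a" using m R' a by (simp add: ab ln_div)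
  define A where "A = circular_annulus R1 R2"
  have Aeq: "A = {z. a < norm z \<and> norm z < b}" by (simp add: A_def circular_annulus_def ab)
  define \<Omega> where "\<Omega> = circular_annulus (ereal \<rho>1) (ereal \<rho>)"
  have \<Omega>: "\<Omega> = {z. \<rho>1 < norm z \<and> norm z < \<rho>}" by (simp add: \<Omega>_def circular_annulus_def)
  have o: "open \<Omega>" unfolding \<Omega> by (intro open_Collect_conj open_Collect_less continuous_intros)
  note reg = regular_paramD[OF isothermal_paramD(1)[OF iso]]
  obtain L where L: "linear L" "L \<circ> \<iota> = id"
  proof -
    have "inj \<iota>" using isom by (subst linear_injective_0[OF lin]) (metis norm_eq_zero)
    then show thesis using linear_injective_left_inverse[OF lin] that by blast
  qed
  have Li: "L (\<iota> z) = z" for z using L(2) by (metis comp_apply id_apply)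
  have h\<iota>: "homeomorphism \<Omega> (tangent_annulus X S p \<rho>1 \<rho>) \<iota> L"
    unfolding tangent_annulus_eq \<Omega>
    by (intro homeomorphismI) (auto simp: Li linear_continuous_on linear_conv_bounded_linear[symmetric] lin L(1))
  obtain k where k: "homeomorphism A (tangent_annulus X S p \<rho>1 \<rho>) h k" using reg(6) unfolding A_def by blast
  have hom: "homeomorphism A \<Omega> (L \<circ> h) (k \<circ> \<iota>)"
    by (rule homeomorphism_compose[OF k homeomorphism_symD[OF h\<iota>]])
  have d\<iota>: "(\<iota> has_derivative \<iota>) (at w)" for w
    using lin by (simp add: linear_conv_bounded_linear bounded_linear_imp_has_derivative)
  have pd\<iota>: "pd_x \<iota> w = \<iota> 1" "pd_y \<iota> w = \<iota> \<i>" for w by (rule pd_unique[OF d\<iota>])+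
  have orth\<iota>: "\<iota> 1 \<bullet> \<iota> \<i> = 0"
  proof -
    have "(norm (\<iota> (1 + \<i>)))\<^sup>2 = 2" by (simp only: isom) (simp add: cmod_power2)
    moreover have "(norm (\<iota> (1 + \<i>)))\<^sup>2 = (norm (\<iota> 1))\<^sup>2 + (norm (\<iota> \<i>))\<^sup>2 + 2 * (\<iota> 1 \<bullet> \<iota> \<i>)"
      unfolding power2_norm_eq_inner linear_add[OF lin] by (simp add: inner_add_left inner_add_right inner_commute)
    ultimately show ?thesis by (simp add: isom)
  qed
  have "ln s2 - ln s1 \<le> ln b - ln a" if s: "s1 < s2" "ereal \<rho>1 < ereal s1" "ereal s2 < ereal \<rho>" for s1 s2
  proof (rule annulus_modulus_le[OF a hom[unfolded Aeq \<Omega>_def], of \<iota> "id \<circ> h"])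
    show "C_times (Suc 0) \<iota> (circular_annulus (ereal \<rho>1) (ereal \<rho>))"
    proof -
      have "pd_x \<iota> = (\<lambda>_. \<iota> 1)" "pd_y \<iota> = (\<lambda>_. \<iota> \<i>)" using pd\<iota> by auto
      moreover have "\<iota> differentiable_on circular_annulus (ereal \<rho>1) (ereal \<rho>)"
        by (rule differentiable_at_imp_differentiable_on) (rule differentiableI[OF d\<iota>])
      ultimately show ?thesis by simp
    qed
    show "open (circular_annulus (ereal \<rho>1) (ereal \<rho>))" using o by (simp add: \<Omega>_def)
    show "norm (pd_x \<iota> w) = norm (pd_y \<iota> w) \<and> pd_x \<iota> w \<bullet> pd_y \<iota> w = 0 \<and> pd_x \<iota> w \<noteq> 0" for w
      unfolding pd\<iota> using orth\<iota> isom[of 1] isom[of \<i>] by auto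
    show "C_times (Suc 0) (id \<circ> h) {z. a < norm z \<and> norm z < b}"
      using reg(3) unfolding C_infinity_def A_def[symmetric] Aeq by blast
    fix z :: complex assume z: "a < norm z" "norm z < b"
    then have zA: "z \<in> A" by (simp add: Aeq)
    then have "h z \<in> tangent_annulus X S p \<rho>1 \<rho>" using k by (auto simp: homeomorphism_def)
    then show "\<iota> ((L \<circ> h) z) = (id \<circ> h) z" by (auto simp: tangent_annulus_eq Li)
    have conf: "norm (pd_x (id \<circ> h) z) = norm (pd_y (id \<circ> h) z)" "pd_x (id \<circ> h) z \<bullet> pd_y (id \<circ> h) z = 0" "pd_x (id \<circ> h) z \<noteq> 0"
      using isothermal_paramD(2)[OF iso, of z] zA by (auto simp: A_def)
    define D where "D = frechet_derivative (id \<circ> h) (at z)"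
    have D: "D h' = Re h' *\<^sub>R pd_x (id \<circ> h) z + Im h' *\<^sub>R pd_y (id \<circ> h) z" for h'
      unfolding D_def using reg(5) zA by (intro frechet_derivative_eq_pd) (simp add: A_def)
    have inner: "D u \<bullet> D v = (norm (pd_x (id \<circ> h) z))\<^sup>2 * (u \<bullet> v)" for u v
      unfolding D by (rule conformal_inner[OF conf(1,2)])
    have nD: "norm (D u) = norm (pd_x (id \<circ> h) z) * norm u" for u
      using inner[of u u] by (simp add: norm_eq_sqrt_inner real_sqrt_mult)
    show "frechet_derivative (id \<circ> h) (at z) z \<noteq> 0"
      using nD[of z] conf(3) z a unfolding D_def[symmetric] by (metis mult_eq_0_iff norm_eq_zero norm_zero not_less order_less_imp_le)
    show "frechet_derivative (id \<circ> h) (at z) z \<bullet> frechet_derivative (id \<circ> h) (at z) (\<i> * z) = 0"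
      unfolding D_def[symmetric] inner by (simp add: inner_complex_def)
    show "norm (frechet_derivative (id \<circ> h) (at z) z) \<le> norm (frechet_derivative (id \<circ> h) (at z) (\<i> * z))"
      unfolding D_def[symmetric] nD by (simp add: norm_mult)
  qed (use \<rho>1 s in auto)
  from exhaust_annulus(3)[of "ereal \<rho>1" "ereal \<rho>" "ln b - ln a", OF _ _ _ this] show ?thesis
    using \<rho>1 a by (simp add: m' ln_div)
qed

end

text \<open>The modulus enters as a relation, so both forms are stated for every value that it
  relates to the annulus. In the second form the modulus of the flat annulus is a real number
  \<open>m\<close>, so that \<open>exp m\<close> makes sense.\<close>

theorem corollary1p2:
  fixes X :: "'a::{t2_space, second_countable_topology} \<Rightarrow> real^3"
    and S :: "'a set" and p :: 'a and \<rho>1 \<rho>2 :: real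
  assumes "minimal_surface X S" and "simply_connected S" and "\<not> whole_plane X S"
    and "p \<in> S" and "0 < \<rho>1" and "\<rho>1 < \<rho>2"
    and "geodesic_disk X S p \<rho>2"
  shows "(\<forall>M. has_conformal_modulus X S (surface_annulus X S p \<rho>1 \<rho>2) M \<longrightarrow>
              ereal (\<rho>2 / \<rho>1) > ereal (1/2) * M\<^sup>2 + 1) \<and>
         (\<forall>m M. has_conformal_modulus id (tangent_plane X S p)
                  (tangent_annulus X S p \<rho>1 \<rho>2) (ereal m) \<longrightarrow>
                has_conformal_modulus X S
                  (exp_map X S p ` tangent_annulus X S p \<rho>1 \<rho>2) M \<longrightarrow>
                ereal (exp m) > ereal (1/2) * M\<^sup>2 + 1)"
proof -
  obtain \<iota> where \<iota>: "linear \<iota>" "\<forall>z. norm (\<iota> z) = norm z" "range \<iota> = tangent_plane X S p"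
    "regular_param X S (ball 0 \<rho>2) (exp_map X S p \<circ> \<iota>) (surface_ball X S p \<rho>2)"
    using assms(7) unfolding geodesic_disk_def by blast
  interpret normal_chart X S p \<rho>2 \<iota>
    by (rule normal_chart.intro) (use assms \<iota> in \<open>auto simp: geodesic_disk_def\<close>)
  have main: "ereal (1/2) * M\<^sup>2 + 1 < ereal (\<rho>2 / \<rho>1)"
    if M: "has_conformal_modulus X S (surface_annulus X S p \<rho>1 \<rho>2) M" for M
  proof -
    obtain m where m: "M = ereal m" "0 < m" "m \<le> ln \<rho>2 - ln \<rho>1"
      by (rule modulus_surface_annulus_le[OF assms(5,6) M]) (rule that)
    \<comment> \<open>The linear term m > 0 of the exponential series is what makes the estimate
      strict.\<close>
    have "1/2 * m\<^sup>2 + 1 < 1 + m + m\<^sup>2 / 2" using m(2) by simp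
    also have "\<dots> \<le> exp m" using m(2) by (intro exp_lower_Taylor_quadratic) simp
    also have "\<dots> \<le> exp (ln \<rho>2 - ln \<rho>1)" using m(3) by simp
    also have "\<dots> = \<rho>2 / \<rho>1" using assms by (simp add: exp_diff)
    finally show ?thesis by (simp add: m(1) one_ereal_def)
  qed
  have "ereal (1/2) * M\<^sup>2 + 1 < ereal (exp m)"
    if m: "has_conformal_modulus id (tangent_plane X S p) (tangent_annulus X S p \<rho>1 \<rho>2) (ereal m)"
      and M: "has_conformal_modulus X S (exp_map X S p ` tangent_annulus X S p \<rho>1 \<rho>2) M" for m M
  proof -
    \<comment> \<open>The exponential map carries the flat annulus onto the geodesic one, so the
      first form applies; it remains to compare \<rho>2 / \<rho>1 with exp m.\<close>
    have "ereal (1/2) * M\<^sup>2 + 1 < ereal (\<rho>2 / \<rho>1)" using main M by (simp add: exp_tangent_annulus)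
    also have "\<rho>2 / \<rho>1 = exp (ln \<rho>2 - ln \<rho>1)" using assms by (simp add: exp_diff)
    also have "ereal \<dots> \<le> ereal (exp m)" using modulus_tangent_annulus_ge[OF assms(5,6) m] by simp
    finally show ?thesis .
  qed
  with main show ?thesis by blast
qed

end
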